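(* Let $\Sigma\in\operatorname{Range}_+\Gamma$ be fixed. Then the map $$s(\,\cdot\,,\Sigma):\ C_+(\mathbb T)\to\mathscr L_+^\Gamma,$$ which assigns to each $\psi\in C_+(\mathbb T)$ the unique $\Lambda\in\mathscr L_+^\Gamma$ satisfying $$\int G\,\psi\,(G^*\Lambda G)^{-1}G^*=\Sigma,$$ is of class $C^1$.
   Context: Let $n\ge m\ge 1$, $A\in\mathbb C^{n\times n}$ with all eigenvalues strictly inside the unit circle, $B\in\mathbb C^{n\times m}$ of full column rank, $(A,B)$ reachable, and $G(z)=(zI-A)^{-1}B$. $\mathbb T$ is the unit circle; on $\mathbb T$, $G^*(z)$ is the conjugate transpose of $G(z)$. All integrals are over $\mathbb T$ with respect to the normalized Lebesgue measure $d\theta/2\pi$, $z=e^{i\theta}$. $\mathfrak H_n$ is the real vector space of $n\times n$ Hermitian matrices and $\mathfrak H_{+,n}$ its subset of positive definite matrices. $C(\mathbb T;\mathfrak H_m)$ is the space of continuous $\mathfrak H_m$-valued functions on $\mathbb T$; $C(\mathbb T)=C(\mathbb T;\mathfrak H_1)$ is the real Banach space of continuous real-valued functions on $\mathbb T$ with the max-norm; $C_+(\mathbb T)$ is its open subset of functions with positive values. $\Gamma:C(\mathbb T;\mathfrak H_m)\to\mathfrak H_n$ is the linear operator $\Gamma(\Phi)=\int G\Phi G^*$; $\operatorname{Range}\Gamma\subset\mathfrak H_n$ is its range and $\operatorname{Range}_+\Gamma=\operatorname{Range}\Gamma\cap\mathfrak H_{+,n}$. $\mathscr L_+=\{\Lambda\in\mathfrak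 H_n: G^*(z)\Lambda G(z)>0\ \ \forall z\in\mathbb T\}$ and $\mathscr L_+^\Gamma=\mathscr L_+\cap\operatorname{Range}\Gamma$, an open subset of the finite-dimensional real vector space $\operatorname{Range}\Gamma$. It is known from earlier work that for each fixed $\psi\in C_+(\mathbb T)$ the map $\Lambda\mapsto\int G\psi(G^*\Lambda G)^{-1}G^*$ is a $C^1$ diffeomorphism from $\mathscr L_+^\Gamma$ onto $\operatorname{Range}_+\Gamma$, so $s(\psi,\Sigma)$ is well defined. "Class $C^1$" means continuously Fréchet differentiable between open subsets of real Banach spaces. *)

theory Defs
  imports "HOL-Analysis.Analysis"
begin

section \<open>The unit circle\<close>

text \<open>The circle is a type of its own so that the continuous real functions on it form the
  Banach space \<open>circle \<Rightarrow>\<^sub>C real\<close>; every continuous function on the compact circle is bounded,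
  so the supremum norm of that type is the maximum norm.\<close>

typedef circle = "sphere (0::complex) 1"
  morphisms complex_of_circle circle_of_complex
  by (rule exI[of _ 1]) simp

setup_lifting type_definition_circle

instantiation circle :: metric_space
begin

lift_definition dist_circle :: "circle \<Rightarrow> circle \<Rightarrow> real" is dist .

definition uniformity_circle :: "(circle \<times> circle) filter"
  where "uniformity_circle = (INF e\<in>{0<..}. principal {(x, y). dist x y < e})"

definition open_circle :: "circle set \<Rightarrow> bool"
  where "open_circle S \<longleftrightarrow> (\<forall>x\<in>S. \<forall>\<^sub>F (x', y) in uniformity. x' = x \<longrightarrow> y \<in> S)"

instance
proof
  fix x y z :: circle
  show "dist x y = 0 \<longleftrightarrow> x = y"
    by transfer simp
  show "dist x y \<le> dist x z + dist y z"
    by transfer (rule dist_triangle2)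
qed (simp_all only: uniformity_circle_def open_circle_def)

end

lift_definition cis_circle :: "real \<Rightarrow> circle" is cis
  by simp

text \<open>Integral with respect to the normalized Lebesgue measure on the circle.\<close>

definition circle_integral :: "(circle \<Rightarrow> 'a::{banach, second_countable_topology}) \<Rightarrow> 'a"
  where "circle_integral f = (LINT \<theta>:{0..2 * pi}|lborel. f (cis_circle \<theta>)) /\<^sub>R (2 * pi)"

instance bcontfun :: (metric_space, banach) banach ..

definition C_plus :: "(circle \<Rightarrow>\<^sub>C real) set"
  where "C_plus = {\<psi>. \<forall>z. 0 < apply_bcontfun \<psi> z}"

section \<open>Complex matrices\<close>

definition conj_transpose :: "complex^'c^'r \<Rightarrow> complex^'r^'c"
  where "conj_transpose M = (\<chi> i j. cnj (M $ j $ i))"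

definition Hermitian :: "(complex^'k^'k) set"
  where "Hermitian = {M. conj_transpose M = M}"

text \<open>For Hermitian matrices the quadratic form is real, so taking its real part loses nothing.\<close>

definition pos_def :: "complex^'k^'k \<Rightarrow> bool"
  where "pos_def M \<longleftrightarrow> M \<in> Hermitian \<and>
    (\<forall>x. x \<noteq> 0 \<longrightarrow> 0 < Re (\<Sum>i\<in>UNIV. cnj (x $ i) * (M *v x) $ i))"

definition eigenvalue :: "complex^'n^'n \<Rightarrow> complex \<Rightarrow> bool"
  where "eigenvalue A \<mu> \<longleftrightarrow> (\<exists>v. v \<noteq> 0 \<and> A *v v = \<mu> *s v)"

primrec mat_pow :: "complex^'n^'n \<Rightarrow> nat \<Rightarrow> complex^'n^'n"
  where "mat_pow A 0 = mat 1"
  | "mat_pow A (Suc k) = A ** mat_pow A k"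

text \<open>Reachability: the columns of \<open>[B, AB, \<dots>, A\<^sup>n\<^sup>-\<^sup>1 B]\<close> span the whole space.\<close>

definition reachable :: "complex^'n^'n \<Rightarrow> complex^'m^'n \<Rightarrow> bool"
  where "reachable A B \<longleftrightarrow> vec.span (\<Union>k<CARD('n). columns (mat_pow A k ** B)) = UNIV"

section \<open>The operator \<open>\<Gamma>\<close> and the constraint sets\<close>

definition transfer_G :: "complex^'n^'n \<Rightarrow> complex^'m^'n \<Rightarrow> circle \<Rightarrow> complex^'m^'n"
  where "transfer_G A B z = matrix_inv (mat (complex_of_circle z) - A) ** B"

definition transfer_G_adj :: "complex^'n^'n \<Rightarrow> complex^'m^'n \<Rightarrow> circle \<Rightarrow> complex^'n^'m"
  where "transfer_G_adj A B z = conj_transpose (transfer_G A B z)"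

definition C_Hermitian :: "(circle \<Rightarrow> complex^'m^'m) set"
  where "C_Hermitian = {\<Phi>. continuous_on UNIV \<Phi> \<and> (\<forall>z. \<Phi> z \<in> Hermitian)}"

definition Gamma ::
    "complex^'n^'n \<Rightarrow> complex^'m^'n \<Rightarrow> (circle \<Rightarrow> complex^'m^'m) \<Rightarrow> complex^'n^'n"
  where "Gamma A B \<Phi> = circle_integral (\<lambda>z. transfer_G A B z ** \<Phi> z ** transfer_G_adj A B z)"

definition Range_Gamma :: "complex^'n^'n \<Rightarrow> complex^'m^'n \<Rightarrow> (complex^'n^'n) set"
  where "Range_Gamma A B = Gamma A B ` C_Hermitian"

definition Range_Gamma_plus :: "complex^'n^'n \<Rightarrow> complex^'m^'n \<Rightarrow> (complex^'n^'n) set"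
  where "Range_Gamma_plus A B = Range_Gamma A B \<inter> {\<Sigma>. pos_def \<Sigma>}"

definition L_plus :: "complex^'n^'n \<Rightarrow> complex^'m^'n \<Rightarrow> (complex^'n^'n) set"
  where "L_plus A B = {\<Lambda> \<in> Hermitian. \<forall>z. pos_def (transfer_G_adj A B z ** \<Lambda> ** transfer_G A B z)}"

definition L_plus_Gamma :: "complex^'n^'n \<Rightarrow> complex^'m^'n \<Rightarrow> (complex^'n^'n) set"
  where "L_plus_Gamma A B = L_plus A B \<inter> Range_Gamma A B"

definition moment_map ::
    "complex^'n^'n \<Rightarrow> complex^'m^'n \<Rightarrow> (circle \<Rightarrow>\<^sub>C real) \<Rightarrow> complex^'n^'n \<Rightarrow> complex^'n^'n"
  where "moment_map A B \<psi> \<Lambda> =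
    circle_integral (\<lambda>z. transfer_G A B z **
      (apply_bcontfun \<psi> z *\<^sub>R matrix_inv (transfer_G_adj A B z ** \<Lambda> ** transfer_G A B z)) ** transfer_G_adj A B z)"

definition s_map ::
    "complex^'n^'n \<Rightarrow> complex^'m^'n \<Rightarrow> (circle \<Rightarrow>\<^sub>C real) \<Rightarrow> complex^'n^'n \<Rightarrow> complex^'n^'n"
  where "s_map A B \<psi> \<Sigma> = (THE \<Lambda>. \<Lambda> \<in> L_plus_Gamma A B \<and> moment_map A B \<psi> \<Lambda> = \<Sigma>)"

section \<open>Maps of class \<open>C\<^sup>1\<close>\<close>

text \<open>The target Banach space is a closed subspace \<open>W\<close> of the ambient type, with \<open>V\<close> open in \<open>W\<close>;
  accordingly the derivatives are bounded linear maps into \<open>W\<close>.\<close>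

definition C1_map :: "'a::banach set \<Rightarrow> 'b::banach set \<Rightarrow> 'b set \<Rightarrow> ('a \<Rightarrow> 'b) \<Rightarrow> bool"
  where "C1_map U W V f \<longleftrightarrow>
    open U \<and> subspace W \<and> closed W \<and> openin (top_of_set W) V \<and> f ` U \<subseteq> V \<and>
    (\<exists>D :: 'a \<Rightarrow> 'a \<Rightarrow>\<^sub>L 'b.
      continuous_on U D \<and>
      (\<forall>x\<in>U. (f has_derivative blinfun_apply (D x)) (at x) \<and> range (blinfun_apply (D x)) \<subseteq> W))"

end

theory Submission
  imports Defs "HOL-Complex_Analysis.Complex_Analysis"
begin

text \<open>
  Write \<open>G\<close> for the transfer function, \<open>Q\<^sub>\<Lambda> = G\<^sup>\<dagger> \<Lambda> G\<close> and \<open>K\<^sub>\<Lambda> = G Q\<^sub>\<Lambda>\<^sup>-\<^sup>1 G\<^sup>\<dagger>\<close>, so that the moment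
  equation reads \<open>\<integral> \<psi> K\<^sub>\<Lambda> = \<Sigma>\<close>.  Matrices carry the real inner product
  \<open>X \<bullet> Y = Re tr (X\<^sup>\<dagger> Y)\<close>; for it the operator \<open>\<Gamma>\<close> is adjoint to \<open>X \<mapsto> G\<^sup>\<dagger> X G\<close>, and therefore
  an element \<open>X\<close> of the range of \<open>\<Gamma>\<close> with \<open>G\<^sup>\<dagger> X G = 0\<close> on the circle is \<open>0\<close>.

  Smoothness comes from an exact identity.  The resolvent-type formula
  \<open>K\<^sub>M - K\<^sub>\<Lambda> = K\<^sub>M (\<Lambda> - M) K\<^sub>\<Lambda>\<close> turns the difference of two moment equations, for \<open>\<psi>, \<Lambda>\<close> and
  for \<open>\<phi>, M\<close>, into \<open>\<integral> \<psi> K\<^sub>M (M - \<Lambda>) K\<^sub>\<Lambda> = \<integral> (\<phi> - \<psi>) K\<^sub>M\<close> (\<open>moment_map_difference\<close>).  The operator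
  \<open>X \<mapsto> \<integral> \<psi> K\<^sub>M X K\<^sub>\<Lambda>\<close> has a positive quadratic form on the range of \<open>\<Gamma>\<close> (\<open>secant_op_pos\<close>), because
  \<open>D \<bullet> (P D R) > 0\<close> for positive definite \<open>P, R\<close> and \<open>D \<noteq> 0\<close>.  With \<open>\<phi> = \<psi>\<close> this is uniqueness.
  In general, compressing the operator to the range of \<open>\<Gamma>\<close> and inverting it gives
  \<open>s \<phi> - s \<psi> = D(\<psi>, \<phi>) (\<phi> - \<psi>)\<close> with bounded linear operators \<open>D(\<psi>, \<phi>)\<close> that depend
  continuously on \<open>\<psi>, \<phi>, s \<psi>, s \<phi>\<close>.  Once \<open>s\<close> is known to be continuous, \<open>D(\<psi>, \<psi>)\<close> is
  its derivative and is continuous in \<open>\<psi>\<close> (\<open>moment_solution_C1\<close>).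

  Continuity of \<open>s\<close> and existence of solutions both follow from a compactness statement
  (\<open>moment_map_proper\<close>): if \<open>\<psi>\<^sub>k \<rightarrow> \<psi>\<close> and the moments of \<open>\<psi>\<^sub>k, \<Lambda>\<^sub>k\<close> converge to a positive
  definite \<open>\<Sigma>\<close> in the range, then a subsequence of \<open>\<Lambda>\<^sub>k\<close> converges inside the constraint set.
  Two effects have to be excluded.

  \<^item> Escape to infinity.  The number \<open>\<Sigma> \<bullet> \<Lambda>\<close> is essentially \<open>m \<integral> \<psi>\<close> along the sequence, so it is
    enough that \<open>\<Sigma> \<bullet> \<Lambda> \<ge> c \<parallel>\<Lambda>\<parallel>\<close> for \<open>\<Lambda>\<close> in the range with \<open>Q\<^sub>\<Lambda> \<ge> 0\<close>.  This holds because \<open>\<Sigma>\<close> is the moment of a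
    positive definite density \<open>\<Phi>\<close>, which makes \<open>\<Sigma> \<bullet> \<Lambda> = \<integral> \<Phi> \<bullet> Q\<^sub>\<Lambda>\<close> positive.  The density is explicit
    (\<open>positive_density\<close>): membership in the range gives \<open>\<Sigma> - A \<Sigma> A\<^sup>\<dagger> = B H + H\<^sup>\<dagger> B\<^sup>\<dagger>\<close>, and the
    feedback \<open>Z = A - B M B\<^sup>\<dagger> \<Sigma>\<^sup>-\<^sup>1 A\<close> with \<open>M = (B\<^sup>\<dagger> \<Sigma>\<^sup>-\<^sup>1 B)\<^sup>-\<^sup>1\<close> is stable with
    \<open>\<Sigma> - Z \<Sigma> Z\<^sup>\<dagger> = B M B\<^sup>\<dagger>\<close>; hence \<open>\<Sigma> = \<integral> F M F\<^sup>\<dagger>\<close> for \<open>F = (z - Z)\<^sup>-\<^sup>1 B\<close>, and \<open>F = G U\<close> with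
    invertible \<open>U\<close>.

  \<^item> Approach to the boundary.  If the limiting \<open>Q\<^sub>\<Lambda>\<close> is singular at a point of the circle, one of
    its quadratic forms vanishes there; being Lipschitz, it vanishes at least linearly, and the
    integral of its reciprocal diverges logarithmically (\<open>singular_blow_up\<close>), while the moments stay
    bounded.

  For fixed \<open>\<psi>\<close> the image of the moment map is then closed in the convex set of positive definite
  elements of the range; it is open there by invariance of domain, and it is not empty, so it is
  everything (\<open>moment_map_ex1\<close>).
\<close>

section \<open>The real inner product on complex matrices\<close>

notation conj_transpose (\<open>_\<^sup>\<dagger>\<close> [1000] 1000)

lemma bounded_bilinear_matrix_mult:
  "bounded_bilinear ((**) :: complex^'b^'a \<Rightarrow> complex^'c^'b \<Rightarrow> complex^'c^'a)"
proof -
  have "bilinear ((**) :: complex^'b^'a \<Rightarrow> complex^'c^'b \<Rightarrow> complex^'c^'a)"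
    by (auto simp: bilinear_def linear_iff vec_eq_iff matrix_matrix_mult_def sum.distrib
        scaleR_right.sum algebra_simps)
  then show ?thesis by (simp add: bilinear_conv_bounded_bilinear)
qed

lemma bounded_bilinear_matrix_vector_mult:
  "bounded_bilinear ((*v) :: complex^'b^'a \<Rightarrow> complex^'b \<Rightarrow> complex^'a)"
proof -
  have "bilinear ((*v) :: complex^'b^'a \<Rightarrow> complex^'b \<Rightarrow> complex^'a)"
    by (auto simp: bilinear_def linear_iff vec_eq_iff matrix_vector_mult_def sum.distrib
        scaleR_right.sum algebra_simps)
  then show ?thesis by (simp add: bilinear_conv_bounded_bilinear)
qed

lemma bounded_linear_conj_transpose:
  "bounded_linear (conj_transpose :: complex^'b^'a \<Rightarrow> complex^'a^'b)"
proof -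
  have "linear (conj_transpose :: complex^'b^'a \<Rightarrow> complex^'a^'b)"
    by (auto simp: linear_iff vec_eq_iff conj_transpose_def)
  then show ?thesis by (simp add: linear_conv_bounded_linear)
qed

lemmas matrix_continuous_intros [continuous_intros] =
  bounded_bilinear.continuous_on[OF bounded_bilinear_matrix_mult]
  bounded_bilinear.continuous_on[OF bounded_bilinear_matrix_vector_mult]
  bounded_linear.continuous_on[OF bounded_linear_conj_transpose]

lemmas matrix_mult_simps =
  bounded_bilinear.add_left[OF bounded_bilinear_matrix_mult]
  bounded_bilinear.add_right[OF bounded_bilinear_matrix_mult]
  bounded_bilinear.diff_left[OF bounded_bilinear_matrix_mult]
  bounded_bilinear.diff_right[OF bounded_bilinear_matrix_mult]
  bounded_bilinear.minus_left[OF bounded_bilinear_matrix_mult]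
  bounded_bilinear.minus_right[OF bounded_bilinear_matrix_mult]
  bounded_bilinear.zero_left[OF bounded_bilinear_matrix_mult]
  bounded_bilinear.zero_right[OF bounded_bilinear_matrix_mult]
  bounded_bilinear.scaleR_left[OF bounded_bilinear_matrix_mult]
  bounded_bilinear.scaleR_right[OF bounded_bilinear_matrix_mult]

lemma conj_transpose_component [simp]: "M\<^sup>\<dagger> $ i $ j = cnj (M $ j $ i)"
  by (simp add: conj_transpose_def)

lemma conj_transpose_conj_transpose [simp]: "M\<^sup>\<dagger>\<^sup>\<dagger> = M"
  by (simp add: vec_eq_iff)

lemma conj_transpose_mult: "(M ** N)\<^sup>\<dagger> = N\<^sup>\<dagger> ** M\<^sup>\<dagger>"
  by (simp add: vec_eq_iff matrix_matrix_mult_def mult.commute)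

lemma conj_transpose_mat [simp]: "(mat c)\<^sup>\<dagger> = mat (cnj c)"
  by (simp add: vec_eq_iff mat_def)

lemma inner_complex_mult_left: "(a * b) \<bullet> c = b \<bullet> (cnj a * c)" for a b c :: complex
  by (simp add: inner_complex_def algebra_simps)

lemma inner_matrix_mult_left: "(M ** X) \<bullet> Y = X \<bullet> (M\<^sup>\<dagger> ** Y)"
  for M :: "complex^'b^'a" and X :: "complex^'c^'b"
proof -
  have "(M ** X) \<bullet> Y = (\<Sum>i\<in>UNIV. \<Sum>j\<in>UNIV. \<Sum>k\<in>UNIV. X $ k $ j \<bullet> (cnj (M $ i $ k) * Y $ i $ j))"
    by (simp only: inner_vec_def matrix_matrix_mult_def vec_lambda_beta inner_sum_left inner_complex_mult_left)
  also have "\<dots> = (\<Sum>i\<in>UNIV. \<Sum>k\<in>UNIV. \<Sum>j\<in>UNIV. X $ k $ j \<bullet> (cnj (M $ i $ k) * Y $ i $ j))"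
    by (rule sum.cong[OF refl], rule sum.swap)
  also have "\<dots> = (\<Sum>k\<in>UNIV. \<Sum>i\<in>UNIV. \<Sum>j\<in>UNIV. X $ k $ j \<bullet> (cnj (M $ i $ k) * Y $ i $ j))"
    by (rule sum.swap)
  also have "\<dots> = (\<Sum>k\<in>UNIV. \<Sum>j\<in>UNIV. \<Sum>i\<in>UNIV. X $ k $ j \<bullet> (cnj (M $ i $ k) * Y $ i $ j))"
    by (rule sum.cong[OF refl], rule sum.swap)
  also have "\<dots> = X \<bullet> (M\<^sup>\<dagger> ** Y)"
    by (simp only: inner_vec_def matrix_matrix_mult_def vec_lambda_beta inner_sum_right conj_transpose_component)
  finally show ?thesis .
qed

lemma inner_conj_transpose: "X\<^sup>\<dagger> \<bullet> Y\<^sup>\<dagger> = X \<bullet> Y"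
  for X :: "complex^'b^'a"
proof -
  have "X\<^sup>\<dagger> \<bullet> Y\<^sup>\<dagger> = (\<Sum>j\<in>UNIV. \<Sum>i\<in>UNIV. X $ i $ j \<bullet> Y $ i $ j)"
    by (simp add: inner_vec_def inner_complex_def)
  also have "\<dots> = X \<bullet> Y"
    unfolding inner_vec_def by (rule sum.swap)
  finally show ?thesis .
qed

lemma inner_matrix_mult_right: "(X ** M) \<bullet> Y = X \<bullet> (Y ** M\<^sup>\<dagger>)"
  for M :: "complex^'c^'b" and X :: "complex^'b^'a"
proof -
  have "(X ** M) \<bullet> Y = (X ** M)\<^sup>\<dagger> \<bullet> Y\<^sup>\<dagger>"
    by (simp only: inner_conj_transpose)
  also have "\<dots> = X\<^sup>\<dagger> \<bullet> (M ** Y\<^sup>\<dagger>)"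
    by (simp add: conj_transpose_mult inner_matrix_mult_left)
  also have "\<dots> = X\<^sup>\<dagger> \<bullet> (Y ** M\<^sup>\<dagger>)\<^sup>\<dagger>"
    by (simp add: conj_transpose_mult)
  finally show ?thesis by (simp only: inner_conj_transpose)
qed

lemma inner_matrix_vector_mult: "(M *v x) \<bullet> y = x \<bullet> (M\<^sup>\<dagger> *v y)"
  for M :: "complex^'b^'a"
proof -
  have "(M *v x) \<bullet> y = (\<Sum>i\<in>UNIV. \<Sum>k\<in>UNIV. x $ k \<bullet> (cnj (M $ i $ k) * y $ i))"
    by (simp only: inner_vec_def matrix_vector_mult_def vec_lambda_beta inner_sum_left inner_complex_mult_left)
  also have "\<dots> = (\<Sum>k\<in>UNIV. \<Sum>i\<in>UNIV. x $ k \<bullet> (cnj (M $ i $ k) * y $ i))"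
    by (rule sum.swap)
  also have "\<dots> = x \<bullet> (M\<^sup>\<dagger> *v y)"
    by (simp only: inner_vec_def matrix_vector_mult_def vec_lambda_beta inner_sum_right conj_transpose_component)
  finally show ?thesis .
qed

section \<open>Positive definite matrices and matrix inverses\<close>

lemma HermitianD: "M \<in> Hermitian \<Longrightarrow> M\<^sup>\<dagger> = M"
  and HermitianI: "M\<^sup>\<dagger> = M \<Longrightarrow> M \<in> Hermitian"
  by (simp_all add: Hermitian_def)

lemma pos_def_iff: "pos_def M \<longleftrightarrow> M \<in> Hermitian \<and> (\<forall>x. x \<noteq> 0 \<longrightarrow> 0 < x \<bullet> (M *v x))"
  by (simp add: pos_def_def inner_vec_def inner_complex_def)

definition pos_semidef :: "complex^'k^'k \<Rightarrow> bool"
  where "pos_semidef M \<longleftrightarrow> M \<in> Hermitian \<and> (\<forall>x. 0 \<le> x \<bullet> (M *v x))"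

lemma pos_def_imp_pos_semidef: "pos_def M \<Longrightarrow> pos_semidef M"
  unfolding pos_def_iff pos_semidef_def
  by (metis inner_zero_left less_eq_real_def)

lemma matrix_inv_cancel:
  assumes "invertible M"
  shows "M ** matrix_inv M = mat 1" "matrix_inv M ** M = mat 1"
  using someI_ex[OF assms[unfolded invertible_def]] unfolding matrix_inv_def by blast+

lemma matrix_inv_unique:
  fixes M :: "complex^'k^'k"
  assumes "N ** M = mat 1"
  shows "invertible M" "matrix_inv M = N"
proof -
  show i: "invertible M" using assms invertible_left_inverse by blast
  show "matrix_inv M = N"
    by (metis assms matrix_inv_cancel(1)[OF i] matrix_mul_assoc matrix_mul_lid matrix_mul_rid)
qed

lemma invertible_iff_ker: "invertible M \<longleftrightarrow> (\<forall>x. M *v x = 0 \<longrightarrow> x = 0)"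
  for M :: "complex^'k^'k"
  by (simp add: invertible_left_inverse matrix_left_invertible_ker)

lemma pos_def_invertible: "pos_def M \<Longrightarrow> invertible M"
  unfolding invertible_iff_ker pos_def_iff by (metis inner_zero_right less_irrefl)

lemma Hermitian_matrix_inv:
  assumes "M \<in> Hermitian" "invertible M"
  shows "matrix_inv M \<in> Hermitian"
proof -
  have "(matrix_inv M)\<^sup>\<dagger> ** M = (M ** matrix_inv M)\<^sup>\<dagger>"
    using assms(1) by (simp add: conj_transpose_mult HermitianD)
  then have "(matrix_inv M)\<^sup>\<dagger> ** M = mat 1"
    by (simp add: matrix_inv_cancel assms)
  then have "matrix_inv M = (matrix_inv M)\<^sup>\<dagger>"
    by (rule matrix_inv_unique(2))
  then show ?thesis
    by (intro HermitianI) simp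
qed

lemma pos_def_matrix_inv:
  assumes "pos_def M"
  shows "pos_def (matrix_inv M)"
  unfolding pos_def_iff
proof (intro conjI allI impI)
  have i: "invertible M" and h: "M \<in> Hermitian"
    using assms pos_def_invertible by (auto simp: pos_def_iff)
  show "matrix_inv M \<in> Hermitian" by (rule Hermitian_matrix_inv[OF h i])
  fix x :: "complex^'a" assume "x \<noteq> 0"
  define y where "y = matrix_inv M *v x"
  have x: "x = M *v y"
    by (simp add: y_def matrix_vector_mul_assoc matrix_inv_cancel i)
  with \<open>x \<noteq> 0\<close> have "y \<noteq> 0" by auto
  then have "0 < y \<bullet> (M *v y)" using assms unfolding pos_def_iff by blast
  then show "0 < x \<bullet> (matrix_inv M *v x)"
    unfolding y_def[symmetric] x[symmetric] by (simp only: inner_commute)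
qed

lemma matrix_inv_eq_cramer:
  fixes M :: "complex^'k^'k"
  assumes "det M \<noteq> 0"
  shows "matrix_inv M $ k $ l = det (\<chi> i j. if j = k then axis l 1 $ i else M $ i $ j) / det M"
proof -
  have i: "invertible M" using assms by (simp add: invertible_det_nz)
  have "M *v (\<chi> i. matrix_inv M $ i $ l) = axis l 1"
  proof -
    have "(M ** matrix_inv M) $ i $ l = (axis l 1 :: complex^'k) $ i" for i
      by (simp add: matrix_inv_cancel i mat_def axis_def)
    then show ?thesis by (simp add: vec_eq_iff matrix_matrix_mult_def matrix_vector_mult_def)
  qed
  then show ?thesis
    unfolding cramer[OF assms] by (simp add: vec_eq_iff)
qed

lemma continuous_on_det [continuous_intros]:
  fixes f :: "'x::topological_space \<Rightarrow> complex^'k^'k"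
  assumes "\<And>i j. continuous_on S (\<lambda>x. f x $ i $ j)"
  shows "continuous_on S (\<lambda>x. det (f x))"
  unfolding det_def by (intro continuous_intros assms)

text \<open>By Cramer's rule the entries of the inverse are quotients of determinants.\<close>

lemma continuous_on_matrix_inv [continuous_intros]:
  fixes f :: "'x::topological_space \<Rightarrow> complex^'k^'k"
  assumes "continuous_on S f" "\<And>x. x \<in> S \<Longrightarrow> invertible (f x)"
  shows "continuous_on S (\<lambda>x. matrix_inv (f x))"
proof -
  have d: "det (f x) \<noteq> 0" if "x \<in> S" for x
    using assms(2)[OF that] by (simp add: invertible_det_nz)
  have c: "continuous_on S (\<lambda>x. f x $ i $ j)" for i j
    by (intro continuous_intros assms)
  have "continuous_on S (\<lambda>x. matrix_inv (f x) $ k $ l)" for k l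
  proof -
    have "continuous_on S (\<lambda>x. det (\<chi> i j. if j = k then axis l 1 $ i else f x $ i $ j) / det (f x))"
    proof (intro continuous_on_divide continuous_on_det c d ballI)
      show "continuous_on S (\<lambda>x. (\<chi> i j. if j = k then axis l 1 $ i else f x $ i $ j) $ i $ j)" for i j
        by (cases "j = k") (auto simp: c)
    qed
    then show ?thesis
      by (rule continuous_on_eq) (simp add: matrix_inv_eq_cramer d)
  qed
  then have "continuous_on S (\<lambda>x. \<chi> k l. matrix_inv (f x) $ k $ l)"
    by (intro continuous_on_vec_lambda)
  then show ?thesis by simp
qed

lemma matrix_inv_diff:
  fixes M N :: "complex^'k^'k"
  assumes "invertible M" "invertible N"
  shows "matrix_inv M - matrix_inv N = matrix_inv M ** (N - M) ** matrix_inv N"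
proof -
  have "matrix_inv M ** (N - M) ** matrix_inv N
      = matrix_inv M ** (N ** matrix_inv N) - (matrix_inv M ** M) ** matrix_inv N"
    by (simp add: matrix_mult_simps matrix_mul_assoc)
  then show ?thesis by (simp add: matrix_inv_cancel assms)
qed

section \<open>Cholesky factors and positivity of traces\<close>

lemmas matrix_vector_mult_simps =
  linear_simps[OF bounded_bilinear.bounded_linear_right[OF bounded_bilinear_matrix_vector_mult]]

text \<open>Otherwise a small step from \<open>x\<close> in the direction \<open>- M x\<close> would make the quadratic form
  negative.\<close>

lemma pos_semidef_kernel:
  assumes "pos_semidef M" "x \<bullet> (M *v x) = 0"
  shows "M *v x = 0"
proof (rule ccontr)
  assume "M *v x \<noteq> 0"
  define v where "v = M *v x"
  define a b where "a = v \<bullet> v" and "b = v \<bullet> (M *v v)"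
  have h: "M\<^sup>\<dagger> = M" and psd: "\<And>y. 0 \<le> y \<bullet> (M *v y)"
    using assms(1) by (auto simp: pos_semidef_def HermitianD)
  have a: "0 < a" using \<open>M *v x \<noteq> 0\<close> by (simp add: a_def v_def)
  have b: "0 \<le> b" unfolding b_def by (rule psd)
  \<comment> \<open>the form along \<open>x - t v\<close> is \<open>- 2 t a + t\<^sup>2 b\<close>, negative for \<open>0 < t < 2 a / b\<close>\<close>
  define t where "t = a / (b + 1)"
  have sym: "x \<bullet> (M *v v) = a"
    using inner_matrix_vector_mult[of M x v] by (simp add: h a_def v_def)
  have "0 \<le> (x - t *\<^sub>R v) \<bullet> (M *v (x - t *\<^sub>R v))" by (rule psd)
  also have "\<dots> = - 2 * t * a + t\<^sup>2 * b"
    using assms(2) sym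
    by (simp add: matrix_vector_mult_simps inner_diff_left
        inner_diff_right a_def b_def power2_eq_square algebra_simps flip: v_def)
  also have "\<dots> = - (a\<^sup>2 * (b + 2)) / (b + 1)\<^sup>2"
    using b by (simp add: t_def power2_eq_square divide_simps) (simp add: algebra_simps)
  also have "\<dots> < 0"
    using a b by (simp add: divide_neg_pos mult_pos_pos)
  finally show False by simp
qed

text \<open>Cholesky elimination, by induction on a set of indices that contains the non-zero rows: a positive
  diagonal entry is removed by subtracting a rank one matrix \<open>c c\<^sup>\<dagger>\<close>, a zero diagonal entry has a zero
  row by \<open>pos_semidef_kernel\<close>.  The support condition on the columns of \<open>L\<close> leaves the column with
  index \<open>i\<close> free for \<open>c\<close>.\<close>

lemma pos_semidef_Cholesky_aux:
  fixes M :: "complex^'k^'k"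
  assumes "finite S" "pos_semidef M" "\<And>i j. i \<notin> S \<Longrightarrow> M $ i $ j = 0"
  shows "\<exists>L. M = L ** L\<^sup>\<dagger> \<and> (\<forall>i j. j \<notin> S \<longrightarrow> L $ i $ j = 0)"
  using assms
proof (induction S arbitrary: M)
  case empty
  then have "M = 0 ** 0\<^sup>\<dagger>" by (simp add: vec_eq_iff matrix_matrix_mult_def)
  then show ?case by (intro exI[of _ "0 :: complex^'k^'k"]) simp
next
  case (insert i S)
  have h: "M\<^sup>\<dagger> = M" and psd: "\<And>y. 0 \<le> y \<bullet> (M *v y)"
    using insert.prems(1) by (auto simp: pos_semidef_def HermitianD)
  have hc: "cnj (M $ r $ s) = M $ s $ r" for r s
    using h by (metis conj_transpose_component)
  have col: "(M *v axis i c) $ r = M $ r $ i * c" for r c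
    by (simp add: matrix_vector_mult_def axis_def if_distrib cong: if_cong)
  have ax: "axis i c \<bullet> y = Re (cnj c * (y $ i))" for c :: complex and y
    by (simp add: inner_axis' inner_complex_def)
  show ?case
  proof (cases "M $ i $ i = 0")
    case True
    then have "axis i 1 \<bullet> (M *v axis i 1) = 0" by (simp add: ax col)
    then have "M *v axis i 1 = 0" using insert.prems(1) pos_semidef_kernel by blast
    then have "M $ r $ i = 0" for r using col[of 1 r] by simp
    then have "M $ i $ r = 0" for r using hc[of r i] by simp
    with insert.prems(2) have "r \<notin> S \<Longrightarrow> M $ r $ j = 0" for r j by (cases "r = i") auto
    with insert.IH[OF insert.prems(1)] show ?thesis by blast
  next
    case False
    define d where "d = Re (M $ i $ i)"
    have Mii: "M $ i $ i = of_real d"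
      using hc[of i i] by (simp add: d_def complex_eq_iff)
    have "0 \<le> d" using psd[of "axis i 1"] by (simp add: ax col d_def)
    with False Mii have d: "0 < d" by auto
    have sq: "complex_of_real (sqrt d) * of_real (sqrt d) = of_real d"
      using d by (simp flip: of_real_mult)
    define c :: "complex^'k" where "c = (\<chi> r. M $ r $ i / of_real (sqrt d))"
    define M' :: "complex^'k^'k" where "M' = (\<chi> r s. M $ r $ s - c $ r * cnj (c $ s))"
    have cc: "c $ r * cnj (c $ s) = M $ r $ i * M $ i $ s / of_real d" for r s
      using sq d by (simp add: c_def hc)
    have "pos_semidef M'"
      unfolding pos_semidef_def
    proof (intro conjI allI HermitianI)
      show "M'\<^sup>\<dagger> = M'" by (simp add: vec_eq_iff M'_def hc)
      fix x
      \<comment> \<open>this \<open>\<alpha>\<close> makes the \<open>i\<close>-th entry of \<open>M y\<close> vanish, so that \<open>M' x = M y\<close> and the form of \<open>M'\<close> at \<open>x\<close> is that of \<open>M\<close> at \<open>y\<close>\<close>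
      define \<alpha> where "\<alpha> = (M *v x) $ i / of_real d"
      define y where "y = x - axis i \<alpha>"
      have My: "M *v y = M *v x - M *v axis i \<alpha>"
        by (simp add: y_def matrix_vector_mult_diff_distrib)
      have 0: "(M *v y) $ i = 0"
        using d by (simp add: My col Mii \<alpha>_def)
      have "(M' *v x) $ r = (M *v y) $ r" for r
      proof -
        have "(M' *v x) $ r = (\<Sum>s\<in>UNIV. M $ r $ s * x $ s) - (\<Sum>s\<in>UNIV. M $ r $ i * M $ i $ s / of_real d * x $ s)"
          by (simp add: M'_def cc matrix_vector_mult_def left_diff_distrib sum_subtractf)
        also have "(\<Sum>s\<in>UNIV. M $ r $ i * M $ i $ s / of_real d * x $ s) = M $ r $ i * \<alpha>"
          by (simp add: \<alpha>_def matrix_vector_mult_def sum_distrib_left sum_divide_distrib mult.assoc)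
        also have "(\<Sum>s\<in>UNIV. M $ r $ s * x $ s) = (M *v x) $ r"
          by (simp add: matrix_vector_mult_def)
        finally show ?thesis by (simp add: My col)
      qed
      then have "x \<bullet> (M' *v x) = x \<bullet> (M *v y)" by (simp add: inner_vec_def)
      also have "\<dots> = y \<bullet> (M *v y)" using 0 by (simp add: y_def inner_diff_left ax)
      finally show "0 \<le> x \<bullet> (M' *v x)" using psd[of y] by simp
    qed
    moreover have "M' $ r $ s = 0" if "r \<notin> S" for r s
      using that insert.prems(2)[of r] d by (cases "r = i") (auto simp: M'_def cc Mii)
    ultimately obtain L :: "complex^'k^'k" where L: "M' = L ** L\<^sup>\<dagger>" and z: "\<And>r s. s \<notin> S \<Longrightarrow> L $ r $ s = 0"
      using insert.IH by meson
    define N :: "complex^'k^'k" where "N = (\<chi> r s. if s = i then c $ r else L $ r $ s)"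
    have "M $ r $ t = (N ** N\<^sup>\<dagger>) $ r $ t" for r t
    proof -
      have "(N ** N\<^sup>\<dagger>) $ r $ t = (\<Sum>s\<in>UNIV. N $ r $ s * cnj (N $ t $ s))"
        by (simp add: matrix_matrix_mult_def)
      also have "\<dots> = c $ r * cnj (c $ t) + (\<Sum>s\<in>UNIV - {i}. L $ r $ s * cnj (L $ t $ s))"
        by (subst sum.remove[of _ i]) (simp_all add: N_def)
      also have "(\<Sum>s\<in>UNIV - {i}. L $ r $ s * cnj (L $ t $ s)) = (\<Sum>s\<in>UNIV. L $ r $ s * cnj (L $ t $ s))"
        using z insert.hyps by (subst (2) sum.remove[of _ i]) simp_all
      also have "\<dots> = M' $ r $ t"
        by (simp add: L matrix_matrix_mult_def)
      finally show ?thesis by (simp add: M'_def)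
    qed
    then have "M = N ** N\<^sup>\<dagger>" by (simp add: vec_eq_iff)
    moreover have "N $ r $ s = 0" if "s \<notin> insert i S" for r s
      using that z by (simp add: N_def)
    ultimately show ?thesis by blast
  qed
qed

lemma pos_semidef_Cholesky:
  fixes M :: "complex^'k^'k"
  assumes "pos_semidef M"
  obtains L :: "complex^'k^'k" where "M = L ** L\<^sup>\<dagger>"
proof -
  have "\<exists>L :: complex^'k^'k. M = L ** L\<^sup>\<dagger> \<and> (\<forall>i j. j \<notin> UNIV \<longrightarrow> L $ i $ j = 0)"
    by (rule pos_semidef_Cholesky_aux[OF finite_class.finite_UNIV assms]) simp
  then show ?thesis using that by blast
qed

lemma inner_columns: "X \<bullet> (P ** X) = (\<Sum>j\<in>UNIV. (\<chi> i. X $ i $ j) \<bullet> (P *v (\<chi> i. X $ i $ j)))"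
  for P :: "complex^'k^'k" and X :: "complex^'c^'k"
proof -
  have "X \<bullet> (P ** X) = (\<Sum>j\<in>UNIV. \<Sum>i\<in>UNIV. X $ i $ j \<bullet> (P ** X) $ i $ j)"
    unfolding inner_vec_def by (rule sum.swap)
  then show ?thesis by (simp add: inner_vec_def matrix_matrix_mult_def matrix_vector_mult_def)
qed

lemma pos_semidef_inner_mult: "pos_semidef P \<Longrightarrow> 0 \<le> X \<bullet> (P ** X)"
  by (auto simp: inner_columns pos_semidef_def intro: sum_nonneg)

lemma pos_def_inner_mult:
  assumes "pos_def P" "X \<noteq> 0"
  shows "0 < X \<bullet> (P ** X)"
proof -
  have "\<exists>j. (\<chi> i. X $ i $ j) \<noteq> 0"
    using \<open>X \<noteq> 0\<close> by (auto simp: vec_eq_iff)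
  then obtain j where "(\<chi> i. X $ i $ j) \<noteq> 0" ..
  then show ?thesis
    unfolding inner_columns
    using assms(1) pos_def_imp_pos_semidef[OF assms(1)]
    by (intro sum_pos2[where i = j]) (auto simp: pos_def_iff pos_semidef_def)
qed

text \<open>With \<open>R = L L\<^sup>\<dagger>\<close> the left-hand side is \<open>(X L) \<bullet> (P (X L))\<close>.  This is the source of uniqueness and
  of the invertibility of the derivative.\<close>

lemma pos_def_inner_two_sided:
  fixes P :: "complex^'k^'k" and R :: "complex^'l^'l"
  assumes "pos_def P" "pos_def R" "X \<noteq> 0"
  shows "0 < X \<bullet> (P ** X ** R)"
proof -
  obtain L :: "complex^'l^'l" where L: "R = L ** L\<^sup>\<dagger>"
    by (rule pos_semidef_Cholesky[OF pos_def_imp_pos_semidef[OF assms(2)]])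
  have "X ** L \<noteq> 0"
  proof
    assume "X ** L = 0"
    then have "X ** R = 0"
      by (simp only: L matrix_mul_assoc matrix_mult_simps)
    then have "X ** (R ** matrix_inv R) = 0"
      by (simp only: matrix_mul_assoc matrix_mult_simps)
    then show False
      using assms(3) matrix_inv_cancel(1)[OF pos_def_invertible[OF assms(2)]] by simp
  qed
  then have "0 < (X ** L) \<bullet> (P ** (X ** L))"
    by (rule pos_def_inner_mult[OF assms(1)])
  then show ?thesis
    unfolding L inner_matrix_mult_right by (simp only: matrix_mul_assoc)
qed

lemma pos_def_inner_pos_semidef:
  fixes P Q :: "complex^'k^'k"
  assumes "pos_def P" "pos_semidef Q"
  shows "0 \<le> P \<bullet> Q" "P \<bullet> Q = 0 \<Longrightarrow> Q = 0"
proof -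
  obtain L :: "complex^'k^'k" where L: "Q = L ** L\<^sup>\<dagger>"
    by (rule pos_semidef_Cholesky[OF assms(2)])
  have eq: "P \<bullet> Q = L \<bullet> (P ** L)"
    unfolding L inner_matrix_mult_right[of P L L, symmetric] by (rule inner_commute)
  show "0 \<le> P \<bullet> Q"
    unfolding eq by (intro pos_semidef_inner_mult pos_def_imp_pos_semidef assms)
  assume "P \<bullet> Q = 0"
  then have "L = 0"
    using pos_def_inner_mult[OF assms(1), of L] unfolding eq by fastforce
  then show "Q = 0" by (simp add: L matrix_mult_simps)
qed

text \<open>The Cauchy-Schwarz inequality for the form of \<open>M\<close>, applied to \<open>x\<close> and \<open>M\<^sup>-\<^sup>1 x\<close>.  It bounds the form
  of the inverse from below where the form of \<open>M\<close> is small.\<close>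

lemma pos_def_inverse_form:
  assumes "pos_def M"
  shows "(x \<bullet> x)\<^sup>2 \<le> (x \<bullet> (M *v x)) * (x \<bullet> (matrix_inv M *v x))"
proof (cases "x = 0")
  case False
  define y where "y = matrix_inv M *v x"
  define a b d where "a = x \<bullet> x" and "b = x \<bullet> (M *v x)" and "d = x \<bullet> y"
  have My: "M *v y = x"
    by (simp add: y_def matrix_vector_mul_assoc matrix_inv_cancel pos_def_invertible assms)
  have h: "M\<^sup>\<dagger> = M" and psd: "0 \<le> v \<bullet> (M *v v)" for v
    using pos_def_imp_pos_semidef[OF assms] by (auto simp: pos_semidef_def HermitianD)
  have b: "0 < b" using assms False by (simp add: b_def pos_def_iff)
  have yMx: "y \<bullet> (M *v x) = a"
    using inner_matrix_vector_mult[of M y x] by (simp add: h My a_def)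
  have "0 \<le> (a *\<^sub>R x - b *\<^sub>R y) \<bullet> (M *v (a *\<^sub>R x - b *\<^sub>R y))" by (rule psd)
  also have "\<dots> = b * (b * d - a\<^sup>2)"
    using yMx by (simp add: matrix_vector_mult_simps inner_diff_left
        inner_diff_right My a_def[symmetric] b_def[symmetric] d_def inner_commute[of y x]
        power2_eq_square algebra_simps)
  finally have "a\<^sup>2 \<le> b * d" using b by (simp add: zero_le_mult_iff)
  then show ?thesis by (simp add: a_def b_def d_def y_def)
qed simp

section \<open>Integration over the circle\<close>

lemma continuous_complex_of_circle: "continuous_on S complex_of_circle"
  by (auto simp: continuous_on_iff dist_circle.rep_eq)

lemma continuous_cis_circle: "continuous_on S cis_circle"
proof -
  have "continuous_on S cis" by (intro continuous_intros)
  then show ?thesis by (simp add: continuous_on_iff dist_circle.rep_eq cis_circle.rep_eq)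
qed

lemma norm_complex_of_circle [simp]: "norm (complex_of_circle z) = 1"
  using complex_of_circle[of z] by simp

lemma cis_circle_surj: "\<exists>\<theta>\<in>{0..<2 * pi}. z = cis_circle \<theta>"
proof -
  have "complex_of_circle z = cis (Arg2pi (complex_of_circle z))"
    using Arg2pi_eq[of "complex_of_circle z"] by (simp add: cis_conv_exp)
  then have "z = cis_circle (Arg2pi (complex_of_circle z))"
    by (simp add: cis_circle.rep_eq flip: complex_of_circle_inject)
  then show ?thesis
    using Arg2pi_ge_0 Arg2pi_lt_2pi by (metis atLeastLessThan_iff)
qed

lemma compact_circle: "compact (UNIV :: circle set)"
proof -
  have "UNIV = cis_circle ` {0..2 * pi}"
    using cis_circle_surj by fastforce
  then show ?thesis
    by (metis compact_Icc compact_continuous_image continuous_cis_circle)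
qed

lemma circle_continuous_bounded: "continuous_on UNIV f \<Longrightarrow> bounded (range f)"
  for f :: "circle \<Rightarrow> 'a::metric_space"
  using compact_circle compact_continuous_image compact_imp_bounded by blast

lemma circle_continuous_bcontfun: "continuous_on UNIV f \<Longrightarrow> f \<in> bcontfun"
  for f :: "circle \<Rightarrow> 'a::metric_space"
  by (simp add: bcontfun_def circle_continuous_bounded)

lemma continuous_on_cis_circle:
  assumes "continuous_on UNIV f"
  shows "continuous_on S (\<lambda>\<theta>. f (cis_circle \<theta>))"
  by (rule continuous_on_compose2[OF assms continuous_cis_circle]) auto

text \<open>This reduces integrals over the circle to gauge integrals over one period, whose calculus and
  positivity rules then carry over.\<close>

lemma circle_integral_eq:
  fixes f :: "circle \<Rightarrow> 'a::euclidean_space"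
  assumes "continuous_on UNIV f"
  shows "circle_integral f = integral {0..2 * pi} (\<lambda>\<theta>. f (cis_circle \<theta>)) /\<^sub>R (2 * pi)"
proof -
  have "set_integrable lborel {0..2 * pi} (\<lambda>\<theta>. f (cis_circle \<theta>))"
    by (intro borel_integrable_atLeastAtMost' continuous_on_cis_circle assms)
  then show ?thesis
    by (simp add: circle_integral_def set_borel_integral_eq_integral)
qed

lemma circle_integrable:
  fixes f :: "circle \<Rightarrow> 'a::euclidean_space"
  assumes "continuous_on UNIV f"
  shows "(\<lambda>\<theta>. f (cis_circle \<theta>)) integrable_on {0..2 * pi}"
  using integrable_continuous_real continuous_on_cis_circle assms by blast

lemma circle_integral_linear:
  fixes f :: "circle \<Rightarrow> 'a::euclidean_space" and T :: "'a \<Rightarrow> 'b::euclidean_space"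
  assumes "continuous_on UNIV f" "bounded_linear T"
  shows "circle_integral (\<lambda>z. T (f z)) = T (circle_integral f)"
proof -
  have "integral {0..2 * pi} (T \<circ> (\<lambda>\<theta>. f (cis_circle \<theta>)))
      = T (integral {0..2 * pi} (\<lambda>\<theta>. f (cis_circle \<theta>)))"
    by (rule integral_linear[OF circle_integrable[OF assms(1)] assms(2)])
  moreover have "continuous_on UNIV (\<lambda>z. T (f z))"
    by (intro bounded_linear.continuous_on[OF assms(2)] assms(1))
  ultimately show ?thesis
    using assms by (simp add: circle_integral_eq o_def bounded_linear.linear linear_scale)
qed

lemma circle_integral_add:
  fixes f g :: "circle \<Rightarrow> 'a::euclidean_space"
  assumes "continuous_on UNIV f" "continuous_on UNIV g"
  shows "circle_integral (\<lambda>z. f z + g z) = circle_integral f + circle_integral g"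
  using assms
  by (simp add: circle_integral_eq continuous_on_add integral_add circle_integrable scaleR_right_distrib)

lemma circle_integral_diff:
  fixes f g :: "circle \<Rightarrow> 'a::euclidean_space"
  assumes "continuous_on UNIV f" "continuous_on UNIV g"
  shows "circle_integral (\<lambda>z. f z - g z) = circle_integral f - circle_integral g"
  using assms
  by (simp add: circle_integral_eq continuous_on_diff integral_diff circle_integrable scaleR_right_diff_distrib)

lemma circle_integral_const [simp]: "circle_integral (\<lambda>z. c) = c"
  for c :: "'a::euclidean_space"
  by (simp add: circle_integral_eq)

lemma circle_integral_mono:
  fixes f g :: "circle \<Rightarrow> real"
  assumes "continuous_on UNIV f" "continuous_on UNIV g" "\<And>z. f z \<le> g z"
  shows "circle_integral f \<le> circle_integral g"
proof -
  have "integral {0..2 * pi} (\<lambda>\<theta>. f (cis_circle \<theta>)) \<le> integral {0..2 * pi} (\<lambda>\<theta>. g (cis_circle \<theta>))"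
    by (intro integral_le circle_integrable assms)
  then show ?thesis using assms by (simp add: circle_integral_eq divide_right_mono)
qed

lemma circle_integral_nonneg:
  fixes f :: "circle \<Rightarrow> real"
  assumes "continuous_on UNIV f" "\<And>z. 0 \<le> f z"
  shows "0 \<le> circle_integral f"
  using circle_integral_mono[of "\<lambda>_. 0" f] assms by simp

lemma circle_integral_nonneg_eq_0:
  fixes f :: "circle \<Rightarrow> real"
  assumes "continuous_on UNIV f" "\<And>z. 0 \<le> f z" "circle_integral f = 0"
  shows "f z = 0"
proof -
  have "integral {0..2 * pi} (\<lambda>\<theta>. f (cis_circle \<theta>)) = 0"
    using assms(3) by (simp add: circle_integral_eq assms(1))
  then have "\<forall>\<theta>\<in>{0..2 * pi}. f (cis_circle \<theta>) = 0"
    using integral_eq_0_iff[of 0 "2 * pi" "\<lambda>\<theta>. f (cis_circle \<theta>)"] assms(2)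
      continuous_on_cis_circle[OF assms(1)]
    by simp
  then show ?thesis using cis_circle_surj[of z] by force
qed

lemma circle_integral_norm_le:
  fixes f :: "circle \<Rightarrow> 'a::euclidean_space"
  assumes "continuous_on UNIV f" "\<And>z. norm (f z) \<le> c"
  shows "norm (circle_integral f) \<le> c"
proof -
  have "norm (integral {0..2 * pi} (\<lambda>\<theta>. f (cis_circle \<theta>))) \<le> c * (2 * pi - 0)"
    by (rule integral_bound) (auto simp: assms continuous_on_cis_circle)
  then show ?thesis
    using assms by (simp add: circle_integral_eq field_simps)
qed

lemmas circle_integral_inner_left =
  circle_integral_linear[OF _ bounded_linear_inner_left]
lemmas circle_integral_inner_right =
  circle_integral_linear[OF _ bounded_linear_inner_right]

section \<open>Resolvents of stable matrices\<close>

lemma mat_mult_vector: "mat z *v x = z *s x" for x :: "complex^'k"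
  by (simp add: vec_eq_iff matrix_vector_mult_def mat_def if_distrib[of "\<lambda>u. u * _"] cong: if_cong)

lemma mat_commute: "mat z ** M = M ** mat z" for M :: "complex^'k^'k"
  by (simp add: vec_eq_iff matrix_matrix_mult_def mat_def mult.commute if_distrib[of "\<lambda>u. u * _"]
      if_distrib[of "\<lambda>u. _ * u"] cong: if_cong)

lemma mat_mult_component: "(mat z ** M) $ i $ j = z * M $ i $ j" for M :: "complex^'b^'k"
  by (simp add: matrix_matrix_mult_def mat_def if_distrib[of "\<lambda>u. u * _"] cong: if_cong)

lemma mat_mult_mat: "mat z ** mat w = (mat (z * w) :: complex^'k^'k)"
  by (simp add: vec_eq_iff mat_mult_component) (simp add: mat_def)

lemma conj_transpose_diff: "(M - N)\<^sup>\<dagger> = M\<^sup>\<dagger> - N\<^sup>\<dagger>"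
  and conj_transpose_add: "(M + N)\<^sup>\<dagger> = M\<^sup>\<dagger> + N\<^sup>\<dagger>"
  and conj_transpose_scaleR: "(c *\<^sub>R M)\<^sup>\<dagger> = c *\<^sub>R M\<^sup>\<dagger>"
  by (simp_all add: vec_eq_iff)

lemma conj_transpose_zero [simp]: "0\<^sup>\<dagger> = 0"
  by (simp add: vec_eq_iff)

lemma invertible_conj_transpose:
  fixes M :: "complex^'k^'k"
  assumes "invertible M"
  shows "invertible (M\<^sup>\<dagger>)" "matrix_inv (M\<^sup>\<dagger>) = (matrix_inv M)\<^sup>\<dagger>"
proof -
  have "(matrix_inv M)\<^sup>\<dagger> ** M\<^sup>\<dagger> = mat 1"
    by (simp add: matrix_inv_cancel[OF assms] flip: conj_transpose_mult)
  then show "invertible (M\<^sup>\<dagger>)" "matrix_inv (M\<^sup>\<dagger>) = (matrix_inv M)\<^sup>\<dagger>"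
    by (rule matrix_inv_unique)+
qed

lemma eigenvalue_iff: "eigenvalue M \<mu> \<longleftrightarrow> \<not> invertible (mat \<mu> - M)"
  unfolding eigenvalue_def invertible_iff_ker
  by (auto simp: matrix_vector_mult_diff_rdistrib mat_mult_vector) metis

lemma eigenvalue_conj_transpose:
  assumes "eigenvalue M \<mu>"
  shows "eigenvalue (M\<^sup>\<dagger>) (cnj \<mu>)"
  using assms invertible_conj_transpose(1)[of "mat (cnj \<mu>) - M\<^sup>\<dagger>"]
  by (auto simp: eigenvalue_iff conj_transpose_diff)

definition stable :: "complex^'k^'k \<Rightarrow> bool"
  where "stable Z \<longleftrightarrow> (\<forall>\<mu>. eigenvalue Z \<mu> \<longrightarrow> norm \<mu> < 1)"

definition resolvent :: "complex^'k^'k \<Rightarrow> circle \<Rightarrow> complex^'k^'k"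
  where "resolvent Z z = matrix_inv (mat (complex_of_circle z) - Z)"

lemma resolvent_cancel:
  assumes "stable Z"
  shows "(mat (complex_of_circle z) - Z) ** resolvent Z z = mat 1"
    and "resolvent Z z ** (mat (complex_of_circle z) - Z) = mat 1"
proof -
  have "invertible (mat (complex_of_circle z) - Z)"
    using assms[unfolded stable_def, rule_format, of "complex_of_circle z"]
    by (auto simp: eigenvalue_iff)
  then show "(mat (complex_of_circle z) - Z) ** resolvent Z z = mat 1"
    and "resolvent Z z ** (mat (complex_of_circle z) - Z) = mat 1"
    by (simp_all add: resolvent_def matrix_inv_cancel)
qed

lemma continuous_mat [continuous_intros]:
  "continuous_on S f \<Longrightarrow> continuous_on S (\<lambda>x. mat (f x) :: complex^'k^'k)"
proof -
  assume f: "continuous_on S f"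
  have "continuous_on S (\<lambda>x. if i = j then f x else 0)" for i j :: 'k
    by (cases "i = j") (simp_all add: f)
  then show ?thesis
    unfolding mat_def by (intro continuous_on_vec_lambda)
qed

lemma continuous_resolvent:
  assumes "stable Z"
  shows "continuous_on S (resolvent Z)"
proof -
  have "invertible (mat (complex_of_circle z) - Z)" for z
    using resolvent_cancel[OF assms] matrix_inv_unique(1) by blast
  then show ?thesis
    unfolding resolvent_def
    by (intro continuous_intros continuous_complex_of_circle)
qed

lemma holomorphic_on_det:
  fixes f :: "complex \<Rightarrow> complex^'k^'k"
  assumes "\<And>i j. (\<lambda>x. f x $ i $ j) holomorphic_on S"
  shows "(\<lambda>x. det (f x)) holomorphic_on S"
  unfolding det_def by (intro holomorphic_intros assms)

text \<open>The resolvent is holomorphic outside the unit disc and vanishes at infinity.  To apply Cauchy's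
  theorem on the disc itself, the adjoint is used: on the circle \<open>(z - Z)\<^sup>-\<^sup>\<dagger> = z (1 - z Z\<^sup>\<dagger>)\<^sup>-\<^sup>1\<close>, and
  \<open>(1 - u Z\<^sup>\<dagger>)\<^sup>-\<^sup>1\<close> is holomorphic in the disc and continuous up to its boundary.\<close>

lemma circle_integral_resolvent:
  assumes "stable Z"
  shows "circle_integral (resolvent Z) = 0"
proof -
  define N where "N u = mat 1 - mat u ** Z\<^sup>\<dagger>" for u
  define g where "g u = matrix_inv (N u)" for u
  have inv: "invertible (N u)" if "norm u \<le> 1" for u
  proof (cases "u = 0")
    case True
    then show ?thesis
      using matrix_inv_unique(1)[of "mat 1" "mat 1"]
      by (simp add: N_def vec_eq_iff mat_mult_component)
  next
    case False
    have "1 \<le> norm (inverse (cnj u))"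
      using that False by (simp add: norm_inverse one_le_inverse_iff)
    then have "\<not> eigenvalue Z (inverse (cnj u))"
      using assms unfolding stable_def by (meson not_less)
    then have "invertible (mat (inverse (cnj u)) - Z)"
      by (simp add: eigenvalue_iff)
    then have "invertible (mat (inverse u) - Z\<^sup>\<dagger>)"
      using invertible_conj_transpose(1) by (fastforce simp: conj_transpose_diff)
    moreover have "invertible (mat u :: complex^'a^'a)"
      by (rule matrix_inv_unique(1)[of "mat (inverse u)"]) (simp add: mat_mult_mat False)
    ultimately have "invertible (mat u ** (mat (inverse u) - Z\<^sup>\<dagger>))"
      by (intro invertible_mult)
    then show ?thesis
      by (simp add: N_def matrix_mult_simps mat_mult_mat False)
  qed
  have entry: "(\<lambda>u. N u $ i $ j) holomorphic_on S" for i j S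
    unfolding N_def by (simp add: mat_mult_component) (intro holomorphic_intros)
  have ent: "(g u $ k $ l = det (\<chi> i j. if j = k then axis l 1 $ i else N u $ i $ j) / det (N u))"
    if "norm u \<le> 1" for u k l
    unfolding g_def using inv[OF that] by (intro matrix_inv_eq_cramer) (simp add: invertible_det_nz)
  have hol: "(\<lambda>u. g u $ k $ l) holomorphic_on ball 0 1" for k l
  proof -
    have "(\<lambda>u. det (\<chi> i j. if j = k then axis l 1 $ i else N u $ i $ j) / det (N u)) holomorphic_on ball 0 1"
    proof (intro holomorphic_on_divide holomorphic_on_det entry)
      show "(\<lambda>u. (\<chi> i j. if j = k then axis l 1 $ i else N u $ i $ j) $ i $ j) holomorphic_on ball 0 1" for i j
        by (cases "j = k") (simp_all add: entry)
      show "det (N u) \<noteq> 0" if "u \<in> ball 0 1" for u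
        using inv[of u] that by (simp add: invertible_det_nz)
    qed
    then show ?thesis
      by (rule holomorphic_transform) (simp add: ent)
  qed
  have cont: "continuous_on (cball 0 1) (\<lambda>u. g u $ k $ l)" for k l
    unfolding g_def N_def
    by (intro continuous_intros) (use inv in \<open>simp add: N_def\<close>)
  have "((\<lambda>u. g u $ k $ l) has_contour_integral 0) (circlepath 0 1)" for k l
  proof (rule Cauchy_theorem_disc[OF finite.emptyI cont])
    show "(\<lambda>u. g u $ k $ l) field_differentiable at u" if "u \<in> ball 0 1 - {}" for u
      using that by (intro holomorphic_on_imp_differentiable_at[OF hol open_ball]) simp
  qed auto
  then have "((\<lambda>t. \<i> * (g (cis t) $ k $ l * cis t)) has_integral 0) {0..2 * pi}" for k l
    by (simp add: circlepath_def has_contour_integral_part_circlepath_iff mult_ac)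
  then have int0: "((\<lambda>t. - \<i> * (\<i> * (g (cis t) $ k $ l * cis t))) has_integral - \<i> * 0) {0..2 * pi}" for k l
    by (intro has_integral_mult_right)
  \<comment> \<open>the factor \<open>cis t\<close> of the adjoint resolvent is the one that the contour integral takes from \<open>du = \<i> u dt\<close>\<close>
  have res: "(resolvent Z (cis_circle t))\<^sup>\<dagger> = mat (cis t) ** g (cis t)" for t
  proof -
    have c: "cis t * cnj (cis t) = 1" by (simp add: cis_cnj cis_mult)
    have inv': "invertible (mat (cis t) - Z)"
      using resolvent_cancel[OF assms, of "cis_circle t"] matrix_inv_unique(1)
      by (fastforce simp: cis_circle.rep_eq)
    have "mat (cis t) ** (mat (cnj (cis t)) - Z\<^sup>\<dagger>) = N (cis t)"
      by (simp only: matrix_mult_simps mat_mult_mat c N_def)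
    then have "(mat (cis t) ** g (cis t)) ** (mat (cnj (cis t)) - Z\<^sup>\<dagger>) = mat 1"
      by (metis g_def inv mat_commute matrix_inv_cancel(2) matrix_mul_assoc norm_cis order_refl)
    then have "matrix_inv (mat (cnj (cis t)) - Z\<^sup>\<dagger>) = mat (cis t) ** g (cis t)"
      by (rule matrix_inv_unique)
    then show ?thesis
      using invertible_conj_transpose(2)[OF inv']
      by (simp add: resolvent_def cis_circle.rep_eq conj_transpose_diff)
  qed
  have c1: "continuous_on UNIV (\<lambda>z. (resolvent Z z)\<^sup>\<dagger>)"
    by (intro continuous_intros continuous_resolvent assms)
  have "(circle_integral (\<lambda>z. (resolvent Z z)\<^sup>\<dagger>)) $ k $ l = 0" for k l
  proof -
    have bl: "bounded_linear (\<lambda>M :: complex^'a^'a. M $ k $ l)"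
      by (intro bounded_linear_compose[OF bounded_linear_vec_nth] bounded_linear_vec_nth)
    have "(circle_integral (\<lambda>z. (resolvent Z z)\<^sup>\<dagger>)) $ k $ l
        = circle_integral (\<lambda>z. (resolvent Z z)\<^sup>\<dagger> $ k $ l)"
      by (rule circle_integral_linear[OF c1 bl, symmetric])
    also have "\<dots> = integral {0..2 * pi} (\<lambda>t. (resolvent Z (cis_circle t))\<^sup>\<dagger> $ k $ l) /\<^sub>R (2 * pi)"
      by (intro circle_integral_eq bounded_linear.continuous_on[OF bl] c1)
    also have "integral {0..2 * pi} (\<lambda>t. (resolvent Z (cis_circle t))\<^sup>\<dagger> $ k $ l) = 0"
      using int0[of k l] unfolding res by (simp add: mat_mult_component integral_unique mult_ac flip: mult.assoc)
    finally show ?thesis by simp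
  qed
  then have "circle_integral (\<lambda>z. (resolvent Z z)\<^sup>\<dagger>) = 0" by (simp add: vec_eq_iff)
  then have "(circle_integral (resolvent Z))\<^sup>\<dagger> = 0"
    using circle_integral_linear[OF continuous_resolvent[OF assms] bounded_linear_conj_transpose] by simp
  then show ?thesis
    by (metis conj_transpose_conj_transpose conj_transpose_zero)
qed


lemma bounded_linear_two_sided: "bounded_linear (\<lambda>X. M ** X ** N)"
  for M :: "complex^'b^'a" and N :: "complex^'d^'c"
  by (rule bounded_linear_compose[OF
        bounded_bilinear.bounded_linear_left[OF bounded_bilinear_matrix_mult]
        bounded_bilinear.bounded_linear_right[OF bounded_bilinear_matrix_mult]])

lemma circle_integral_two_sided:
  fixes M :: "complex^'b^'a" and N :: "complex^'d^'c"
  assumes "continuous_on UNIV f"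
  shows "circle_integral (\<lambda>z. M ** f z ** N) = M ** circle_integral f ** N"
  by (rule circle_integral_linear[OF assms bounded_linear_two_sided])

text \<open>For \<open>P = z - Z\<close> with \<open>z\<close> on the circle, \<open>S = (P + Z) S (P + Z)\<^sup>\<dagger>\<close>.  Expanding, the integrand becomes
  \<open>S + S Z\<^sup>\<dagger> P\<^sup>-\<^sup>\<dagger> + P\<^sup>-\<^sup>1 Z S\<close>, and the last two terms have integral \<open>0\<close> by \<open>circle_integral_resolvent\<close>.\<close>

lemma lyapunov_integral:
  assumes "stable Z"
  shows "circle_integral (\<lambda>z. resolvent Z z ** (S - Z ** S ** Z\<^sup>\<dagger>) ** (resolvent Z z)\<^sup>\<dagger>) = S"
proof -
  let ?R = "resolvent Z"
  have cR: "continuous_on UNIV ?R" "continuous_on UNIV (\<lambda>z. (?R z)\<^sup>\<dagger>)"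
    by (intro continuous_intros continuous_resolvent assms)+
  have "?R z ** (S - Z ** S ** Z\<^sup>\<dagger>) ** (?R z)\<^sup>\<dagger>
      = S + (S ** Z\<^sup>\<dagger> ** (?R z)\<^sup>\<dagger> ** mat 1 + mat 1 ** ?R z ** (Z ** S))" for z
  proof -
    define u where "u = complex_of_circle z"
    define P where "P = mat u - Z"
    have u: "u * cnj u = 1"
      using complex_norm_square[of u] by (simp add: u_def)
    have P: "?R z ** P = mat 1" "P\<^sup>\<dagger> ** (?R z)\<^sup>\<dagger> = mat 1"
      using resolvent_cancel[OF assms, of z] by (simp_all add: P_def u_def flip: conj_transpose_mult)
    have "S = mat u ** S ** (mat u)\<^sup>\<dagger>"
      by (simp add: u mat_mult_mat mat_commute[of u S] flip: matrix_mul_assoc)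
    also have "\<dots> = (P + Z) ** S ** (P + Z)\<^sup>\<dagger>"
      by (simp add: P_def)
    also have "\<dots> = P ** S ** P\<^sup>\<dagger> + P ** S ** Z\<^sup>\<dagger> + Z ** S ** P\<^sup>\<dagger> + Z ** S ** Z\<^sup>\<dagger>"
      by (simp add: conj_transpose_add matrix_mult_simps)
    finally have "S - Z ** S ** Z\<^sup>\<dagger> = P ** S ** P\<^sup>\<dagger> + P ** S ** Z\<^sup>\<dagger> + Z ** S ** P\<^sup>\<dagger>"
      by (rule diff_eq_eq[THEN iffD2])
    then have "?R z ** (S - Z ** S ** Z\<^sup>\<dagger>) ** (?R z)\<^sup>\<dagger>
        = (?R z ** P) ** S ** (P\<^sup>\<dagger> ** (?R z)\<^sup>\<dagger>) + (?R z ** P) ** S ** Z\<^sup>\<dagger> ** (?R z)\<^sup>\<dagger>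
          + ?R z ** Z ** S ** (P\<^sup>\<dagger> ** (?R z)\<^sup>\<dagger>)"
      by (simp add: matrix_mult_simps matrix_mul_assoc)
    then show ?thesis
      by (simp add: P matrix_mul_assoc)
  qed
  then have "circle_integral (\<lambda>z. ?R z ** (S - Z ** S ** Z\<^sup>\<dagger>) ** (?R z)\<^sup>\<dagger>)
      = circle_integral (\<lambda>z. S + (S ** Z\<^sup>\<dagger> ** (?R z)\<^sup>\<dagger> ** mat 1 + mat 1 ** ?R z ** (Z ** S)))"
    by presburger
  also have "\<dots> = S + (circle_integral (\<lambda>z. S ** Z\<^sup>\<dagger> ** (?R z)\<^sup>\<dagger> ** mat 1)
      + circle_integral (\<lambda>z. mat 1 ** ?R z ** (Z ** S)))"
    by (subst circle_integral_add, intro continuous_intros cR, intro continuous_intros cR,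
        subst circle_integral_add, (intro continuous_intros cR)+) simp
  also have "\<dots> = S"
    using cR circle_integral_resolvent[OF assms]
    by (simp only: circle_integral_two_sided circle_integral_linear[OF cR(1) bounded_linear_conj_transpose])
       (simp add: matrix_mult_simps)
  finally show ?thesis .
qed

section \<open>Positive definite moments come from positive definite densities\<close>

locale stable_system =
  fixes A :: "complex^'n^'n" and B :: "complex^'m^'n"
  assumes stable_A: "stable A"
    and inj_B: "B *v x = 0 \<Longrightarrow> x = 0"
begin

abbreviation G :: "circle \<Rightarrow> complex^'m^'n" where "G \<equiv> transfer_G A B"

lemma transfer_G_eq: "G z = resolvent A z ** B"
  by (simp add: transfer_G_def resolvent_def)

lemma transfer_G_adj_eq: "transfer_G_adj A B z = (G z)\<^sup>\<dagger>"
  by (simp add: transfer_G_adj_def)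

lemma continuous_G [continuous_intros]: "continuous_on S G"
  unfolding transfer_G_eq[abs_def] by (intro continuous_intros continuous_resolvent stable_A)

lemma G_inj: "G z *v x = 0 \<Longrightarrow> x = 0"
proof (rule inj_B)
  assume "G z *v x = 0"
  then have "(mat (complex_of_circle z) - A) *v (resolvent A z *v (B *v x)) = 0"
    by (simp add: transfer_G_eq matrix_vector_mul_assoc)
  then show "B *v x = 0"
    by (simp add: matrix_vector_mul_assoc matrix_mul_assoc resolvent_cancel stable_A)
qed

lemma shift_G: "mat (complex_of_circle z) ** G z = A ** G z + B"
proof -
  have "(mat (complex_of_circle z) - A) ** G z = B"
    by (simp add: transfer_G_eq matrix_mul_assoc resolvent_cancel stable_A)
  then show ?thesis by (simp add: matrix_mult_simps algebra_simps)
qed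

lemma Gamma_eq: "Gamma A B \<Phi> = circle_integral (\<lambda>z. G z ** \<Phi> z ** (G z)\<^sup>\<dagger>)"
  by (simp add: Gamma_def transfer_G_adj_eq)

text \<open>On the circle \<open>G \<Phi> G\<^sup>\<dagger> = (z G) \<Phi> (z G)\<^sup>\<dagger>\<close>, and \<open>z G = A G + B\<close>; all terms other than
  \<open>A (G \<Phi> G\<^sup>\<dagger>) A\<^sup>\<dagger>\<close> have a factor \<open>B\<close> on the left or \<open>B\<^sup>\<dagger>\<close> on the right.\<close>

lemma Gamma_lyapunov:
  assumes "\<Phi> \<in> C_Hermitian"
  obtains H where "Gamma A B \<Phi> - A ** Gamma A B \<Phi> ** A\<^sup>\<dagger> = B ** H + H\<^sup>\<dagger> ** B\<^sup>\<dagger>"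
proof -
  have c: "continuous_on UNIV \<Phi>" and h: "(\<Phi> z)\<^sup>\<dagger> = \<Phi> z" for z
    using assms by (auto simp: C_Hermitian_def HermitianD)
  define X where "X z = G z ** \<Phi> z ** (G z)\<^sup>\<dagger>" for z
  define Y where "Y z = G z ** \<Phi> z" for z
  define S where "S = Gamma A B \<Phi>"
  define W where "W = circle_integral Y"
  define \<Psi> where "\<Psi> = circle_integral \<Phi>"
  have cX: "continuous_on UNIV X" and cY: "continuous_on UNIV Y"
    unfolding X_def Y_def by (intro continuous_intros c)+
  have cY': "continuous_on UNIV (\<lambda>z. (Y z)\<^sup>\<dagger>)"
    by (intro continuous_intros cY)
  have SX: "S = circle_integral X"
    by (simp add: S_def Gamma_eq X_def[abs_def])
  have "X z = A ** X z ** A\<^sup>\<dagger> + (A ** Y z ** B\<^sup>\<dagger> + (B ** (Y z)\<^sup>\<dagger> ** A\<^sup>\<dagger> + B ** \<Phi> z ** B\<^sup>\<dagger>))" for z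
  proof -
    define u where "u = complex_of_circle z"
    have u: "u * cnj u = 1"
      using complex_norm_square[of u] by (simp add: u_def)
    have "X z = mat u ** X z ** (mat u)\<^sup>\<dagger>"
      by (simp add: u mat_mult_mat mat_commute[of u "X z"] flip: matrix_mul_assoc)
    also have "\<dots> = (mat u ** G z) ** \<Phi> z ** (mat u ** G z)\<^sup>\<dagger>"
      by (simp only: X_def conj_transpose_mult matrix_mul_assoc)
    also have "mat u ** G z = A ** G z + B"
      by (simp only: u_def shift_G)
    also have "(A ** G z + B) ** \<Phi> z ** (A ** G z + B)\<^sup>\<dagger>
       = A ** X z ** A\<^sup>\<dagger> + (A ** Y z ** B\<^sup>\<dagger> + (B ** (Y z)\<^sup>\<dagger> ** A\<^sup>\<dagger> + B ** \<Phi> z ** B\<^sup>\<dagger>))"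
      by (simp add: X_def Y_def conj_transpose_add conj_transpose_mult matrix_mult_simps matrix_mul_assoc h)
    finally show ?thesis .
  qed
  then have "circle_integral X = circle_integral (\<lambda>z. A ** X z ** A\<^sup>\<dagger> + (A ** Y z ** B\<^sup>\<dagger> + (B ** (Y z)\<^sup>\<dagger> ** A\<^sup>\<dagger> + B ** \<Phi> z ** B\<^sup>\<dagger>)))"
    by (intro arg_cong[where f = circle_integral] ext)
  also have "\<dots> = circle_integral (\<lambda>z. A ** X z ** A\<^sup>\<dagger>) + (circle_integral (\<lambda>z. A ** Y z ** B\<^sup>\<dagger>)
      + (circle_integral (\<lambda>z. B ** (Y z)\<^sup>\<dagger> ** A\<^sup>\<dagger>) + circle_integral (\<lambda>z. B ** \<Phi> z ** B\<^sup>\<dagger>)))"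
    by (subst circle_integral_add, intro continuous_intros cX, intro continuous_intros cY c,
        subst circle_integral_add, intro continuous_intros cY, intro continuous_intros cY c,
        subst circle_integral_add, (intro continuous_intros cY c)+) simp
  also have "\<dots> = A ** S ** A\<^sup>\<dagger> + (A ** W ** B\<^sup>\<dagger> + (B ** W\<^sup>\<dagger> ** A\<^sup>\<dagger> + B ** \<Psi> ** B\<^sup>\<dagger>))"
    by (simp only: circle_integral_two_sided[OF cX] circle_integral_two_sided[OF cY] circle_integral_two_sided[OF c]
        circle_integral_two_sided[OF cY'] SX W_def \<Psi>_def
        circle_integral_linear[OF cY bounded_linear_conj_transpose])
  finally have S: "S = A ** S ** A\<^sup>\<dagger> + (A ** W ** B\<^sup>\<dagger> + (B ** W\<^sup>\<dagger> ** A\<^sup>\<dagger> + B ** \<Psi> ** B\<^sup>\<dagger>))"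
    by (simp only: SX)
  have "\<Psi>\<^sup>\<dagger> = \<Psi>"
    using circle_integral_linear[OF c bounded_linear_conj_transpose] unfolding h \<Psi>_def by (rule sym)
  then have H: "(W\<^sup>\<dagger> ** A\<^sup>\<dagger> + (1/2) *\<^sub>R (\<Psi> ** B\<^sup>\<dagger>))\<^sup>\<dagger> ** B\<^sup>\<dagger>
      = A ** W ** B\<^sup>\<dagger> + (1/2) *\<^sub>R (B ** \<Psi> ** B\<^sup>\<dagger>)"
    by (simp add: conj_transpose_add conj_transpose_mult conj_transpose_scaleR matrix_mult_simps)
  have BH: "B ** (W\<^sup>\<dagger> ** A\<^sup>\<dagger> + (1/2) *\<^sub>R (\<Psi> ** B\<^sup>\<dagger>))
      = B ** W\<^sup>\<dagger> ** A\<^sup>\<dagger> + (1/2) *\<^sub>R (B ** \<Psi> ** B\<^sup>\<dagger>)"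
    by (simp add: matrix_mult_simps matrix_mul_assoc)
  \<comment> \<open>the Hermitian term \<open>B \<Psi> B\<^sup>\<dagger>\<close> is shared equally between \<open>B H\<close> and \<open>H\<^sup>\<dagger> B\<^sup>\<dagger>\<close>\<close>
  have half: "x = (1/2) *\<^sub>R x + (1/2) *\<^sub>R x" for x :: "complex^'n^'n"
    by (simp flip: scaleR_left_distrib)
  have "S - A ** S ** A\<^sup>\<dagger> = A ** W ** B\<^sup>\<dagger> + (B ** W\<^sup>\<dagger> ** A\<^sup>\<dagger> + B ** \<Psi> ** B\<^sup>\<dagger>)"
    by (subst (1) S) simp
  also have "\<dots> = B ** (W\<^sup>\<dagger> ** A\<^sup>\<dagger> + (1/2) *\<^sub>R (\<Psi> ** B\<^sup>\<dagger>))
      + (W\<^sup>\<dagger> ** A\<^sup>\<dagger> + (1/2) *\<^sub>R (\<Psi> ** B\<^sup>\<dagger>))\<^sup>\<dagger> ** B\<^sup>\<dagger>"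
    unfolding H BH by (subst (1) half[of "B ** \<Psi> ** B\<^sup>\<dagger>"]) (simp only: add_ac)
  finally have "S - A ** S ** A\<^sup>\<dagger> = B ** (W\<^sup>\<dagger> ** A\<^sup>\<dagger> + (1/2) *\<^sub>R (\<Psi> ** B\<^sup>\<dagger>))
      + (W\<^sup>\<dagger> ** A\<^sup>\<dagger> + (1/2) *\<^sub>R (\<Psi> ** B\<^sup>\<dagger>))\<^sup>\<dagger> ** B\<^sup>\<dagger>" .
  then show ?thesis using that by (simp add: S_def)
qed

end

lemma pos_def_congruence:
  fixes M :: "complex^'k^'k" and L :: "complex^'l^'k"
  assumes "pos_def M" "\<And>x. L *v x = 0 \<Longrightarrow> x = 0"
  shows "pos_def (L\<^sup>\<dagger> ** M ** L)"
  unfolding pos_def_iff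
proof (intro conjI allI impI HermitianI)
  have h: "M\<^sup>\<dagger> = M" using assms(1) unfolding pos_def_iff by (blast intro: HermitianD)
  show "(L\<^sup>\<dagger> ** M ** L)\<^sup>\<dagger> = L\<^sup>\<dagger> ** M ** L"
    unfolding conj_transpose_mult conj_transpose_conj_transpose h by (rule matrix_mul_assoc)
  fix x :: "complex^'l" assume "x \<noteq> 0"
  then have "L *v x \<noteq> 0" using assms(2)[of x] by fast
  then have "0 < (L *v x) \<bullet> (M *v (L *v x))"
    using assms(1) unfolding pos_def_iff by blast
  then show "0 < x \<bullet> (L\<^sup>\<dagger> ** M ** L *v x)"
    unfolding inner_matrix_vector_mult by (simp only: matrix_vector_mul_assoc matrix_mul_assoc)
qed

lemma invertible_conj_transpose_ker:
  fixes M :: "complex^'k^'k"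
  assumes "invertible M" "M\<^sup>\<dagger> *v x = 0"
  shows "x = 0"
  using invertible_conj_transpose(1)[OF assms(1)] assms(2) by (simp add: invertible_iff_ker)

lemma inner_smult_smult: "(c *s x) \<bullet> (c *s y) = (norm c)\<^sup>2 * (x \<bullet> y)" for x y :: "complex^'k"
proof -
  have "(c * a) \<bullet> (c * b) = (norm c)\<^sup>2 * (a \<bullet> b)" for a b :: complex
    unfolding inner_complex_def cmod_power2 by (simp add: power2_eq_square algebra_simps)
  then show ?thesis by (simp add: inner_vec_def sum_distrib_left)
qed

text \<open>The feedback is \<open>Z = Pr A\<close>, where \<open>Pr = 1 - B M B\<^sup>\<dagger> S\<^sup>-\<^sup>1\<close> with \<open>M = (B\<^sup>\<dagger> S\<^sup>-\<^sup>1 B)\<^sup>-\<^sup>1\<close> is the projection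
  along the range of \<open>B\<close> that is orthogonal for the form of \<open>S\<^sup>-\<^sup>1\<close>.  Since \<open>Pr B = 0\<close>, conjugation by
  \<open>Pr\<close> removes the right-hand side of the assumed equation.  A left eigenvector \<open>w\<close> of \<open>Z\<close> satisfies
  \<open>(1 - \<bar>\<mu>\<bar>\<^sup>2) (w \<bullet> S w) = b \<bullet> M b\<close> with \<open>b = B\<^sup>\<dagger> w\<close>; if \<open>b = 0\<close>, then \<open>w\<close> is a left eigenvector of \<open>A\<close>.\<close>

lemma closed_loop:
  fixes A S :: "complex^'n^'n" and B :: "complex^'m^'n"
  assumes A: "stable A" and B: "\<And>x. B *v x = 0 \<Longrightarrow> x = 0" and S: "pos_def S"
    and lyap: "S - A ** S ** A\<^sup>\<dagger> = B ** H + H\<^sup>\<dagger> ** B\<^sup>\<dagger>"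
  obtains K and M :: "complex^'m^'m" where "pos_def M" "stable (A - B ** K)"
    "S - (A - B ** K) ** S ** (A - B ** K)\<^sup>\<dagger> = B ** M ** B\<^sup>\<dagger>"
proof -
  define Si where "Si = matrix_inv S"
  define M where "M = matrix_inv (B\<^sup>\<dagger> ** Si ** B)"
  define K where "K = M ** B\<^sup>\<dagger> ** Si ** A"
  define Pr where "Pr = mat 1 - B ** M ** B\<^sup>\<dagger> ** Si"
  define Z where "Z = A - B ** K"
  have Si: "pos_def Si" "S ** Si = mat 1" "Si ** S = mat 1"
    using S by (simp_all add: Si_def pos_def_matrix_inv matrix_inv_cancel pos_def_invertible)
  have W: "pos_def (B\<^sup>\<dagger> ** Si ** B)"
    using Si(1) B by (rule pos_def_congruence)
  then have M: "pos_def M" "M ** (B\<^sup>\<dagger> ** Si ** B) = mat 1"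
    by (simp_all add: M_def pos_def_matrix_inv matrix_inv_cancel pos_def_invertible)
  have h: "S\<^sup>\<dagger> = S" "Si\<^sup>\<dagger> = Si" "M\<^sup>\<dagger> = M"
    using S Si M by (simp_all add: pos_def_iff HermitianD)
  have Z: "Z = Pr ** A"
    by (simp add: Z_def Pr_def K_def matrix_mult_simps matrix_mul_assoc)
  have "Pr ** B = B - B ** (M ** (B\<^sup>\<dagger> ** Si ** B))"
    by (simp add: Pr_def matrix_mult_simps matrix_mul_assoc)
  then have PrB: "Pr ** B = 0" by (simp add: M)
  then have BPr: "B\<^sup>\<dagger> ** Pr\<^sup>\<dagger> = 0" by (metis conj_transpose_mult conj_transpose_zero)
  have "Pr ** S = S - B ** M ** B\<^sup>\<dagger> ** (Si ** S)"
    by (simp add: Pr_def matrix_mult_simps matrix_mul_assoc)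
  then have PrS: "Pr ** S = S - B ** M ** B\<^sup>\<dagger>" by (simp add: Si)
  have "Pr ** S ** Pr\<^sup>\<dagger> = S ** Pr\<^sup>\<dagger> - B ** M ** (B\<^sup>\<dagger> ** Pr\<^sup>\<dagger>)"
    unfolding PrS by (simp add: matrix_mult_simps matrix_mul_assoc)
  also have "\<dots> = (Pr ** S)\<^sup>\<dagger>" by (simp add: BPr matrix_mult_simps conj_transpose_mult h)
  also have "\<dots> = S - B ** M ** B\<^sup>\<dagger>"
    by (simp add: PrS conj_transpose_diff conj_transpose_mult h matrix_mul_assoc)
  finally have PrSPr: "Pr ** S ** Pr\<^sup>\<dagger> = S - B ** M ** B\<^sup>\<dagger>" .
  have "A ** S ** A\<^sup>\<dagger> = S - (B ** H + H\<^sup>\<dagger> ** B\<^sup>\<dagger>)" by (simp flip: lyap)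
  then have "Pr ** (A ** S ** A\<^sup>\<dagger>) ** Pr\<^sup>\<dagger>
      = Pr ** S ** Pr\<^sup>\<dagger> - ((Pr ** B) ** H ** Pr\<^sup>\<dagger> + Pr ** H\<^sup>\<dagger> ** (B\<^sup>\<dagger> ** Pr\<^sup>\<dagger>))"
    by (simp add: matrix_mult_simps matrix_mul_assoc)
  also have "\<dots> = S - B ** M ** B\<^sup>\<dagger>"
    by (simp add: PrB BPr PrSPr matrix_mult_simps)
  finally have ZSZ: "Z ** S ** Z\<^sup>\<dagger> = S - B ** M ** B\<^sup>\<dagger>"
    by (simp add: Z conj_transpose_mult matrix_mul_assoc)
  have "stable Z"
    unfolding stable_def
  proof (intro allI impI)
    fix \<mu> assume "eigenvalue Z \<mu>"
    then obtain w where w: "w \<noteq> 0" "Z\<^sup>\<dagger> *v w = cnj \<mu> *s w"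
      using eigenvalue_conj_transpose[of Z \<mu>] unfolding eigenvalue_def by blast
    define b where "b = B\<^sup>\<dagger> *v w"
    have pos: "0 < w \<bullet> (S *v w)" using S w(1) by (simp add: pos_def_iff)
    have Sc: "S *v (c *s w) = c *s (S *v w)" for c
      by (simp add: vec_eq_iff matrix_vector_mult_def sum_distrib_left mult_ac)
    have "b \<bullet> (M *v b) = w \<bullet> ((B ** M ** B\<^sup>\<dagger>) *v w)"
      using inner_matrix_vector_mult[of "B\<^sup>\<dagger>" w "M *v (B\<^sup>\<dagger> *v w)"]
      by (simp add: b_def matrix_vector_mul_assoc matrix_mul_assoc)
    also have "B ** M ** B\<^sup>\<dagger> = S - Z ** S ** Z\<^sup>\<dagger>" by (simp add: ZSZ)
    also have "w \<bullet> ((S - Z ** S ** Z\<^sup>\<dagger>) *v w) = w \<bullet> (S *v w) - (Z\<^sup>\<dagger> *v w) \<bullet> (S *v (Z\<^sup>\<dagger> *v w))"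
      using inner_matrix_vector_mult[of "Z\<^sup>\<dagger>" w "S *v (Z\<^sup>\<dagger> *v w)"]
      by (simp add: matrix_vector_mult_diff_rdistrib inner_diff_right matrix_vector_mul_assoc matrix_mul_assoc)
    also have "\<dots> = (1 - (norm \<mu>)\<^sup>2) * (w \<bullet> (S *v w))"
      by (simp add: w(2) Sc inner_smult_smult algebra_simps)
    finally have bMb: "b \<bullet> (M *v b) = (1 - (norm \<mu>)\<^sup>2) * (w \<bullet> (S *v w))" .
    show "norm \<mu> < 1"
    proof (cases "b = 0")
      case True
      have "Pr\<^sup>\<dagger> = mat 1 - Si ** B ** M ** B\<^sup>\<dagger>"
        by (simp add: Pr_def conj_transpose_diff conj_transpose_mult h matrix_mul_assoc)
      then have "Pr\<^sup>\<dagger> *v w = w - (Si ** B ** M) *v b"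
        by (simp add: matrix_vector_mult_diff_rdistrib b_def matrix_vector_mul_assoc)
      then have "Pr\<^sup>\<dagger> *v w = w" by (simp add: True)
      then have "A\<^sup>\<dagger> *v w = Z\<^sup>\<dagger> *v w"
        by (simp add: Z conj_transpose_mult flip: matrix_vector_mul_assoc)
      then have "eigenvalue (A\<^sup>\<dagger>) (cnj \<mu>)"
        using w unfolding eigenvalue_def by auto
      from eigenvalue_conj_transpose[OF this] show ?thesis
        using A by (simp add: stable_def)
    next
      case False
      then have "0 < b \<bullet> (M *v b)" using M(1) by (simp add: pos_def_iff)
      then have "0 < 1 - (norm \<mu>)\<^sup>2" using pos unfolding bMb by (simp add: zero_less_mult_iff)
      then show ?thesis using power_less_imp_less_base[of "norm \<mu>" 2 1] by simp
    qed
  qed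
  then show ?thesis
    using that[of M K] M(1) ZSZ unfolding Z_def by (simp add: algebra_simps)
qed

context stable_system
begin

text \<open>The density is the one of maximum entropy.  With \<open>F = (z - Z)\<^sup>-\<^sup>1 B\<close> for the stable feedback
  \<open>Z = A - B K\<close>, the relation \<open>(z - A) F = B (1 - K F)\<close> gives \<open>F = G U\<close> for \<open>U = 1 - K F\<close>, so that
  \<open>\<Phi> = U M U\<^sup>\<dagger>\<close> has moment \<open>\<integral> F M F\<^sup>\<dagger> = S\<close> by \<open>lyapunov_integral\<close>.\<close>

theorem positive_density:
  assumes "S \<in> Range_Gamma A B" "pos_def S"
  obtains \<Phi> where "continuous_on UNIV \<Phi>" "\<And>z. pos_def (\<Phi> z)" "Gamma A B \<Phi> = S"
proof -
  obtain \<Phi>' where "\<Phi>' \<in> C_Hermitian" "S = Gamma A B \<Phi>'"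
    using assms(1) by (auto simp: Range_Gamma_def)
  then obtain H where H: "S - A ** S ** A\<^sup>\<dagger> = B ** H + H\<^sup>\<dagger> ** B\<^sup>\<dagger>"
    using Gamma_lyapunov by metis
  obtain K and M :: "complex^'m^'m" where M: "pos_def M" and st: "stable (A - B ** K)"
    and eq: "S - (A - B ** K) ** S ** (A - B ** K)\<^sup>\<dagger> = B ** M ** B\<^sup>\<dagger>"
    by (rule closed_loop[OF stable_A inj_B assms(2) H])
  define Z where "Z = A - B ** K"
  define F where "F z = resolvent Z z ** B" for z
  define U where "U z = mat 1 - K ** F z" for z
  define \<Phi> where "\<Phi> z = U z ** M ** (U z)\<^sup>\<dagger>" for z
  have st: "stable Z" using st by (simp add: Z_def)
  have cF: "continuous_on UNIV F"
    unfolding F_def by (intro continuous_intros continuous_resolvent st)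
  then have c: "continuous_on UNIV \<Phi>"
    unfolding \<Phi>_def U_def by (intro continuous_intros)
  have ZF: "(mat (complex_of_circle z) - Z) ** F z = B" for z
    by (simp add: F_def matrix_mul_assoc resolvent_cancel st)
  have F: "F z = G z ** U z" for z
  proof -
    have "(mat (complex_of_circle z) - A) ** F z = B ** U z"
    proof -
      have "mat (complex_of_circle z) - A = (mat (complex_of_circle z) - Z) - B ** K"
        by (simp add: Z_def)
      then have "(mat (complex_of_circle z) - A) ** F z
          = (mat (complex_of_circle z) - Z) ** F z - B ** K ** F z"
        by (simp only: matrix_mult_simps)
      also have "\<dots> = B ** U z"
        unfolding ZF by (simp only: U_def matrix_mult_simps matrix_mul_rid matrix_mul_assoc)
      finally show ?thesis .
    qed
    then have "resolvent A z ** ((mat (complex_of_circle z) - A) ** F z) = resolvent A z ** (B ** U z)"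
      by simp
    then show ?thesis
      by (simp only: matrix_mul_assoc resolvent_cancel[OF stable_A] matrix_mul_lid transfer_G_eq)
  qed
  have inj: "x = 0" if "U z *v x = 0" for z x
  proof (rule inj_B)
    have "F z *v x = 0"
      unfolding F using that by (simp flip: matrix_vector_mul_assoc)
    then show "B *v x = 0"
      unfolding ZF[of z, symmetric] by (simp flip: matrix_vector_mul_assoc)
  qed
  have pd: "pos_def (\<Phi> z)" for z
  proof -
    have "invertible (U z)" unfolding invertible_iff_ker using inj by blast
    then have "pos_def ((U z)\<^sup>\<dagger>\<^sup>\<dagger> ** M ** (U z)\<^sup>\<dagger>)"
      using invertible_conj_transpose_ker by (intro pos_def_congruence[OF M]) blast
    then show ?thesis
      by (simp add: \<Phi>_def)
  qed
  have "G z ** \<Phi> z ** (G z)\<^sup>\<dagger> = resolvent Z z ** (S - Z ** S ** Z\<^sup>\<dagger>) ** (resolvent Z z)\<^sup>\<dagger>" for z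
  proof -
    have "G z ** \<Phi> z ** (G z)\<^sup>\<dagger> = F z ** M ** (F z)\<^sup>\<dagger>"
      by (simp only: F \<Phi>_def conj_transpose_mult matrix_mul_assoc)
    also have "\<dots> = resolvent Z z ** (B ** M ** B\<^sup>\<dagger>) ** (resolvent Z z)\<^sup>\<dagger>"
      by (simp only: F_def conj_transpose_mult matrix_mul_assoc)
    finally show ?thesis
      unfolding eq[folded Z_def] .
  qed
  then have "Gamma A B \<Phi> = S"
    unfolding Gamma_eq by (simp add: lyapunov_integral st)
  then show ?thesis using that c pd by blast
qed

section \<open>The range of the moment operator\<close>

lemma Gamma_inner:
  assumes "continuous_on UNIV \<Phi>"
  shows "Gamma A B \<Phi> \<bullet> X = circle_integral (\<lambda>z. \<Phi> z \<bullet> ((G z)\<^sup>\<dagger> ** X ** G z))"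
proof -
  have "continuous_on UNIV (\<lambda>z. G z ** \<Phi> z ** (G z)\<^sup>\<dagger>)"
    by (intro continuous_intros assms)
  then have "Gamma A B \<Phi> \<bullet> X = circle_integral (\<lambda>z. (G z ** \<Phi> z ** (G z)\<^sup>\<dagger>) \<bullet> X)"
    unfolding Gamma_eq by (rule circle_integral_inner_left[symmetric])
  moreover have "(G z ** \<Phi> z ** (G z)\<^sup>\<dagger>) \<bullet> X = \<Phi> z \<bullet> ((G z)\<^sup>\<dagger> ** X ** G z)" for z
    unfolding inner_matrix_mult_right[of "G z ** \<Phi> z" "(G z)\<^sup>\<dagger>" X] inner_matrix_mult_left[of "G z" "\<Phi> z"]
    by (simp add: matrix_mul_assoc)
  ultimately show ?thesis by simp
qed

lemma Gamma_add:
  assumes "continuous_on UNIV \<Phi>" "continuous_on UNIV \<Psi>"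
  shows "Gamma A B (\<lambda>z. \<Phi> z + \<Psi> z) = Gamma A B \<Phi> + Gamma A B \<Psi>"
proof -
  have "continuous_on UNIV (\<lambda>z. G z ** \<Phi> z ** (G z)\<^sup>\<dagger>)" "continuous_on UNIV (\<lambda>z. G z ** \<Psi> z ** (G z)\<^sup>\<dagger>)"
    by (intro continuous_intros assms)+
  then show ?thesis by (simp add: Gamma_eq matrix_mult_simps circle_integral_add)
qed

lemma Gamma_scaleR:
  assumes "continuous_on UNIV \<Phi>"
  shows "Gamma A B (\<lambda>z. c *\<^sub>R \<Phi> z) = c *\<^sub>R Gamma A B \<Phi>"
proof -
  have "continuous_on UNIV (\<lambda>z. G z ** \<Phi> z ** (G z)\<^sup>\<dagger>)"
    by (intro continuous_intros assms)
  from circle_integral_linear[OF this bounded_linear_scaleR_right[of c]]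
  show ?thesis by (simp add: Gamma_eq matrix_mult_simps)
qed

lemma subspace_Range_Gamma: "subspace (Range_Gamma A B)"
proof (rule subspaceI)
  have 0: "(\<lambda>z. 0) \<in> C_Hermitian"
    by (simp add: C_Hermitian_def HermitianI)
  have "Gamma A B (\<lambda>z. 0) = 0"
    using Gamma_scaleR[of "\<lambda>z. 0" 0] by simp
  with 0 show "0 \<in> Range_Gamma A B"
    unfolding Range_Gamma_def by (metis image_eqI)
next
  fix x y assume "x \<in> Range_Gamma A B" "y \<in> Range_Gamma A B"
  then obtain \<Phi> \<Psi> where *: "\<Phi> \<in> C_Hermitian" "x = Gamma A B \<Phi>" "\<Psi> \<in> C_Hermitian" "y = Gamma A B \<Psi>"
    by (auto simp: Range_Gamma_def)
  then have "(\<lambda>z. \<Phi> z + \<Psi> z) \<in> C_Hermitian"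
    by (auto simp: C_Hermitian_def Hermitian_def conj_transpose_add intro: continuous_on_add)
  moreover have "x + y = Gamma A B (\<lambda>z. \<Phi> z + \<Psi> z)"
    using * by (simp add: Gamma_add C_Hermitian_def)
  ultimately show "x + y \<in> Range_Gamma A B"
    unfolding Range_Gamma_def by blast
next
  fix c x assume "x \<in> Range_Gamma A B"
  then obtain \<Phi> where *: "\<Phi> \<in> C_Hermitian" "x = Gamma A B \<Phi>"
    by (auto simp: Range_Gamma_def)
  then have "(\<lambda>z. c *\<^sub>R \<Phi> z) \<in> C_Hermitian"
    by (auto simp: C_Hermitian_def Hermitian_def conj_transpose_scaleR intro: continuous_on_scaleR continuous_on_const)
  moreover have "c *\<^sub>R x = Gamma A B (\<lambda>z. c *\<^sub>R \<Phi> z)"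
    using * by (simp add: Gamma_scaleR C_Hermitian_def)
  ultimately show "c *\<^sub>R x \<in> Range_Gamma A B"
    unfolding Range_Gamma_def by blast
qed

lemma Range_Gamma_Hermitian:
  assumes "X \<in> Range_Gamma A B"
  shows "X \<in> Hermitian"
proof -
  obtain \<Phi> where \<Phi>: "\<Phi> \<in> C_Hermitian" and X: "X = Gamma A B \<Phi>"
    using assms by (auto simp: Range_Gamma_def)
  then have c: "continuous_on UNIV (\<lambda>z. G z ** \<Phi> z ** (G z)\<^sup>\<dagger>)"
    by (intro continuous_intros) (simp add: C_Hermitian_def)
  have h: "(G z ** \<Phi> z ** (G z)\<^sup>\<dagger>)\<^sup>\<dagger> = G z ** \<Phi> z ** (G z)\<^sup>\<dagger>" for z
    using \<Phi> by (simp add: conj_transpose_mult matrix_mul_assoc C_Hermitian_def Hermitian_def)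
  have "X\<^sup>\<dagger> = circle_integral (\<lambda>z. (G z ** \<Phi> z ** (G z)\<^sup>\<dagger>)\<^sup>\<dagger>)"
    unfolding X Gamma_eq by (rule circle_integral_linear[OF c bounded_linear_conj_transpose, symmetric])
  also have "\<dots> = X" unfolding X Gamma_eq by (simp only: h)
  finally show ?thesis by (rule HermitianI)
qed

lemma Hermitian_compression:
  "X \<in> Hermitian \<Longrightarrow> (G z)\<^sup>\<dagger> ** X ** G z \<in> Hermitian"
  by (simp add: Hermitian_def conj_transpose_mult matrix_mul_assoc)

lemma Range_Gamma_compression_eq_0:
  assumes "X \<in> Range_Gamma A B" "\<And>z. (G z)\<^sup>\<dagger> ** X ** G z = 0"
  shows "X = 0"
proof -
  obtain \<Phi> where "\<Phi> \<in> C_Hermitian" "X = Gamma A B \<Phi>"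
    using assms(1) by (auto simp: Range_Gamma_def)
  then have "X \<bullet> X = circle_integral (\<lambda>z. \<Phi> z \<bullet> ((G z)\<^sup>\<dagger> ** X ** G z))"
    by (simp only: Gamma_inner C_Hermitian_def mem_Collect_eq)
  then have "X \<bullet> X = 0" by (simp only: assms(2) inner_zero_right circle_integral_const)
  then show ?thesis by simp
qed

text \<open>Test orthogonality against the moment of \<open>G\<^sup>\<dagger> Y G\<close> itself.\<close>

lemma orthogonal_Range_Gamma_compression:
  assumes "Y \<in> Hermitian" "\<And>X. X \<in> Range_Gamma A B \<Longrightarrow> X \<bullet> Y = 0"
  shows "(G z)\<^sup>\<dagger> ** Y ** G z = 0"
proof -
  define \<Phi> where "\<Phi> z = (G z)\<^sup>\<dagger> ** Y ** G z" for z
  have c: "continuous_on UNIV \<Phi>"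
    unfolding \<Phi>_def by (intro continuous_intros)
  have "\<Phi> \<in> C_Hermitian"
    using c assms(1) by (auto simp: C_Hermitian_def \<Phi>_def Hermitian_compression)
  then have "Gamma A B \<Phi> \<bullet> Y = 0"
    by (intro assms(2)) (auto simp: Range_Gamma_def)
  then have "circle_integral (\<lambda>z. \<Phi> z \<bullet> \<Phi> z) = 0"
    by (simp add: Gamma_inner[OF c] flip: \<Phi>_def)
  then have "\<Phi> z \<bullet> \<Phi> z = 0"
    by (rule circle_integral_nonneg_eq_0[OF continuous_on_inner[OF c c] inner_ge_zero])
  then show ?thesis by (simp add: \<Phi>_def)
qed

lemma L_plus_eq: "L_plus A B = {\<Lambda> \<in> Hermitian. \<forall>z. pos_def ((G z)\<^sup>\<dagger> ** \<Lambda> ** G z)}"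
  by (simp add: L_plus_def transfer_G_adj_eq)

lemma pos_def_compression_iff:
  assumes "\<Lambda> \<in> Hermitian"
  shows "pos_def ((G z)\<^sup>\<dagger> ** \<Lambda> ** G z) \<longleftrightarrow> (\<forall>x. x \<noteq> 0 \<longrightarrow> 0 < (G z *v x) \<bullet> (\<Lambda> *v (G z *v x)))"
  using Hermitian_compression[OF assms, of z]
  by (simp add: pos_def_iff inner_matrix_vector_mult matrix_vector_mul_assoc matrix_mul_assoc)

text \<open>The orthogonal projection of the identity onto the range has the same compression \<open>G\<^sup>\<dagger> G\<close> as the
  identity.\<close>

lemma L_plus_Gamma_nonempty: "L_plus_Gamma A B \<noteq> {}"
proof -
  let ?V = "Range_Gamma A B"
  obtain P Y where P: "P \<in> span ?V" and Y: "\<And>X. X \<in> span ?V \<Longrightarrow> orthogonal Y X"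
    and eq: "(mat 1 :: complex^'n^'n) = P + Y"
    using orthogonal_subspace_decomp_exists[of ?V "mat 1"] by metis
  have P: "P \<in> ?V" using P by (simp add: subspace_Range_Gamma span_eq_iff[THEN iffD2])
  have "(mat 1 :: complex^'n^'n) \<in> Hermitian" by (simp add: HermitianI)
  moreover have hP: "P \<in> Hermitian" using P by (rule Range_Gamma_Hermitian)
  moreover have Yeq: "Y = mat 1 - P" using eq by simp
  ultimately have "Y \<in> Hermitian" by (simp add: Hermitian_def conj_transpose_diff)
  then have "(G z)\<^sup>\<dagger> ** Y ** G z = 0" for z
    using Y by (intro orthogonal_Range_Gamma_compression)
       (auto simp: orthogonal_def inner_commute span_base)
  then have "(G z)\<^sup>\<dagger> ** P ** G z = (G z)\<^sup>\<dagger> ** mat 1 ** G z" for z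
    unfolding Yeq by (simp add: matrix_mult_simps)
  moreover have "pos_def ((G z)\<^sup>\<dagger> ** mat 1 ** G z)" for z
    by (rule pos_def_congruence[OF _ G_inj]) (simp add: pos_def_iff HermitianI)
  ultimately have "P \<in> L_plus_Gamma A B"
    using P hP by (simp add: L_plus_Gamma_def L_plus_eq)
  then show ?thesis by blast
qed

lemma bounded_G: obtains C where "C > 0" "\<And>z x. norm (G z *v x) \<le> C * norm x"
proof -
  obtain C where C: "\<And>(M :: complex^'m^'n) x. norm (M *v x) \<le> norm M * norm x * C" "C > 0"
    using bounded_bilinear.pos_bounded[OF bounded_bilinear_matrix_vector_mult] by blast
  obtain b where b: "b > 0" "\<And>z. norm (G z) \<le> b"
    using circle_continuous_bounded[OF continuous_G] by (auto simp: bounded_pos)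
  have "norm (G z *v x) \<le> (b * C) * norm x" for z x
  proof -
    have "norm (G z *v x) \<le> norm (G z) * norm x * C" by (rule C)
    also have "\<dots> \<le> b * norm x * C"
      using b C(2) by (intro mult_right_mono) auto
    finally show ?thesis by (simp add: mult_ac)
  qed
  then show ?thesis using that[of "b * C"] b C(2) by simp
qed

text \<open>The form \<open>(G x) \<bullet> (\<Lambda> (G x))\<close> attains a positive minimum over the circle and the unit sphere, and
  nearby matrices change it by less than that minimum.\<close>

lemma openin_L_plus_Gamma: "openin (top_of_set (Range_Gamma A B)) (L_plus_Gamma A B)"
  unfolding openin_euclidean_subtopology_iff
proof (intro conjI ballI)
  show "L_plus_Gamma A B \<subseteq> Range_Gamma A B" by (auto simp: L_plus_Gamma_def)
  fix \<Lambda> assume "\<Lambda> \<in> L_plus_Gamma A B"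
  then have h: "\<Lambda> \<in> Hermitian" and pd: "\<And>z. pos_def ((G z)\<^sup>\<dagger> ** \<Lambda> ** G z)"
    by (auto simp: L_plus_Gamma_def L_plus_eq)
  obtain C where C: "C > 0" "\<And>z x. norm (G z *v x) \<le> C * norm x"
    using bounded_G by blast
  obtain D where D: "D > 0" "\<And>(M :: complex^'n^'n) x. norm (M *v x) \<le> norm M * norm x * D"
    using bounded_bilinear.pos_bounded[OF bounded_bilinear_matrix_vector_mult] by blast
  let ?K = "(UNIV :: circle set) \<times> sphere (0 :: complex^'m) 1"
  let ?f = "\<lambda>p. (G (fst p) *v snd p) \<bullet> (\<Lambda> *v (G (fst p) *v snd p))"
  have cf: "continuous_on ?K ?f"
    by (intro continuous_intros continuous_on_compose2[OF continuous_G]) auto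
  have "compact ?K" by (intro compact_Times compact_circle compact_sphere)
  moreover have "?K \<noteq> {}"
    by (auto intro!: exI[of _ "axis undefined 1"])
  ultimately obtain p where p: "p \<in> ?K" "\<And>q. q \<in> ?K \<Longrightarrow> ?f p \<le> ?f q"
    using continuous_attains_inf[of ?K ?f] cf by blast
  define e where "e = ?f p"
  have "snd p \<noteq> 0" using p(1) by auto
  then have e: "e > 0" using pd[of "fst p"] unfolding pos_def_compression_iff[OF h] e_def by blast
  have "X \<in> L_plus_Gamma A B" if X: "X \<in> Range_Gamma A B" "dist X \<Lambda> < e / (C * C * D)" for X
  proof -
    have hX: "X \<in> Hermitian" by (rule Range_Gamma_Hermitian[OF X(1)])
    have "0 < (G z *v x) \<bullet> (X *v (G z *v x))" if "x \<noteq> 0" for z x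
    proof -
      define y where "y = (1 / norm x) *\<^sub>R x"
      define v where "v = G z *v y"
      have ny: "norm y = 1" using that by (simp add: y_def)
      have v: "norm v \<le> C" using C(2)[of z y] by (simp add: v_def ny)
      have "e \<le> v \<bullet> (\<Lambda> *v v)"
        using p(2)[of "(z, y)"] ny by (simp add: e_def v_def)
      also have "\<dots> = v \<bullet> (X *v v) + v \<bullet> ((\<Lambda> - X) *v v)"
        by (simp add: matrix_vector_mult_diff_rdistrib inner_diff_right)
      also have "v \<bullet> ((\<Lambda> - X) *v v) \<le> norm v * norm ((\<Lambda> - X) *v v)"
        by (rule norm_cauchy_schwarz)
      also have "\<dots> \<le> norm v * (norm (\<Lambda> - X) * norm v * D)"
        by (intro mult_left_mono D) simp
      also have "\<dots> = norm v * norm v * (norm (\<Lambda> - X) * D)" by simp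
      also have "\<dots> \<le> C * C * (norm (\<Lambda> - X) * D)"
        using v C D by (intro mult_right_mono mult_mono) auto
      also have "\<dots> < e"
        using X(2) C D by (simp add: dist_norm norm_minus_commute pos_less_divide_eq mult_ac)
      finally have "0 < v \<bullet> (X *v v)" by simp
      moreover have "G z *v x = norm x *\<^sub>R v"
        using that by (simp add: v_def y_def matrix_vector_mult_simps)
      ultimately show ?thesis
        using that by (simp add: matrix_vector_mult_simps)
    qed
    then show ?thesis
      using X(1) hX by (simp add: L_plus_Gamma_def L_plus_eq pos_def_compression_iff)
  qed
  then show "\<exists>e>0. \<forall>X\<in>Range_Gamma A B. dist X \<Lambda> < e \<longrightarrow> X \<in> L_plus_Gamma A B"
    using e C D by (intro exI[of _ "e / (C * C * D)"]) auto
qed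

end

section \<open>Divergence of the inverse at a singular boundary point\<close>

lemma circle_lipschitz_bilinear:
  fixes f :: "circle \<Rightarrow> 'a::real_normed_vector" and g :: "circle \<Rightarrow> 'b::real_normed_vector"
  assumes "bounded_bilinear prd" "\<exists>L. L-lipschitz_on UNIV f" "\<exists>L. L-lipschitz_on UNIV g"
  shows "\<exists>L. L-lipschitz_on UNIV (\<lambda>z. prd (f z) (g z))"
proof -
  interpret bounded_bilinear prd by fact
  obtain K where K: "K > 0" "\<And>a b. norm (prd a b) \<le> norm a * norm b * K"
    using pos_bounded by blast
  obtain Lf where Lf: "Lf-lipschitz_on UNIV f" using assms(2) by blast
  obtain Lg where Lg: "Lg-lipschitz_on UNIV g" using assms(3) by blast
  obtain bf where bf: "bf > 0" "\<And>z. norm (f z) \<le> bf"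
    using circle_continuous_bounded[OF lipschitz_on_continuous_on[OF Lf]] by (auto simp: bounded_pos)
  obtain bg where bg: "bg > 0" "\<And>z. norm (g z) \<le> bg"
    using circle_continuous_bounded[OF lipschitz_on_continuous_on[OF Lg]] by (auto simp: bounded_pos)
  have L: "Lf \<ge> 0" "Lg \<ge> 0" using lipschitz_on_nonneg Lf Lg by blast+
  have "((Lf * bg + bf * Lg) * K)-lipschitz_on UNIV (\<lambda>z. prd (f z) (g z))"
  proof (rule lipschitz_onI)
    fix z w :: circle
    have "prd (f z) (g z) - prd (f w) (g w) = prd (f z - f w) (g z) + prd (f w) (g z - g w)"
      by (simp add: diff_left diff_right)
    then have "dist (prd (f z) (g z)) (prd (f w) (g w))
        \<le> norm (prd (f z - f w) (g z)) + norm (prd (f w) (g z - g w))"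
      unfolding dist_norm by (simp only: norm_triangle_ineq)
    also have "\<dots> \<le> norm (f z - f w) * norm (g z) * K + norm (f w) * norm (g z - g w) * K"
      by (intro add_mono K)
    also have "\<dots> \<le> (Lf * dist z w) * bg * K + bf * (Lg * dist z w) * K"
      using lipschitz_onD[OF Lf, of z w] lipschitz_onD[OF Lg, of z w] bf bg K(1) L
      by (intro add_mono mult_right_mono mult_mono) (auto simp: dist_norm)
    finally show "dist (prd (f z) (g z)) (prd (f w) (g w)) \<le> (Lf * bg + bf * Lg) * K * dist z w"
      by (simp add: algebra_simps)
  qed (use L bf bg K in simp)
  then show ?thesis by blast
qed

lemma lipschitz_const: "\<exists>L. L-lipschitz_on UNIV (\<lambda>z::circle. c)"
  by (metis lipschitz_on_constant)

lemma circle_lipschitz_linear: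
  fixes f :: "circle \<Rightarrow> 'a::real_normed_vector"
  assumes "bounded_linear T" "\<exists>L. L-lipschitz_on UNIV f"
  shows "\<exists>L. L-lipschitz_on UNIV (\<lambda>z. T (f z))"
proof -
  obtain K where K: "K > 0" "\<And>x. norm (T x) \<le> norm x * K"
    using bounded_linear.pos_bounded[OF assms(1)] by blast
  obtain L where L: "L-lipschitz_on UNIV f" using assms(2) by blast
  have "(L * K)-lipschitz_on UNIV (\<lambda>z. T (f z))"
  proof (rule lipschitz_onI)
    fix z w
    have "dist (T (f z)) (T (f w)) = norm (T (f z - f w))"
      by (simp add: dist_norm linear_diff[OF bounded_linear.linear[OF assms(1)]])
    also have "\<dots> \<le> dist (f z) (f w) * K" unfolding dist_norm by (rule K)
    also have "\<dots> \<le> (L * dist z w) * K"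
      using lipschitz_onD[OF L, of z w] K(1) by (intro mult_right_mono) auto
    finally show "dist (T (f z)) (T (f w)) \<le> L * K * dist z w" by (simp add: mult_ac)
  qed (use K lipschitz_on_nonneg[OF L] in simp)
  then show ?thesis by blast
qed

lemma norm_mat_mult: "norm (mat c ** M) = norm c * norm M" for M :: "complex^'b^'k"
proof -
  have "cnj c * (c * m) = (norm c)\<^sup>2 *\<^sub>R m" for m :: complex
    using complex_norm_square[of c] by (simp add: scaleR_conv_of_real mult_ac)
  then have "mat (cnj c) ** (mat c ** M) = (norm c)\<^sup>2 *\<^sub>R M"
    by (simp add: vec_eq_iff mat_mult_component)
  then have "(mat c ** M) \<bullet> (mat c ** M) = (norm c)\<^sup>2 * (M \<bullet> M)"
    by (simp add: inner_matrix_mult_left)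
  then have "(norm (mat c ** M))\<^sup>2 = (norm c * norm M)\<^sup>2"
    by (simp only: power2_norm_eq_inner power_mult_distrib)
  then show ?thesis by (simp add: power2_eq_iff_nonneg)
qed

text \<open>By the resolvent identity \<open>(z - Z)\<^sup>-\<^sup>1 - (w - Z)\<^sup>-\<^sup>1 = (w - z) (z - Z)\<^sup>-\<^sup>1 (w - Z)\<^sup>-\<^sup>1\<close>.\<close>

lemma lipschitz_resolvent:
  assumes "stable Z"
  shows "\<exists>L. L-lipschitz_on UNIV (resolvent Z)"
proof -
  obtain b where b: "b > 0" "\<And>z. norm (resolvent Z z) \<le> b"
    using circle_continuous_bounded[OF continuous_resolvent[OF assms]] by (auto simp: bounded_pos)
  obtain K where K: "K > 0" "\<And>(M :: complex^'a^'a) (N :: complex^'a^'a). norm (M ** N) \<le> norm M * norm N * K"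
    using bounded_bilinear.pos_bounded[OF bounded_bilinear_matrix_mult] by blast
  have "(b * b * K)-lipschitz_on UNIV (resolvent Z)"
  proof (rule lipschitz_onI)
    fix z w
    let ?z = "complex_of_circle z" and ?w = "complex_of_circle w"
    have inv: "invertible (mat (complex_of_circle v) - Z)" for v
      using resolvent_cancel[OF assms, of v] matrix_inv_unique(1) by blast
    have m: "mat ?w - mat ?z = (mat (?w - ?z) :: complex^'a^'a)"
      by (simp add: vec_eq_iff mat_def)
    have "resolvent Z z - resolvent Z w = resolvent Z z ** mat (?w - ?z) ** resolvent Z w"
      using matrix_inv_diff[OF inv inv, of z w] by (simp add: m flip: resolvent_def)
    also have "\<dots> = mat (?w - ?z) ** (resolvent Z z ** resolvent Z w)"
      by (simp add: matrix_mul_assoc flip: mat_commute)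
    finally have "norm (resolvent Z z - resolvent Z w) = norm (?w - ?z) * norm (resolvent Z z ** resolvent Z w)"
      by (simp add: norm_mat_mult)
    also have "norm (?w - ?z) = dist z w"
      by (simp add: dist_circle.rep_eq dist_norm norm_minus_commute)
    also have "norm (resolvent Z z ** resolvent Z w) \<le> b * b * K"
    proof -
      have "norm (resolvent Z z ** resolvent Z w) \<le> norm (resolvent Z z) * norm (resolvent Z w) * K"
        by (rule K)
      also have "\<dots> \<le> b * b * K"
        using b K(1) by (intro mult_right_mono mult_mono) auto
      finally show ?thesis .
    qed
    finally have "norm (resolvent Z z - resolvent Z w) \<le> dist z w * (b * b * K)"
      by (simp add: mult_left_mono)
    then show "dist (resolvent Z z) (resolvent Z w) \<le> b * b * K * dist z w"
      unfolding dist_norm[of "resolvent Z z"] by (simp only: mult.commute)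
  qed (use b K in simp)
  then show ?thesis by blast
qed

lemma dist_cis_circle_le: "dist (cis_circle s) (cis_circle t) \<le> \<bar>s - t\<bar>"
proof -
  have "cis s - cis t = cis t * (cis (s - t) - 1)"
    by (simp add: right_diff_distrib cis_mult)
  then have "dist (cis s) (cis t) = norm (cis (s - t) - 1)"
    by (simp add: dist_norm norm_mult)
  also have "\<dots> = 2 * \<bar>sin ((s - t) / 2)\<bar>"
    using dist_exp_i_1[of "s - t"] by (simp add: cis_conv_exp)
  also have "\<dots> \<le> 2 * \<bar>(s - t) / 2\<bar>"
    by (intro mult_left_mono abs_sin_x_le_abs_x) simp
  finally show ?thesis by (simp add: dist_circle.rep_eq cis_circle.rep_eq)
qed

lemma log_divergence:
  fixes a C r s S :: real
  assumes "a > 0" "C > 0" "r > 0"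
  obtains e where "e > 0" "S < integral {s..s + r} (\<lambda>t. a / (e + C * (t - s)))"
proof -
  \<comment> \<open>the integral is \<open>(a / C) ln (1 + C r / e)\<close>, and this \<open>e\<close> makes \<open>(a / C) ln (C r / e)\<close> equal to \<open>\<bar>S\<bar>\<close>\<close>
  define e where "e = C * r / exp (\<bar>S\<bar> * C / a)"
  have e: "e > 0" using assms by (simp add: e_def)
  have "((\<lambda>t. a / (e + C * (t - s))) has_integral
      (a / C) * ln (e + C * ((s + r) - s)) - (a / C) * ln (e + C * (s - s))) {s..s + r}"
  proof (rule fundamental_theorem_of_calculus)
    fix t assume "t \<in> {s..s + r}"
    then have "0 < e + C * (t - s)" using e assms by (intro add_pos_nonneg mult_nonneg_nonneg) auto
    then have "((\<lambda>t. (a / C) * ln (e + C * (t - s))) has_real_derivative (a / C) * (C / (e + C * (t - s)))) (at t within {s..s + r})"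
      by (auto intro!: derivative_eq_intros)
    then have "((\<lambda>t. (a / C) * ln (e + C * (t - s))) has_real_derivative a / (e + C * (t - s))) (at t within {s..s + r})"
      using assms by simp
    then show "((\<lambda>t. (a / C) * ln (e + C * (t - s))) has_vector_derivative a / (e + C * (t - s))) (at t within {s..s + r})"
      by (simp add: has_real_derivative_iff_has_vector_derivative)
  qed (use assms in simp)
  then have "integral {s..s + r} (\<lambda>t. a / (e + C * (t - s))) = (a / C) * (ln (e + C * r) - ln e)"
    by (simp add: integral_unique right_diff_distrib)
  moreover have "\<bar>S\<bar> * C / a < ln (e + C * r) - ln e"
  proof -
    have "ln (C * r) < ln (e + C * r)"
      using assms e by (subst ln_less_cancel_iff) (auto simp: add_pos_pos)
    moreover have "ln e = ln (C * r) - \<bar>S\<bar> * C / a"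
      using assms by (simp add: e_def ln_div)
    ultimately show ?thesis by linarith
  qed
  then have "(a / C) * (\<bar>S\<bar> * C / a) < (a / C) * (ln (e + C * r) - ln e)"
    using assms by (intro mult_strict_left_mono) auto
  then have "\<bar>S\<bar> < (a / C) * (ln (e + C * r) - ln e)" using assms by simp
  ultimately show ?thesis using that[OF e] by linarith
qed

context stable_system
begin

lemma lipschitz_G: "\<exists>L. L-lipschitz_on UNIV G"
  unfolding transfer_G_eq[abs_def]
  by (intro circle_lipschitz_bilinear[OF bounded_bilinear_matrix_mult] lipschitz_resolvent
      lipschitz_const stable_A)

text \<open>Let \<open>y = G\<^sup>\<dagger> u\<close> with \<open>u\<close> chosen such that \<open>y = x\<close> at \<open>z\<^sub>0\<close>, which is possible because \<open>G\<close> is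
  injective.  The form of \<open>G\<^sup>\<dagger> \<Lambda> G\<close> along \<open>y\<close> is a Lipschitz function on the circle with a zero
  at \<open>z\<^sub>0\<close>, so the integral of \<open>\<parallel>y\<parallel>\<^sup>4\<close> divided by it diverges.  The constant \<open>e\<close> regularizes the
  quotient; it absorbs the difference between \<open>\<Lambda>\<close> and a nearby matrix later on.\<close>

lemma singular_blow_up:
  assumes "x \<noteq> 0" "(G z0 *v x) \<bullet> (\<Lambda> *v (G z0 *v x)) = 0"
  shows "\<exists>u. \<forall>S. \<exists>e>0. S < circle_integral (\<lambda>z. (((G z)\<^sup>\<dagger> *v u) \<bullet> ((G z)\<^sup>\<dagger> *v u))\<^sup>2
      / (e + \<bar>(G z *v ((G z)\<^sup>\<dagger> *v u)) \<bullet> (\<Lambda> *v (G z *v ((G z)\<^sup>\<dagger> *v u)))\<bar>))"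
proof -
  have "pos_def ((G z0)\<^sup>\<dagger> ** mat 1 ** G z0)"
    by (rule pos_def_congruence[OF _ G_inj]) (simp add: pos_def_iff HermitianI)
  then have inv: "invertible ((G z0)\<^sup>\<dagger> ** G z0)"
    using pos_def_invertible by fastforce
  define u where "u = (G z0 ** matrix_inv ((G z0)\<^sup>\<dagger> ** G z0)) *v x"
  define y where "y z = (G z)\<^sup>\<dagger> *v u" for z
  define q where "q z = (G z *v y z) \<bullet> (\<Lambda> *v (G z *v y z))" for z
  have "y z0 = ((G z0)\<^sup>\<dagger> ** G z0 ** matrix_inv ((G z0)\<^sup>\<dagger> ** G z0)) *v x"
    unfolding y_def u_def by (simp only: matrix_vector_mul_assoc matrix_mul_assoc)
  then have y0: "y z0 = x" by (simp add: matrix_inv_cancel[OF inv])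
  then have q0: "q z0 = 0" by (simp add: q_def assms(2))
  have "\<exists>L. L-lipschitz_on UNIV y"
    unfolding y_def
    by (intro circle_lipschitz_bilinear[OF bounded_bilinear_matrix_vector_mult]
        circle_lipschitz_linear[OF bounded_linear_conj_transpose] lipschitz_G lipschitz_const)
  then have lip_y: "\<exists>L. L-lipschitz_on UNIV y" .
  then have cy: "continuous_on UNIV y" using lipschitz_on_continuous_on by blast
  have lip_w: "\<exists>L. L-lipschitz_on UNIV (\<lambda>z. G z *v y z)"
    by (intro circle_lipschitz_bilinear[OF bounded_bilinear_matrix_vector_mult] lipschitz_G lip_y)
  have "\<exists>L. L-lipschitz_on UNIV q"
    unfolding q_def
    by (intro circle_lipschitz_bilinear[OF bounded_bilinear_inner]
        circle_lipschitz_bilinear[OF bounded_bilinear_matrix_vector_mult] lip_w lipschitz_const)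
  then obtain L where L: "L-lipschitz_on UNIV q" by blast
  then have cq: "continuous_on UNIV q" by (rule lipschitz_on_continuous_on)
  have L0: "0 \<le> L" using L by (rule lipschitz_on_nonneg)
  obtain \<theta> where \<theta>: "0 \<le> \<theta>" "\<theta> < 2 * pi" "z0 = cis_circle \<theta>"
    using cis_circle_surj[of z0] by auto
  define a where "a = (x \<bullet> x)\<^sup>2 / 2"
  have a: "a > 0" using assms(1) by (simp add: a_def)
  define p where "p t = (y (cis_circle t) \<bullet> y (cis_circle t))\<^sup>2" for t
  have "continuous_on UNIV p"
    unfolding p_def by (intro continuous_intros continuous_on_cis_circle cy)
  then obtain d where d: "d > 0" and "\<And>t. dist t \<theta> < d \<Longrightarrow> dist (p t) (p \<theta>) < a"
    using a unfolding continuous_on_iff by (metis UNIV_I)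
  moreover have "p \<theta> = 2 * a"
    using y0 by (simp add: p_def a_def flip: \<theta>(3))
  ultimately have near: "a \<le> p t" if "\<bar>t - \<theta>\<bar> < d" for t
    using that by (force simp: dist_real_def)
  define r where "r = min (d / 2) (2 * pi - \<theta>)"
  have r: "r > 0" "r < d" "\<theta> + r \<le> 2 * pi" using d \<theta> by (auto simp: r_def)
  have "\<exists>e>0. S < circle_integral (\<lambda>z. (y z \<bullet> y z)\<^sup>2 / (e + \<bar>q z\<bar>))" for S
  proof -
    obtain e where e: "e > 0" "S * (2 * pi) < integral {\<theta>..\<theta> + r} (\<lambda>t. a / (e + (L + 1) * (t - \<theta>)))"
      using log_divergence[of a "L + 1" r "S * (2 * pi)" \<theta>] a L0 r by auto
    define f where "f z = (y z \<bullet> y z)\<^sup>2 / (e + \<bar>q z\<bar>)" for z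
    have cf: "continuous_on UNIV f"
      unfolding f_def using e(1) by (intro continuous_intros cy cq) (auto simp: add_pos_nonneg pos_add_strict intro: less_imp_neq[symmetric])
    have "integral {\<theta>..\<theta> + r} (\<lambda>t. a / (e + (L + 1) * (t - \<theta>))) \<le> integral {\<theta>..\<theta> + r} (\<lambda>t. f (cis_circle t))"
    proof (rule integral_le)
      have "0 < e + (L + 1) * (t - \<theta>)" if "t \<in> {\<theta>..\<theta> + r}" for t
        using that e(1) L0 by (intro add_pos_nonneg mult_nonneg_nonneg) auto
      then show "(\<lambda>t. a / (e + (L + 1) * (t - \<theta>))) integrable_on {\<theta>..\<theta> + r}"
        by (intro integrable_continuous_real continuous_intros) force
      show "(\<lambda>t. f (cis_circle t)) integrable_on {\<theta>..\<theta> + r}"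
        by (intro integrable_continuous_real continuous_on_cis_circle cf)
      fix t assume t: "t \<in> {\<theta>..\<theta> + r}"
      have "\<bar>q (cis_circle t)\<bar> = dist (q (cis_circle t)) (q z0)"
        by (simp add: q0)
      also have "\<dots> \<le> L * dist (cis_circle t) z0"
        by (rule lipschitz_onD[OF L]) auto
      also have "\<dots> \<le> L * (t - \<theta>)"
        using dist_cis_circle_le[of t \<theta>] t L0 by (intro mult_left_mono) (auto simp: \<theta>(3))
      also have "\<dots> \<le> (L + 1) * (t - \<theta>)" using t by (intro mult_right_mono) auto
      finally have q: "\<bar>q (cis_circle t)\<bar> \<le> (L + 1) * (t - \<theta>)" .
      show "a / (e + (L + 1) * (t - \<theta>)) \<le> f (cis_circle t)"
        unfolding f_def using q e(1) a t r by (intro frac_le near[unfolded p_def]) auto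
    qed
    also have "\<dots> \<le> integral {0..2 * pi} (\<lambda>t. f (cis_circle t))"
      using \<theta> r e(1)
      by (intro integral_subset_le integrable_continuous_real continuous_on_cis_circle cf)
         (auto simp: f_def)
    finally have "S * (2 * pi) < integral {0..2 * pi} (\<lambda>t. f (cis_circle t))"
      using e(2) by linarith
    then have "S < circle_integral f"
      by (simp add: circle_integral_eq[OF cf] field_simps)
    then show ?thesis using e(1) unfolding f_def by blast
  qed
  then show ?thesis unfolding y_def q_def by blast
qed

end

section \<open>Bilinear integrals of continuous functions on the circle\<close>

lemma apply_bcontfun_circle:
  "continuous_on UNIV f \<Longrightarrow> apply_bcontfun (Bcontfun f) = f" for f :: "circle \<Rightarrow> 'a::metric_space"
  by (simp add: Bcontfun_inverse circle_continuous_bcontfun)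

lemma continuous_on_bilinear_bcontfun:
  assumes "bounded_bilinear prd"
  shows "continuous_on S (\<lambda>z. prd (apply_bcontfun f z) (apply_bcontfun g z))"
  by (intro bounded_bilinear.continuous_on[OF assms] continuous_on_apply_bcontfun)

lemma bounded_bilinear_bcontfun:
  fixes prd :: "'a::real_normed_vector \<Rightarrow> 'b::real_normed_vector \<Rightarrow> 'c::real_normed_vector"
  assumes "bounded_bilinear prd"
  shows "bounded_bilinear (\<lambda>(f :: circle \<Rightarrow>\<^sub>C 'a) (g :: circle \<Rightarrow>\<^sub>C 'b). Bcontfun (\<lambda>z. prd (apply_bcontfun f z) (apply_bcontfun g z)))"
proof -
  interpret bounded_bilinear prd by fact
  define P where "P f g = Bcontfun (\<lambda>z. prd (apply_bcontfun f z) (apply_bcontfun g z))"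
    for f :: "circle \<Rightarrow>\<^sub>C 'a" and g :: "circle \<Rightarrow>\<^sub>C 'b"
  have P: "apply_bcontfun (P f g) z = prd (apply_bcontfun f z) (apply_bcontfun g z)" for f g z
    unfolding P_def by (subst apply_bcontfun_circle) (rule continuous_on_bilinear_bcontfun[OF assms], rule refl)
  obtain K where K: "K > 0" "\<And>a b. norm (prd a b) \<le> norm a * norm b * K"
    using pos_bounded by blast
  have "bounded_bilinear P"
  proof
    show "\<exists>K. \<forall>f g. norm (P f g) \<le> norm f * norm g * K"
    proof (intro exI[of _ K] allI norm_bound)
      fix f :: "circle \<Rightarrow>\<^sub>C 'a" and g :: "circle \<Rightarrow>\<^sub>C 'b" and z
      have "norm (prd (apply_bcontfun f z) (apply_bcontfun g z))
          \<le> norm (apply_bcontfun f z) * norm (apply_bcontfun g z) * K" by (rule K)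
      also have "\<dots> \<le> norm f * norm g * K"
        using K(1) by (intro mult_right_mono mult_mono norm_bounded) auto
      finally show "norm (apply_bcontfun (P f g) z) \<le> norm f * norm g * K"
        by (simp add: P)
    qed
  qed (auto intro!: bcontfun_eqI simp: P add_left add_right scaleR_left scaleR_right)
  then show ?thesis unfolding P_def[abs_def] .
qed

lemma bounded_bilinear_circle_integral:
  fixes prd :: "'a::real_normed_vector \<Rightarrow> 'b::real_normed_vector \<Rightarrow> 'c::euclidean_space"
  assumes "bounded_bilinear prd"
  shows "bounded_bilinear (\<lambda>(f :: circle \<Rightarrow>\<^sub>C 'a) (g :: circle \<Rightarrow>\<^sub>C 'b). circle_integral (\<lambda>z. prd (apply_bcontfun f z) (apply_bcontfun g z)))"
proof -
  interpret bounded_bilinear prd by fact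
  note c = continuous_on_bilinear_bcontfun[OF assms, of UNIV]
  obtain K where K: "K > 0" "\<And>a b. norm (prd a b) \<le> norm a * norm b * K"
    using pos_bounded by blast
  show ?thesis
  proof
    show "\<exists>K. \<forall>(f :: circle \<Rightarrow>\<^sub>C 'a) (g :: circle \<Rightarrow>\<^sub>C 'b).
        norm (circle_integral (\<lambda>z. prd (apply_bcontfun f z) (apply_bcontfun g z))) \<le> norm f * norm g * K"
    proof (intro exI[of _ K] allI circle_integral_norm_le c)
      fix f :: "circle \<Rightarrow>\<^sub>C 'a" and g :: "circle \<Rightarrow>\<^sub>C 'b" and z
      have "norm (prd (apply_bcontfun f z) (apply_bcontfun g z)) \<le> norm (apply_bcontfun f z) * norm (apply_bcontfun g z) * K" by (rule K)
      also have "\<dots> \<le> norm f * norm g * K"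
        using K(1) by (intro mult_right_mono mult_mono norm_bounded) auto
      finally show "norm (prd (apply_bcontfun f z) (apply_bcontfun g z)) \<le> norm f * norm g * K" .
    qed
  next
    fix r and f :: "circle \<Rightarrow>\<^sub>C 'a" and g :: "circle \<Rightarrow>\<^sub>C 'b"
    show "circle_integral (\<lambda>z. prd (apply_bcontfun (r *\<^sub>R f) z) (apply_bcontfun g z)) = r *\<^sub>R circle_integral (\<lambda>z. prd (apply_bcontfun f z) (apply_bcontfun g z))"
      and "circle_integral (\<lambda>z. prd (apply_bcontfun f z) (apply_bcontfun (r *\<^sub>R g) z)) = r *\<^sub>R circle_integral (\<lambda>z. prd (apply_bcontfun f z) (apply_bcontfun g z))"
      using circle_integral_linear[OF c[of f g] bounded_linear_scaleR_right[of r]]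
      by (simp_all add: scaleR_left scaleR_right)
  qed (simp_all add: add_left add_right circle_integral_add c)
qed

text \<open>Pointwise joint continuity is uniform in the variable that runs over the compact circle, and the
  norm of bounded continuous functions is the uniform one.\<close>

lemma continuous_on_Bcontfun:
  fixes f :: "'x::metric_space \<Rightarrow> circle \<Rightarrow> 'b::metric_space"
  assumes "continuous_on (U \<times> UNIV) (\<lambda>p. f (fst p) (snd p))"
  shows "continuous_on U (\<lambda>x. Bcontfun (f x))"
proof -
  have c: "continuous_on UNIV (f x)" if "x \<in> U" for x
    using continuous_on_compose2[OF assms, of UNIV "\<lambda>z. (x, z)"] that
    by (force intro: continuous_intros)
  show ?thesis
    unfolding continuous_on_iff
  proof (intro ballI allI impI)
    fix x and e :: real assume x: "x \<in> U" and e: "0 < e"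
    obtain X where X: "x \<in> X" "open X"
      "\<forall>x'\<in>X \<inter> U. \<forall>z\<in>UNIV. dist (f (fst (x', z)) (snd (x', z))) (f (fst (x, z)) (snd (x, z))) \<le> e / 2"
      using continuous_on_prod_compactE[OF assms compact_circle x half_gt_zero[OF e]] by metis
    obtain d where d: "d > 0" "ball x d \<subseteq> X" using X by (meson open_contains_ball)
    have "dist (Bcontfun (f x')) (Bcontfun (f x)) < e" if "x' \<in> U" "dist x' x < d" for x'
    proof -
      have "x' \<in> X" using d that by (auto simp: dist_commute)
      then have "dist (Bcontfun (f x')) (Bcontfun (f x)) \<le> e / 2"
        using X(3) that(1) by (intro dist_bound) (simp add: apply_bcontfun_circle c x)
      then show ?thesis using e by simp
    qed
    then show "\<exists>d>0. \<forall>x'\<in>U. dist x' x < d \<longrightarrow> dist (Bcontfun (f x')) (Bcontfun (f x)) < e"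
      using d(1) by blast
  qed
qed

lemma C_plus_lower_bound:
  assumes "\<psi> \<in> C_plus"
  obtains p where "p > 0" "\<And>z. p \<le> apply_bcontfun \<psi> z"
proof -
  obtain z0 where "\<forall>z. apply_bcontfun \<psi> z0 \<le> apply_bcontfun \<psi> z"
    using continuous_attains_inf[OF compact_circle, of "apply_bcontfun \<psi>"] by auto
  then show ?thesis using that[of "apply_bcontfun \<psi> z0"] assms by (auto simp: C_plus_def)
qed

lemma open_C_plus: "open C_plus"
  unfolding open_dist
proof (intro ballI)
  fix \<psi> :: "circle \<Rightarrow>\<^sub>C real" assume "\<psi> \<in> C_plus"
  then obtain p where p: "p > 0" "\<And>z. p \<le> apply_bcontfun \<psi> z"
    using C_plus_lower_bound by blast
  have "\<phi> \<in> C_plus" if "dist \<phi> \<psi> < p" for \<phi>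
  proof -
    have "0 < apply_bcontfun \<phi> z" for z
      using dist_fun_lt_imp_dist_val_lt[OF that, of z] p(2)[of z] by (simp add: dist_real_def)
    then show ?thesis by (simp add: C_plus_def)
  qed
  then show "\<exists>e>0. \<forall>\<phi>. dist \<phi> \<psi> < e \<longrightarrow> \<phi> \<in> C_plus" using p(1) by blast
qed

lemma bounded_linear_quadratic_form: "bounded_linear (\<lambda>M :: complex^'k^'k. x \<bullet> (M *v x))"
  by (rule bounded_linear_compose[OF bounded_linear_inner_right
        bounded_bilinear.bounded_linear_left[OF bounded_bilinear_matrix_vector_mult]])

context stable_system
begin

section \<open>The moment map\<close>

definition moment_kernel :: "complex^'n^'n \<Rightarrow> circle \<Rightarrow> complex^'n^'n"
  where "moment_kernel \<Lambda> z = G z ** matrix_inv ((G z)\<^sup>\<dagger> ** \<Lambda> ** G z) ** (G z)\<^sup>\<dagger>"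

text \<open>As an element of the Banach space of continuous functions, so that its dependence on \<open>\<Lambda>\<close> can be
  composed with bounded bilinear integrals.\<close>

definition moment_kernel_fun :: "complex^'n^'n \<Rightarrow> circle \<Rightarrow>\<^sub>C (complex^'n^'n)"
  where "moment_kernel_fun \<Lambda> = Bcontfun (moment_kernel \<Lambda>)"

lemma L_plus_pos_def: "\<Lambda> \<in> L_plus A B \<Longrightarrow> pos_def ((G z)\<^sup>\<dagger> ** \<Lambda> ** G z)"
  by (simp add: L_plus_eq)

lemma continuous_moment_kernel_joint: "continuous_on (L_plus A B \<times> UNIV) (\<lambda>p. moment_kernel (fst p) (snd p))"
  unfolding moment_kernel_def
  by (intro continuous_intros continuous_on_compose2[OF continuous_G[of UNIV]])
     (auto simp: pos_def_invertible L_plus_pos_def)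

lemma continuous_moment_kernel:
  assumes "\<Lambda> \<in> L_plus A B"
  shows "continuous_on UNIV (moment_kernel \<Lambda>)"
  using assms continuous_on_compose2[OF continuous_moment_kernel_joint, of UNIV "\<lambda>z. (\<Lambda>, z)"]
  by (force intro: continuous_intros)

lemma apply_moment_kernel_fun: "\<Lambda> \<in> L_plus A B \<Longrightarrow> apply_bcontfun (moment_kernel_fun \<Lambda>) = moment_kernel \<Lambda>"
  unfolding moment_kernel_fun_def by (intro apply_bcontfun_circle continuous_moment_kernel)

lemma continuous_moment_kernel_fun: "continuous_on (L_plus A B) moment_kernel_fun"
  unfolding moment_kernel_fun_def[abs_def] by (intro continuous_on_Bcontfun continuous_moment_kernel_joint)

lemma moment_map_eq: "moment_map A B \<psi> \<Lambda> = circle_integral (\<lambda>z. apply_bcontfun \<psi> z *\<^sub>R moment_kernel \<Lambda> z)"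
  by (simp add: moment_map_def moment_kernel_def transfer_G_adj_eq matrix_mult_simps)

lemma continuous_scaled_moment_kernel:
  assumes "\<Lambda> \<in> L_plus A B"
  shows "continuous_on UNIV (\<lambda>z. apply_bcontfun \<psi> z *\<^sub>R moment_kernel \<Lambda> z)"
  by (intro continuous_intros continuous_moment_kernel assms continuous_on_apply_bcontfun)

lemma moment_kernel_diff:
  assumes "\<Lambda> \<in> L_plus A B" "M \<in> L_plus A B"
  shows "moment_kernel M z - moment_kernel \<Lambda> z = moment_kernel M z ** (\<Lambda> - M) ** moment_kernel \<Lambda> z"
proof -
  let ?Q = "\<lambda>\<Lambda>. (G z)\<^sup>\<dagger> ** \<Lambda> ** G z"
  have inv: "invertible (?Q \<Lambda>)" "invertible (?Q M)"
    using assms by (auto intro: pos_def_invertible L_plus_pos_def)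
  have "moment_kernel M z - moment_kernel \<Lambda> z = G z ** (matrix_inv (?Q M) - matrix_inv (?Q \<Lambda>)) ** (G z)\<^sup>\<dagger>"
    by (simp add: moment_kernel_def matrix_mult_simps)
  also have "\<dots> = G z ** (matrix_inv (?Q M) ** (?Q \<Lambda> - ?Q M) ** matrix_inv (?Q \<Lambda>)) ** (G z)\<^sup>\<dagger>"
    by (simp only: matrix_inv_diff[OF inv(2) inv(1)])
  also have "?Q \<Lambda> - ?Q M = ?Q (\<Lambda> - M)"
    by (simp add: matrix_mult_simps)
  finally show ?thesis by (simp only: moment_kernel_def matrix_mul_assoc)
qed

lemma moment_map_range:
  assumes "\<Lambda> \<in> L_plus A B"
  shows "moment_map A B \<psi> \<Lambda> \<in> Range_Gamma A B"
proof -
  let ?\<Phi> = "\<lambda>z. apply_bcontfun \<psi> z *\<^sub>R matrix_inv ((G z)\<^sup>\<dagger> ** \<Lambda> ** G z)"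
  have "continuous_on UNIV ?\<Phi>"
    by (intro continuous_intros continuous_on_apply_bcontfun pos_def_invertible L_plus_pos_def assms)
  moreover have "?\<Phi> z \<in> Hermitian" for z
    using pos_def_matrix_inv[OF L_plus_pos_def[OF assms, of z]]
    by (simp add: pos_def_iff Hermitian_def conj_transpose_scaleR)
  ultimately have "?\<Phi> \<in> C_Hermitian" by (simp add: C_Hermitian_def)
  moreover have "moment_map A B \<psi> \<Lambda> = Gamma A B ?\<Phi>"
    by (simp add: moment_map_def Gamma_def transfer_G_adj_eq)
  ultimately show ?thesis by (auto simp: Range_Gamma_def)
qed

lemma continuous_moment_map:
  "continuous_on (UNIV \<times> L_plus A B) (\<lambda>p. moment_map A B (fst p) (snd p))"
proof -
  have "continuous_on (UNIV \<times> L_plus A B)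
      (\<lambda>p. circle_integral (\<lambda>z. apply_bcontfun (fst p) z *\<^sub>R apply_bcontfun (moment_kernel_fun (snd p)) z))"
    by (intro bounded_bilinear.continuous_on[OF bounded_bilinear_circle_integral[OF bounded_bilinear_scaleR]]
        continuous_on_fst continuous_on_id continuous_on_compose2[OF continuous_moment_kernel_fun] continuous_on_snd) auto
  then show ?thesis
    by (rule continuous_on_eq) (auto simp: moment_map_eq apply_moment_kernel_fun)
qed

lemma moment_map_quadratic_form:
  assumes "\<Lambda> \<in> L_plus A B"
  shows "u \<bullet> (moment_map A B \<psi> \<Lambda> *v u) = circle_integral (\<lambda>z. apply_bcontfun \<psi> z *
    (((G z)\<^sup>\<dagger> *v u) \<bullet> (matrix_inv ((G z)\<^sup>\<dagger> ** \<Lambda> ** G z) *v ((G z)\<^sup>\<dagger> *v u))))"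
proof -
  have "u \<bullet> (moment_kernel \<Lambda> z *v u) = ((G z)\<^sup>\<dagger> *v u) \<bullet> (matrix_inv ((G z)\<^sup>\<dagger> ** \<Lambda> ** G z) *v ((G z)\<^sup>\<dagger> *v u))" for z
    by (simp add: moment_kernel_def inner_matrix_vector_mult matrix_vector_mul_assoc matrix_mul_assoc)
  moreover have "u \<bullet> ((c *\<^sub>R M) *v u) = c * (u \<bullet> (M *v u))" for c and M :: "complex^'n^'n"
    by (simp add: bounded_bilinear.scaleR_left[OF bounded_bilinear_matrix_vector_mult])
  ultimately show ?thesis
    unfolding moment_map_eq
    by (simp add: circle_integral_linear[OF continuous_scaled_moment_kernel[OF assms] bounded_linear_quadratic_form, symmetric])
qed

text \<open>The integrand is \<open>\<psi> tr (Q\<^sub>\<Lambda>\<^sup>-\<^sup>1 Q\<^sub>\<Lambda>) = m \<psi>\<close>.  This controls \<open>\<Sigma> \<bullet> \<Lambda>\<close> along solutions.\<close>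

lemma moment_map_inner:
  assumes "\<Lambda> \<in> L_plus A B"
  shows "moment_map A B \<psi> \<Lambda> \<bullet> \<Lambda> = CARD('m) * circle_integral (apply_bcontfun \<psi>)"
proof -
  have Q: "moment_kernel \<Lambda> z \<bullet> \<Lambda> = CARD('m)" for z
  proof -
    let ?Q = "(G z)\<^sup>\<dagger> ** \<Lambda> ** G z"
    have pd: "pos_def ?Q" by (rule L_plus_pos_def[OF assms])
    then have h: "(matrix_inv ?Q)\<^sup>\<dagger> = matrix_inv ?Q"
      using pos_def_matrix_inv[OF pd] by (simp add: pos_def_iff HermitianD)
    have "moment_kernel \<Lambda> z \<bullet> \<Lambda> = matrix_inv ?Q \<bullet> ?Q"
      unfolding moment_kernel_def inner_matrix_mult_right[of "G z ** matrix_inv ?Q" "(G z)\<^sup>\<dagger>" \<Lambda>]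
        inner_matrix_mult_left[of "G z" "matrix_inv ?Q"]
      by (simp add: matrix_mul_assoc)
    also have "\<dots> = (mat 1 ** matrix_inv ?Q) \<bullet> ?Q" by simp
    also have "\<dots> = (mat 1 :: complex^'m^'m) \<bullet> (?Q ** matrix_inv ?Q)"
      unfolding inner_matrix_mult_right h ..
    also have "?Q ** matrix_inv ?Q = mat 1"
      by (rule matrix_inv_cancel[OF pos_def_invertible[OF pd]])
    also have "(mat 1 :: complex^'m^'m) \<bullet> mat 1 = CARD('m)"
      by (simp add: inner_vec_def mat_def if_distrib[of "\<lambda>x. x \<bullet> _"] cong: if_cong)
    finally show ?thesis .
  qed
  have "moment_map A B \<psi> \<Lambda> \<bullet> \<Lambda> = circle_integral (\<lambda>z. (apply_bcontfun \<psi> z *\<^sub>R moment_kernel \<Lambda> z) \<bullet> \<Lambda>)"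
    unfolding moment_map_eq
    by (rule circle_integral_inner_left[OF continuous_scaled_moment_kernel[OF assms], symmetric])
  also have "\<dots> = circle_integral (\<lambda>z. CARD('m) * apply_bcontfun \<psi> z)"
    by (simp add: Q mult.commute)
  also have "\<dots> = CARD('m) * circle_integral (apply_bcontfun \<psi>)"
    by (rule circle_integral_linear[OF continuous_on_apply_bcontfun bounded_linear_mult_right])
  finally show ?thesis .
qed

text \<open>For \<open>M = \<Lambda>\<close> this is minus the derivative of the moment map with respect to \<open>\<Lambda>\<close>; for different \<open>M\<close>
  and \<open>\<Lambda>\<close> it represents exact differences.\<close>

definition secant_op :: "(circle \<Rightarrow>\<^sub>C real) \<Rightarrow> complex^'n^'n \<Rightarrow> complex^'n^'n \<Rightarrow> complex^'n^'n \<Rightarrow> complex^'n^'n"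
  where "secant_op \<psi> \<Lambda> M X = circle_integral (\<lambda>z. apply_bcontfun \<psi> z *\<^sub>R (moment_kernel M z ** X ** moment_kernel \<Lambda> z))"

text \<open>The integrand \<open>X \<bullet> (K\<^sub>M X K\<^sub>\<Lambda>)\<close> equals \<open>D \<bullet> (Q\<^sub>M\<^sup>-\<^sup>1 D Q\<^sub>\<Lambda>\<^sup>-\<^sup>1)\<close> for the compression \<open>D = G\<^sup>\<dagger> X G\<close>, so it is
  positive where \<open>D \<noteq> 0\<close>; and \<open>D\<close> does not vanish identically on the circle, as \<open>X\<close> is in the range.\<close>

lemma secant_op_pos:
  assumes \<psi>: "\<psi> \<in> C_plus" and \<Lambda>: "\<Lambda> \<in> L_plus A B" and M: "M \<in> L_plus A B"
    and X: "X \<in> Range_Gamma A B" "X \<noteq> 0"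
  shows "0 < X \<bullet> secant_op \<psi> \<Lambda> M X"
proof -
  let ?Q = "\<lambda>\<Lambda> z. (G z)\<^sup>\<dagger> ** \<Lambda> ** G z"
  define D where "D z = ?Q X z" for z
  define f where "f z = apply_bcontfun \<psi> z * (X \<bullet> (moment_kernel M z ** X ** moment_kernel \<Lambda> z))" for z
  have ck: "continuous_on UNIV (\<lambda>z. moment_kernel M z ** X ** moment_kernel \<Lambda> z)"
    by (intro continuous_intros continuous_moment_kernel \<Lambda> M)
  then have cf: "continuous_on UNIV f"
    unfolding f_def
    by (intro continuous_on_mult continuous_on_inner continuous_on_const continuous_on_apply_bcontfun)
  have "continuous_on UNIV (\<lambda>z. apply_bcontfun \<psi> z *\<^sub>R (moment_kernel M z ** X ** moment_kernel \<Lambda> z))"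
    by (intro continuous_on_scaleR ck continuous_on_apply_bcontfun)
  from circle_integral_inner_right[OF this]
  have eq: "X \<bullet> secant_op \<psi> \<Lambda> M X = circle_integral f"
    by (simp add: secant_op_def f_def[abs_def])
  have form: "X \<bullet> (moment_kernel M z ** X ** moment_kernel \<Lambda> z) = D z \<bullet> (matrix_inv (?Q M z) ** D z ** matrix_inv (?Q \<Lambda> z))" for z
  proof -
    let ?Y = "matrix_inv (?Q M z) ** D z ** matrix_inv (?Q \<Lambda> z)"
    have "moment_kernel M z ** X ** moment_kernel \<Lambda> z = G z ** ?Y ** (G z)\<^sup>\<dagger>"
      by (simp only: moment_kernel_def D_def matrix_mul_assoc)
    also have "X \<bullet> \<dots> = (X ** G z) \<bullet> (G z ** ?Y)"
      using inner_matrix_mult_right[of X "G z" "G z ** ?Y"] by simp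
    also have "\<dots> = ((G z)\<^sup>\<dagger> ** (X ** G z)) \<bullet> ?Y"
      using inner_matrix_mult_left[of "(G z)\<^sup>\<dagger>" "X ** G z" ?Y] by simp
    finally show ?thesis by (simp only: D_def matrix_mul_assoc)
  qed
  have pd: "pos_def (matrix_inv (?Q M z))" "pos_def (matrix_inv (?Q \<Lambda> z))" for z
    by (intro pos_def_matrix_inv L_plus_pos_def M \<Lambda>)+
  have \<psi>pos: "0 < apply_bcontfun \<psi> z" for z using \<psi> by (simp add: C_plus_def)
  have pos: "0 < f z" if "D z \<noteq> 0" for z
    unfolding f_def form using \<psi>pos pos_def_inner_two_sided[OF pd that] by simp
  then have nonneg: "0 \<le> f z" for z
    by (cases "D z = 0") (auto simp: f_def form intro: less_imp_le)
  have "circle_integral f \<noteq> 0"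
  proof
    assume "circle_integral f = 0"
    then have "f z = 0" for z using circle_integral_nonneg_eq_0[OF cf nonneg] by blast
    then have "D z = 0" for z using pos[of z] by force
    then have "X = 0" using Range_Gamma_compression_eq_0[OF X(1)] by (simp add: D_def)
    then show False using X(2) by simp
  qed
  then show ?thesis
    unfolding eq using circle_integral_nonneg[OF cf nonneg] by simp
qed

lemma moment_map_difference:
  assumes "\<Lambda> \<in> L_plus A B" "M \<in> L_plus A B"
  shows "moment_map A B \<phi> M - moment_map A B \<psi> \<Lambda> = moment_map A B (\<phi> - \<psi>) M - secant_op \<psi> \<Lambda> M (M - \<Lambda>)"
proof -
  have c: "continuous_on UNIV (\<lambda>z. apply_bcontfun \<psi> z *\<^sub>R (moment_kernel M z ** (M - \<Lambda>) ** moment_kernel \<Lambda> z))"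
    by (intro continuous_intros continuous_moment_kernel assms continuous_on_apply_bcontfun)
  have eq: "apply_bcontfun \<phi> z *\<^sub>R moment_kernel M z - apply_bcontfun \<psi> z *\<^sub>R moment_kernel \<Lambda> z
      = apply_bcontfun (\<phi> - \<psi>) z *\<^sub>R moment_kernel M z - apply_bcontfun \<psi> z *\<^sub>R (moment_kernel M z ** (M - \<Lambda>) ** moment_kernel \<Lambda> z)" for z
  proof -
    have "moment_kernel M z ** (M - \<Lambda>) ** moment_kernel \<Lambda> z = moment_kernel \<Lambda> z - moment_kernel M z"
      using moment_kernel_diff[OF assms, of z] by (simp add: matrix_mult_simps) (metis minus_diff_eq)
    then show ?thesis
      by (simp add: scaleR_left_diff_distrib scaleR_right_diff_distrib)
  qed
  show ?thesis
    unfolding moment_map_eq secant_op_def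
      circle_integral_diff[OF continuous_scaled_moment_kernel[OF assms(2)] continuous_scaled_moment_kernel[OF assms(1)], symmetric]
      circle_integral_diff[OF continuous_scaled_moment_kernel[OF assms(2)] c, symmetric] eq ..
qed

lemma moment_map_inj:
  assumes \<psi>: "\<psi> \<in> C_plus" and \<Lambda>: "\<Lambda> \<in> L_plus_Gamma A B" and M: "M \<in> L_plus_Gamma A B"
    and eq: "moment_map A B \<psi> \<Lambda> = moment_map A B \<psi> M"
  shows "\<Lambda> = M"
proof (rule ccontr)
  assume ne: "\<Lambda> \<noteq> M"
  have L: "\<Lambda> \<in> L_plus A B" "M \<in> L_plus A B" and V: "M - \<Lambda> \<in> Range_Gamma A B"
    using \<Lambda> M subspace_Range_Gamma by (auto simp: L_plus_Gamma_def subspace_diff)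
  have "moment_map A B 0 M = 0" by (simp add: moment_map_eq)
  with moment_map_difference[OF L, of \<psi> \<psi>] have "secant_op \<psi> \<Lambda> M (M - \<Lambda>) = 0"
    by (simp add: eq)
  with secant_op_pos[OF \<psi> L V] ne show False by simp
qed

section \<open>Properness of the moment map\<close>

definition nonneg_on_circle :: "complex^'n^'n \<Rightarrow> bool"
  where "nonneg_on_circle \<Lambda> \<longleftrightarrow> (\<forall>z x. 0 \<le> (G z *v x) \<bullet> (\<Lambda> *v (G z *v x)))"

lemma nonneg_on_circle_pos_semidef:
  assumes "\<Lambda> \<in> Hermitian" "nonneg_on_circle \<Lambda>"
  shows "pos_semidef ((G z)\<^sup>\<dagger> ** \<Lambda> ** G z)"
  using assms Hermitian_compression[OF assms(1), of z]
  by (simp add: pos_semidef_def nonneg_on_circle_def inner_matrix_vector_mult matrix_vector_mul_assoc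
      matrix_mul_assoc)

lemma L_plus_nonneg_on_circle:
  assumes "\<Lambda> \<in> L_plus A B"
  shows "nonneg_on_circle \<Lambda>"
  unfolding nonneg_on_circle_def
proof (intro allI)
  fix z x
  have "\<Lambda> \<in> Hermitian" "pos_def ((G z)\<^sup>\<dagger> ** \<Lambda> ** G z)"
    using assms by (auto simp: L_plus_eq)
  then show "0 \<le> (G z *v x) \<bullet> (\<Lambda> *v (G z *v x))"
    by (cases "x = 0") (auto simp: pos_def_compression_iff intro: less_imp_le)
qed

lemma closed_nonneg_on_circle: "closed {\<Lambda>. nonneg_on_circle \<Lambda>}"
  unfolding nonneg_on_circle_def
  by (intro closed_Collect_all closed_Collect_le continuous_intros)

text \<open>Here \<open>S \<bullet> \<Lambda> = \<integral> \<Phi> \<bullet> (G\<^sup>\<dagger> \<Lambda> G)\<close> for the density \<open>\<Phi>\<close> of \<open>positive_density\<close>.\<close>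

lemma Range_Gamma_plus_inner_pos:
  assumes S: "S \<in> Range_Gamma_plus A B"
    and \<Lambda>: "\<Lambda> \<in> Range_Gamma A B" "nonneg_on_circle \<Lambda>" "\<Lambda> \<noteq> 0"
  shows "0 < S \<bullet> \<Lambda>"
proof -
  have "S \<in> Range_Gamma A B" "pos_def S" using S by (auto simp: Range_Gamma_plus_def)
  then obtain \<Phi> where \<Phi>: "continuous_on UNIV \<Phi>" "\<And>z. pos_def (\<Phi> z)" "Gamma A B \<Phi> = S"
    using positive_density by metis
  define f where "f z = \<Phi> z \<bullet> ((G z)\<^sup>\<dagger> ** \<Lambda> ** G z)" for z
  have cf: "continuous_on UNIV f"
    unfolding f_def by (intro continuous_intros \<Phi>)
  have psd: "pos_semidef ((G z)\<^sup>\<dagger> ** \<Lambda> ** G z)" for z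
    by (intro nonneg_on_circle_pos_semidef Range_Gamma_Hermitian \<Lambda>)
  have nonneg: "0 \<le> f z" for z
    unfolding f_def by (rule pos_def_inner_pos_semidef(1)[OF \<Phi>(2) psd])
  have eq: "S \<bullet> \<Lambda> = circle_integral f"
    using Gamma_inner[OF \<Phi>(1), of \<Lambda>] by (simp add: \<Phi>(3) f_def[abs_def])
  have "circle_integral f \<noteq> 0"
  proof
    assume "circle_integral f = 0"
    then have "f z = 0" for z using circle_integral_nonneg_eq_0[OF cf nonneg] by blast
    then have "(G z)\<^sup>\<dagger> ** \<Lambda> ** G z = 0" for z
      using pos_def_inner_pos_semidef(2)[OF \<Phi>(2) psd, of z z] by (simp add: f_def)
    with Range_Gamma_compression_eq_0[OF \<Lambda>(1)] \<Lambda>(3) show False by blast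
  qed
  then show ?thesis
    unfolding eq using circle_integral_nonneg[OF cf nonneg] by simp
qed

text \<open>Compactness of the unit sphere makes the positivity uniform.\<close>

lemma Range_Gamma_plus_coercive:
  assumes S: "S \<in> Range_Gamma_plus A B"
  obtains c where "c > 0"
    "\<And>\<Lambda>. \<Lambda> \<in> Range_Gamma A B \<Longrightarrow> nonneg_on_circle \<Lambda> \<Longrightarrow> c * norm \<Lambda> \<le> S \<bullet> \<Lambda>"
proof -
  define C where "C = Range_Gamma A B \<inter> {\<Lambda>. nonneg_on_circle \<Lambda>} \<inter> sphere 0 1"
  have "compact C"
    unfolding C_def
    by (intro closed_Int_compact closed_Int closed_subspace subspace_Range_Gamma closed_nonneg_on_circle
        compact_sphere)
  have "\<exists>c>0. \<forall>\<Lambda>\<in>C. c \<le> S \<bullet> \<Lambda>"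
  proof (cases "C = {}")
    case False
    obtain \<Lambda>0 where \<Lambda>0: "\<Lambda>0 \<in> C" "\<forall>\<Lambda>\<in>C. S \<bullet> \<Lambda>0 \<le> S \<bullet> \<Lambda>"
      using continuous_attains_inf[OF \<open>compact C\<close> False
          continuous_on_inner[OF continuous_on_const continuous_on_id]] by blast
    then have "0 < S \<bullet> \<Lambda>0" by (intro Range_Gamma_plus_inner_pos S) (auto simp: C_def)
    then show ?thesis using \<Lambda>0 by blast
  qed (auto intro: exI[of _ 1])
  then obtain c where c: "c > 0" "\<And>\<Lambda>. \<Lambda> \<in> C \<Longrightarrow> c \<le> S \<bullet> \<Lambda>" by blast
  have "c * norm \<Lambda> \<le> S \<bullet> \<Lambda>" if \<Lambda>: "\<Lambda> \<in> Range_Gamma A B" "nonneg_on_circle \<Lambda>" for \<Lambda>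
  proof (cases "\<Lambda> = 0")
    case False
    let ?N = "(1 / norm \<Lambda>) *\<^sub>R \<Lambda>"
    have "0 \<le> v \<bullet> (?N *v v)" if "0 \<le> v \<bullet> (\<Lambda> *v v)" for v
      using that by (simp add: bounded_bilinear.scaleR_left[OF bounded_bilinear_matrix_vector_mult])
    then have "?N \<in> C"
      using \<Lambda> False subspace_scale[OF subspace_Range_Gamma]
      by (simp add: C_def nonneg_on_circle_def)
    from c(2)[OF this] show ?thesis using False by (simp add: pos_le_divide_eq)
  qed simp
  then show ?thesis using that c(1) by blast
qed

text \<open>The sequence is bounded by coercivity and \<open>moment_map_inner\<close>, so a subsequence has a limit \<open>\<Lambda>\<close> with
  non-negative forms on the circle.  If a form vanished, then for the vector \<open>u\<close> of
  \<open>singular_blow_up\<close> the numbers \<open>u \<bullet> (S\<^sub>k u) = \<integral> \<psi>\<^sub>k (y \<bullet> Q\<^sub>k\<^sup>-\<^sup>1 y)\<close> would become arbitrarily large, since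
  \<open>y \<bullet> Q\<^sub>k\<^sup>-\<^sup>1 y \<ge> \<parallel>y\<parallel>\<^sup>4 / (y \<bullet> Q\<^sub>k y)\<close> by \<open>pos_def_inverse_form\<close>.\<close>

lemma moment_map_proper:
  assumes \<psi>: "\<And>k. \<psi>s k \<in> C_plus" "\<psi>s \<longlonglongrightarrow> \<psi>" "\<psi> \<in> C_plus"
    and \<Lambda>: "\<And>k. \<Lambda>s k \<in> L_plus_Gamma A B"
    and lim: "(\<lambda>k. moment_map A B (\<psi>s k) (\<Lambda>s k)) \<longlonglongrightarrow> S"
    and S: "S \<in> Range_Gamma_plus A B"
  obtains r \<Lambda> where "strict_mono (r :: nat \<Rightarrow> nat)" "(\<Lambda>s \<circ> r) \<longlonglongrightarrow> \<Lambda>" "\<Lambda> \<in> L_plus_Gamma A B"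
    "moment_map A B \<psi> \<Lambda> = S"
proof -
  let ?V = "Range_Gamma A B"
  define Ss where "Ss k = moment_map A B (\<psi>s k) (\<Lambda>s k)" for k
  have lim: "Ss \<longlonglongrightarrow> S" using lim by (simp add: Ss_def[abs_def])
  have L: "\<Lambda>s k \<in> L_plus A B" and V: "\<Lambda>s k \<in> ?V" for k
    using \<Lambda> by (auto simp: L_plus_Gamma_def)
  have bounded: "\<exists>R. \<forall>\<^sub>F k in sequentially. norm (\<Lambda>s k) \<le> R"
  proof -
    obtain c where c: "c > 0"
      "\<And>\<Lambda>. \<Lambda> \<in> ?V \<Longrightarrow> nonneg_on_circle \<Lambda> \<Longrightarrow> c * norm \<Lambda> \<le> S \<bullet> \<Lambda>"
      using Range_Gamma_plus_coercive[OF S] by metis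
    have "\<forall>\<^sub>F k in sequentially. dist (Ss k) S < c / 2" "\<forall>\<^sub>F k in sequentially. dist (\<psi>s k) \<psi> < 1"
      using tendstoD[OF lim, of "c / 2"] tendstoD[OF \<psi>(2), of 1] c(1) by auto
    then have "\<forall>\<^sub>F k in sequentially. norm (\<Lambda>s k) \<le> 2 * (CARD('m) * (norm \<psi> + 1)) / c"
    proof eventually_elim
      case (elim k)
      have "c * norm (\<Lambda>s k) \<le> S \<bullet> \<Lambda>s k"
        by (intro c(2) V L_plus_nonneg_on_circle L)
      also have "\<dots> = Ss k \<bullet> \<Lambda>s k + (S - Ss k) \<bullet> \<Lambda>s k"
        by (simp add: inner_diff_left)
      also have "(S - Ss k) \<bullet> \<Lambda>s k \<le> norm (S - Ss k) * norm (\<Lambda>s k)"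
        by (rule norm_cauchy_schwarz)
      also have "\<dots> \<le> c / 2 * norm (\<Lambda>s k)"
        using elim(1) by (intro mult_right_mono) (auto simp: dist_norm norm_minus_commute)
      finally have "c / 2 * norm (\<Lambda>s k) \<le> Ss k \<bullet> \<Lambda>s k" by simp
      also have "\<dots> = CARD('m) * circle_integral (apply_bcontfun (\<psi>s k))"
        unfolding Ss_def by (rule moment_map_inner[OF L])
      also have "\<dots> \<le> CARD('m) * (norm \<psi> + 1)"
      proof (rule mult_left_mono)
        have "norm (circle_integral (apply_bcontfun (\<psi>s k))) \<le> norm (\<psi>s k)"
          by (intro circle_integral_norm_le norm_bounded continuous_on_apply_bcontfun)
        moreover have "norm (\<psi>s k) \<le> norm \<psi> + 1"
          using elim(2) norm_triangle_ineq2[of "\<psi>s k" \<psi>] by (simp add: dist_norm)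
        ultimately show "circle_integral (apply_bcontfun (\<psi>s k)) \<le> norm \<psi> + 1" by simp
      qed simp
      finally show ?case using c(1) by (simp add: field_simps)
    qed
    then show ?thesis by blast
  qed
  then obtain R k0 where R: "\<And>k. k \<ge> k0 \<Longrightarrow> norm (\<Lambda>s k) \<le> R"
    unfolding eventually_sequentially by blast
  have "bounded (range (\<lambda>k. \<Lambda>s (k + k0)))"
    using R by (intro boundedI[of _ R]) auto
  then obtain r0 \<Lambda> where r0: "strict_mono (r0 :: nat \<Rightarrow> nat)" "((\<lambda>k. \<Lambda>s (k + k0)) \<circ> r0) \<longlonglongrightarrow> \<Lambda>"
    using bounded_imp_convergent_subsequence by blast
  define r where "r k = r0 k + k0" for k
  have r: "strict_mono r" "(\<Lambda>s \<circ> r) \<longlonglongrightarrow> \<Lambda>"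
    using r0 by (auto simp: r_def strict_mono_def o_def)
  have \<Lambda>V: "\<Lambda> \<in> ?V"
    by (rule closed_sequentially[OF closed_subspace[OF subspace_Range_Gamma] _ r(2)]) (simp add: V)
  have nn: "nonneg_on_circle \<Lambda>"
    using closed_sequentially[OF closed_nonneg_on_circle _ r(2)] L_plus_nonneg_on_circle L by simp
  have h: "\<Lambda> \<in> Hermitian" by (rule Range_Gamma_Hermitian[OF \<Lambda>V])
  have lim\<psi>: "(\<psi>s \<circ> r) \<longlonglongrightarrow> \<psi>" and limS: "(Ss \<circ> r) \<longlonglongrightarrow> S"
    using \<psi>(2) lim r(1) by (auto intro: LIMSEQ_subseq_LIMSEQ)
  have nonsing: "0 < (G z0 *v x) \<bullet> (\<Lambda> *v (G z0 *v x))" if x: "x \<noteq> 0" for z0 x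
  proof (rule ccontr)
    assume "\<not> ?thesis"
    moreover have "0 \<le> (G z0 *v x) \<bullet> (\<Lambda> *v (G z0 *v x))"
      using nn unfolding nonneg_on_circle_def by blast
    ultimately have "(G z0 *v x) \<bullet> (\<Lambda> *v (G z0 *v x)) = 0" by linarith
    then obtain u where u: "\<forall>s. \<exists>e>0. s < circle_integral (\<lambda>z. (((G z)\<^sup>\<dagger> *v u) \<bullet> ((G z)\<^sup>\<dagger> *v u))\<^sup>2
        / (e + \<bar>(G z *v ((G z)\<^sup>\<dagger> *v u)) \<bullet> (\<Lambda> *v (G z *v ((G z)\<^sup>\<dagger> *v u)))\<bar>))"
      using singular_blow_up[OF x] by blast
    define y where "y z = (G z)\<^sup>\<dagger> *v u" for z
    define w where "w z = G z *v y z" for z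
    define q where "q z = w z \<bullet> (\<Lambda> *v w z)" for z
    have cy: "continuous_on UNIV y" unfolding y_def by (intro continuous_intros)
    then have cw: "continuous_on UNIV w" unfolding w_def by (intro continuous_intros)
    then have cq: "continuous_on UNIV q" unfolding q_def by (intro continuous_intros)
    obtain p where p: "p > 0" "\<And>z. p \<le> apply_bcontfun \<psi> z"
      using C_plus_lower_bound[OF \<psi>(3)] by blast
    \<comment> \<open>\<open>p / 2\<close> will bound the weights from below and \<open>u \<bullet> S u + 1\<close> the moments from above, so this value contradicts the final estimate\<close>
    obtain e where e: "e > 0"
      "2 * (u \<bullet> (S *v u) + 1) / p < circle_integral (\<lambda>z. (y z \<bullet> y z)\<^sup>2 / (e + \<bar>q z\<bar>))"
      using u[rule_format, of "2 * (u \<bullet> (S *v u) + 1) / p"] unfolding q_def w_def y_def by blast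
    obtain W where W: "W > 0" "\<And>z. norm (w z) \<le> W"
      using circle_continuous_bounded[OF cw] by (auto simp: bounded_pos)
    obtain D where D: "D > 0" "\<And>(M :: complex^'n^'n) x. norm (M *v x) \<le> norm M * norm x * D"
      using bounded_bilinear.pos_bounded[OF bounded_bilinear_matrix_vector_mult] by blast
    have "(\<lambda>k. u \<bullet> ((Ss \<circ> r) k *v u)) \<longlonglongrightarrow> u \<bullet> (S *v u)"
      by (rule bounded_linear.tendsto[OF bounded_linear_quadratic_form limS])
    then have "\<forall>\<^sub>F k in sequentially. u \<bullet> ((Ss \<circ> r) k *v u) < u \<bullet> (S *v u) + 1"
      by (rule order_tendstoD) simp
    moreover have "\<forall>\<^sub>F k in sequentially. dist ((\<Lambda>s \<circ> r) k) \<Lambda> < e / (W * W * D)"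
      using W D e by (intro tendstoD[OF r(2)]) simp
    moreover have "\<forall>\<^sub>F k in sequentially. dist ((\<psi>s \<circ> r) k) \<psi> < p / 2"
      using p by (intro tendstoD[OF lim\<psi>]) simp
    ultimately have "\<forall>\<^sub>F k in sequentially. u \<bullet> (Ss (r k) *v u) < u \<bullet> (S *v u) + 1
        \<and> dist (\<Lambda>s (r k)) \<Lambda> < e / (W * W * D) \<and> dist (\<psi>s (r k)) \<psi> < p / 2"
      by eventually_elim simp
    then obtain k where k: "u \<bullet> (Ss (r k) *v u) < u \<bullet> (S *v u) + 1"
        "dist (\<Lambda>s (r k)) \<Lambda> < e / (W * W * D)" "dist (\<psi>s (r k)) \<psi> < p / 2"
      using eventually_happens'[OF sequentially_bot] by blast
    let ?M = "\<Lambda>s (r k)" and ?Q = "\<lambda>z. (G z)\<^sup>\<dagger> ** \<Lambda>s (r k) ** G z" and ?\<psi> = "\<psi>s (r k)"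
    have near: "w z \<bullet> (?M *v w z) \<le> e + \<bar>q z\<bar>" for z
    proof -
      have "w z \<bullet> (?M *v w z) = q z + w z \<bullet> ((?M - \<Lambda>) *v w z)"
        by (simp add: q_def matrix_vector_mult_diff_rdistrib inner_diff_right)
      also have "w z \<bullet> ((?M - \<Lambda>) *v w z) \<le> norm (w z) * norm ((?M - \<Lambda>) *v w z)"
        by (rule norm_cauchy_schwarz)
      also have "\<dots> \<le> norm (w z) * (norm (?M - \<Lambda>) * norm (w z) * D)"
        by (intro mult_left_mono D) simp
      also have "\<dots> = norm (w z) * norm (w z) * (norm (?M - \<Lambda>) * D)" by simp
      also have "\<dots> \<le> W * W * (norm (?M - \<Lambda>) * D)"
        using W D by (intro mult_right_mono mult_mono) auto
      also have "\<dots> \<le> e"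
        using k(2) W D by (simp add: dist_norm pos_less_divide_eq mult_ac)
      finally show ?thesis by simp
    qed
    have pd: "pos_def (?Q z)" for z by (rule L_plus_pos_def[OF L])
    define g where "g z = apply_bcontfun ?\<psi> z * (y z \<bullet> (matrix_inv (?Q z) *v y z))" for z
    have cg: "continuous_on UNIV g"
      unfolding g_def by (intro continuous_intros cy continuous_on_apply_bcontfun pos_def_invertible pd)
    have lower: "p / 2 * ((y z \<bullet> y z)\<^sup>2 / (e + \<bar>q z\<bar>)) \<le> g z" for z
    proof -
      let ?b = "y z \<bullet> (matrix_inv (?Q z) *v y z)"
      have b: "0 \<le> ?b"
        using pos_def_imp_pos_semidef[OF pos_def_matrix_inv[OF pd]] by (simp add: pos_semidef_def)
      have "(y z \<bullet> y z)\<^sup>2 \<le> (y z \<bullet> (?Q z *v y z)) * ?b"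
        by (rule pos_def_inverse_form[OF pd])
      also have "y z \<bullet> (?Q z *v y z) = w z \<bullet> (?M *v w z)"
        by (simp add: w_def inner_matrix_vector_mult matrix_vector_mul_assoc matrix_mul_assoc)
      also have "\<dots> * ?b \<le> (e + \<bar>q z\<bar>) * ?b"
        by (intro mult_right_mono near b)
      finally have 1: "(y z \<bullet> y z)\<^sup>2 / (e + \<bar>q z\<bar>) \<le> ?b"
        using e(1) by (simp add: pos_divide_le_eq add_pos_nonneg mult.commute)
      have 2: "p / 2 \<le> apply_bcontfun ?\<psi> z"
        using dist_fun_lt_imp_dist_val_lt[OF k(3), of z] p(2)[of z] unfolding dist_real_def by linarith
      show ?thesis
        unfolding g_def using 1 2 p(1) e(1) by (intro mult_mono) auto
    qed
    define f where "f z = (y z \<bullet> y z)\<^sup>2 / (e + \<bar>q z\<bar>)" for z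
    have "e + \<bar>q z\<bar> \<noteq> 0" for z using e(1) by (metis abs_ge_zero add_pos_nonneg less_irrefl)
    then have cf: "continuous_on UNIV f"
      unfolding f_def by (intro continuous_intros cy cq) auto
    have "p / 2 * circle_integral f = circle_integral (\<lambda>z. p / 2 * f z)"
      by (rule circle_integral_linear[OF cf bounded_linear_mult_right, symmetric])
    also have "\<dots> \<le> circle_integral g"
      by (intro circle_integral_mono cg continuous_on_mult continuous_on_const cf)
         (use lower in \<open>simp add: f_def\<close>)
    also have "\<dots> = u \<bullet> (Ss (r k) *v u)"
      unfolding Ss_def moment_map_quadratic_form[OF L] by (simp add: g_def[abs_def] y_def)
    also have "\<dots> < u \<bullet> (S *v u) + 1" by (rule k(1))
    finally have "circle_integral f < 2 * (u \<bullet> (S *v u) + 1) / p"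
      using p(1) by (simp add: field_simps)
    with e(2) show False by (simp add: f_def[abs_def])
  qed
  have \<Lambda>L: "\<Lambda> \<in> L_plus A B"
    using h nonsing by (simp add: L_plus_eq pos_def_compression_iff)
  have "(\<lambda>k. moment_map A B (fst ((\<psi>s \<circ> r) k, (\<Lambda>s \<circ> r) k)) (snd ((\<psi>s \<circ> r) k, (\<Lambda>s \<circ> r) k)))
      \<longlonglongrightarrow> moment_map A B (fst (\<psi>, \<Lambda>)) (snd (\<psi>, \<Lambda>))"
    by (rule continuous_on_tendsto_compose[OF continuous_moment_map])
       (simp_all add: L \<Lambda>L tendsto_Pair lim\<psi>[unfolded o_def] r(2)[unfolded o_def])
  then have "(Ss \<circ> r) \<longlonglongrightarrow> moment_map A B \<psi> \<Lambda>" by (simp add: Ss_def o_def)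
  then have "moment_map A B \<psi> \<Lambda> = S" using limS LIMSEQ_unique by blast
  then show ?thesis
    using that r \<Lambda>L \<Lambda>V by (simp add: L_plus_Gamma_def)
qed

section \<open>Existence and uniqueness of solutions\<close>

text \<open>If \<open>u \<bullet> (moment u) = 0\<close>, then \<open>G\<^sup>\<dagger> u = 0\<close> on the whole circle, and every element of the range
  annihilates \<open>u\<close>; this is impossible when the range contains a positive definite \<open>S\<close>.\<close>

lemma moment_map_Range_Gamma_plus:
  assumes S: "S \<in> Range_Gamma_plus A B" and \<psi>: "\<psi> \<in> C_plus" and \<Lambda>: "\<Lambda> \<in> L_plus A B"
  shows "moment_map A B \<psi> \<Lambda> \<in> Range_Gamma_plus A B"
proof -
  obtain \<Phi> where \<Phi>: "\<Phi> \<in> C_Hermitian" and SG: "S = Gamma A B \<Phi>" and Spd: "pos_def S"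
    using S by (auto simp: Range_Gamma_plus_def Range_Gamma_def)
  have R: "moment_map A B \<psi> \<Lambda> \<in> Range_Gamma A B" by (rule moment_map_range[OF \<Lambda>])
  have "0 < u \<bullet> (moment_map A B \<psi> \<Lambda> *v u)" if "u \<noteq> 0" for u
  proof -
    define y where "y z = (G z)\<^sup>\<dagger> *v u" for z
    define f where "f z = apply_bcontfun \<psi> z * (y z \<bullet> (matrix_inv ((G z)\<^sup>\<dagger> ** \<Lambda> ** G z) *v y z))" for z
    have cy: "continuous_on UNIV y" unfolding y_def by (intro continuous_intros)
    have cf: "continuous_on UNIV f"
      unfolding f_def
      by (intro continuous_intros cy continuous_on_apply_bcontfun pos_def_invertible L_plus_pos_def \<Lambda>)
    have pos: "0 < f z" if "y z \<noteq> 0" for z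
      using \<psi> that pos_def_matrix_inv[OF L_plus_pos_def[OF \<Lambda>, of z]]
      by (simp add: f_def C_plus_def pos_def_iff)
    then have nonneg: "0 \<le> f z" for z
      by (cases "y z = 0") (auto simp: f_def intro: less_imp_le)
    have eq: "u \<bullet> (moment_map A B \<psi> \<Lambda> *v u) = circle_integral f"
      unfolding moment_map_quadratic_form[OF \<Lambda>] by (simp add: f_def[abs_def] y_def)
    have "circle_integral f \<noteq> 0"
    proof
      assume "circle_integral f = 0"
      then have "f z = 0" for z using circle_integral_nonneg_eq_0[OF cf nonneg] by blast
      then have y0: "y z = 0" for z using pos[of z] by force
      have c: "continuous_on UNIV (\<lambda>z. G z ** \<Phi> z ** (G z)\<^sup>\<dagger>)"
        using \<Phi> by (intro continuous_intros) (simp add: C_Hermitian_def)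
      have "(G z ** \<Phi> z ** (G z)\<^sup>\<dagger>) *v u = (G z ** \<Phi> z) *v y z" for z
        by (simp add: y_def matrix_vector_mul_assoc matrix_mul_assoc)
      then have z0: "u \<bullet> ((G z ** \<Phi> z ** (G z)\<^sup>\<dagger>) *v u) = 0" for z by (simp add: y0)
      have "u \<bullet> (S *v u) = circle_integral (\<lambda>z. u \<bullet> ((G z ** \<Phi> z ** (G z)\<^sup>\<dagger>) *v u))"
        unfolding SG Gamma_eq
        by (rule circle_integral_linear[OF c bounded_linear_quadratic_form, symmetric])
      also have "\<dots> = 0" by (simp only: z0 circle_integral_const)
      finally show False using Spd \<open>u \<noteq> 0\<close> unfolding pos_def_iff by (metis less_irrefl)
    qed
    then show ?thesis unfolding eq using circle_integral_nonneg[OF cf nonneg] by simp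
  qed
  then show ?thesis
    using R Range_Gamma_Hermitian[OF R] by (simp add: Range_Gamma_plus_def pos_def_iff)
qed

lemma convex_Range_Gamma_plus: "convex (Range_Gamma_plus A B)"
proof -
  have "convex {S :: complex^'n^'n. pos_def S}"
    unfolding convex_alt
  proof (intro ballI allI impI, elim conjE)
    fix S S' :: "complex^'n^'n" and t :: real
    assume S: "S \<in> {S. pos_def S}" "S' \<in> {S. pos_def S}" and t: "0 \<le> t" "t \<le> 1"
    have "0 < x \<bullet> (((1 - t) *\<^sub>R S + t *\<^sub>R S') *v x)" if "x \<noteq> 0" for x
    proof -
      have 1: "0 < x \<bullet> (S *v x)" "0 < x \<bullet> (S' *v x)"
        using S that by (auto simp: pos_def_iff)
      have "x \<bullet> (((1 - t) *\<^sub>R S + t *\<^sub>R S') *v x) = (1 - t) * (x \<bullet> (S *v x)) + t * (x \<bullet> (S' *v x))"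
        by (simp add: matrix_vector_mult_add_rdistrib inner_add_right
            bounded_bilinear.scaleR_left[OF bounded_bilinear_matrix_vector_mult])
      also have "0 < \<dots>"
      proof (cases "t = 0")
        case False
        then show ?thesis using 1 t by (intro add_nonneg_pos mult_nonneg_nonneg mult_pos_pos) auto
      qed (use 1 in simp)
      finally show ?thesis .
    qed
    then show "(1 - t) *\<^sub>R S + t *\<^sub>R S' \<in> {S. pos_def S}"
      using S by (simp add: pos_def_iff Hermitian_def conj_transpose_add conj_transpose_scaleR)
  qed
  then show ?thesis
    unfolding Range_Gamma_plus_def
    by (rule convex_Int[OF subspace_imp_convex[OF subspace_Range_Gamma]])
qed

text \<open>The image of the moment map is non-empty, open by invariance of domain and closed by properness in the
  connected set of positive definite elements of the range.\<close>

theorem moment_map_ex1: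
  assumes S: "S \<in> Range_Gamma_plus A B" and \<psi>: "\<psi> \<in> C_plus"
  shows "\<exists>!\<Lambda>. \<Lambda> \<in> L_plus_Gamma A B \<and> moment_map A B \<psi> \<Lambda> = S"
proof -
  let ?V = "Range_Gamma A B" and ?R = "Range_Gamma_plus A B"
  define I where "I = moment_map A B \<psi> ` L_plus_Gamma A B"
  have IR: "I \<subseteq> ?R"
    using moment_map_Range_Gamma_plus[OF S \<psi>] by (auto simp: I_def L_plus_Gamma_def)
  have RV: "?R \<subseteq> ?V" by (auto simp: Range_Gamma_plus_def)
  have cont: "continuous_on (L_plus_Gamma A B) (moment_map A B \<psi>)"
    using continuous_on_compose2[OF continuous_moment_map, of "L_plus_Gamma A B" "\<lambda>\<Lambda>. (\<psi>, \<Lambda>)"]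
    by (force intro: continuous_intros simp: L_plus_Gamma_def)
  have "openin (top_of_set ?V) I"
    unfolding I_def
  proof (rule invariance_of_domain_subspaces[OF openin_L_plus_Gamma subspace_Range_Gamma
        subspace_Range_Gamma order_refl cont])
    show "moment_map A B \<psi> \<in> L_plus_Gamma A B \<rightarrow> ?V"
      using moment_map_range by (auto simp: L_plus_Gamma_def)
    show "inj_on (moment_map A B \<psi>) (L_plus_Gamma A B)"
      using moment_map_inj[OF \<psi>] by (auto simp: inj_on_def)
  qed
  then have op: "openin (top_of_set ?R) I" by (rule openin_subset_trans[OF _ IR RV])
  have "I = ?R \<inter> closure I"
  proof
    show "I \<subseteq> ?R \<inter> closure I" using IR closure_subset by blast
    show "?R \<inter> closure I \<subseteq> I"
    proof
      fix S' assume S': "S' \<in> ?R \<inter> closure I"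
      then obtain Ss where Ss: "\<And>k. Ss k \<in> I" "Ss \<longlonglongrightarrow> S'"
        by (auto simp: closure_sequential)
      then obtain \<Lambda>s where \<Lambda>s: "\<And>k. \<Lambda>s k \<in> L_plus_Gamma A B" "\<And>k. Ss k = moment_map A B \<psi> (\<Lambda>s k)"
        unfolding I_def image_iff by metis
      have "(\<lambda>k. moment_map A B \<psi> (\<Lambda>s k)) \<longlonglongrightarrow> S'"
        using Ss(2) by (simp flip: \<Lambda>s(2))
      then obtain \<Lambda> where "\<Lambda> \<in> L_plus_Gamma A B" "moment_map A B \<psi> \<Lambda> = S'"
        using moment_map_proper[of "\<lambda>k. \<psi>" \<psi> \<Lambda>s S'] \<psi> \<Lambda>s(1) S' by (metis IntD1 tendsto_const)
      then show "S' \<in> I" by (auto simp: I_def)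
    qed
  qed
  then have "closedin (top_of_set ?R) I" by (metis closedin_closed_Int closed_closure)
  moreover have "connected ?R" by (intro convex_connected convex_Range_Gamma_plus)
  moreover have "I \<noteq> {}" using L_plus_Gamma_nonempty by (simp add: I_def)
  ultimately have "I = ?R" using op unfolding connected_clopen by blast
  with S have "S \<in> I" by simp
  then obtain \<Lambda> where \<Lambda>: "\<Lambda> \<in> L_plus_Gamma A B" "moment_map A B \<psi> \<Lambda> = S"
    unfolding I_def by blast
  show ?thesis
  proof (rule ex1I[of _ \<Lambda>])
    show "\<Lambda> \<in> L_plus_Gamma A B \<and> moment_map A B \<psi> \<Lambda> = S" using \<Lambda> by blast
    show "\<Lambda>' = \<Lambda>" if "\<Lambda>' \<in> L_plus_Gamma A B \<and> moment_map A B \<psi> \<Lambda>' = S" for \<Lambda>'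
      using moment_map_inj[OF \<psi>] that \<Lambda> by blast
  qed
qed

end

section \<open>Differentiability of the solution map\<close>

lemma subspace_orthogonal_projection:
  fixes V :: "'a::euclidean_space set"
  assumes "subspace V"
  obtains P :: "'a \<Rightarrow> 'a" where "bounded_linear P" "\<And>x. P x \<in> V" "\<And>x. x \<in> V \<Longrightarrow> P x = x"
    "\<And>x y. y \<in> V \<Longrightarrow> (x - P x) \<bullet> y = 0"
proof -
  obtain b where b: "b \<subseteq> V" "pairwise orthogonal b" "\<And>x. x \<in> b \<Longrightarrow> norm x = 1"
    "independent b" "span b = V"
    using orthonormal_basis_subspace[OF assms] by metis
  have fin: "finite b" using b(4) by (rule independent_imp_finite)
  define P where "P x = (\<Sum>i\<in>b. (x \<bullet> i) *\<^sub>R i)" for x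
  have PV: "P x \<in> V" for x
    unfolding P_def using b(1) by (intro subspace_sum assms subspace_scale) auto
  have orth_b: "(x - P x) \<bullet> i = 0" if "i \<in> b" for x i
  proof -
    have "P x \<bullet> i = (\<Sum>j\<in>b. (x \<bullet> j) * (j \<bullet> i))"
      by (simp add: P_def inner_sum_left)
    also have "\<dots> = (\<Sum>j\<in>b. if j = i then x \<bullet> i else 0)"
      using b(2,3) that by (intro sum.cong) (auto simp: pairwise_def orthogonal_def dot_square_norm)
    also have "\<dots> = x \<bullet> i" using that fin by simp
    finally show ?thesis by (simp add: inner_diff_left)
  qed
  have orth: "(x - P x) \<bullet> y = 0" if "y \<in> V" for x y
  proof -
    have "y \<in> span b" using that b(5) by simp
    then have "orthogonal (x - P x) y"
      by (rule orthogonal_to_span) (simp only: orthogonal_def orth_b)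
    then show ?thesis by (simp only: orthogonal_def)
  qed
  have id: "P x = x" if "x \<in> V" for x
  proof -
    have "(x - P x) \<bullet> (x - P x) = 0" by (rule orth[OF subspace_diff[OF assms that PV]])
    then show ?thesis by simp
  qed
  have "linear P"
    by (rule linearI) (simp_all add: P_def inner_add_left scaleR_left_distrib sum.distrib scaleR_right.sum)
  then have "bounded_linear P" by (simp add: linear_conv_bounded_linear)
  then show ?thesis by (rule that[OF _ PV id orth])
qed

text \<open>In finite dimension an injective endomorphism is invertible.  Where \<open>F x\<close> is close to \<open>F a\<close>, it is
  bounded below by \<open>1 / (2 c)\<close> for \<open>c = \<parallel>(F a)\<^sup>-\<^sup>1\<parallel>\<close>, and
  \<open>(F x)\<^sup>-\<^sup>1 - (F a)\<^sup>-\<^sup>1 = (F x)\<^sup>-\<^sup>1 (F a - F x) (F a)\<^sup>-\<^sup>1\<close>.\<close>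

lemma continuous_on_blinfun_inverse:
  fixes F :: "'x::metric_space \<Rightarrow> 'a::euclidean_space \<Rightarrow>\<^sub>L 'a"
  assumes cont: "continuous_on S F" and inj: "\<And>x v. x \<in> S \<Longrightarrow> blinfun_apply (F x) v = 0 \<Longrightarrow> v = 0"
  obtains R :: "'x \<Rightarrow> 'a \<Rightarrow>\<^sub>L 'a" where "continuous_on S R"
    "\<And>x v. x \<in> S \<Longrightarrow> blinfun_apply (R x) (blinfun_apply (F x) v) = v"
    "\<And>x v. x \<in> S \<Longrightarrow> blinfun_apply (F x) (blinfun_apply (R x) v) = v"
proof -
  have "\<exists>r :: 'a \<Rightarrow>\<^sub>L 'a. \<forall>v. blinfun_apply r (blinfun_apply (F x) v) = v \<and> blinfun_apply (F x) (blinfun_apply r v) = v"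
    if "x \<in> S" for x
  proof -
    have lin: "linear (blinfun_apply (F x))"
      by (simp add: bounded_linear.linear blinfun.bounded_linear_right)
    moreover have "inj (blinfun_apply (F x))"
      using inj[OF that] by (simp add: linear_injective_0[OF lin])
    ultimately obtain f where "linear f" "\<forall>v. f (blinfun_apply (F x) v) = v" "\<forall>v. blinfun_apply (F x) (f v) = v"
      using linear_injective_isomorphism by blast
    then show ?thesis
      by (intro exI[of _ "Blinfun f"]) (simp add: bounded_linear_Blinfun_apply linear_conv_bounded_linear)
  qed
  then obtain R :: "'x \<Rightarrow> 'a \<Rightarrow>\<^sub>L 'a" where R: "\<And>x v. x \<in> S \<Longrightarrow> blinfun_apply (R x) (blinfun_apply (F x) v) = v"
    "\<And>x v. x \<in> S \<Longrightarrow> blinfun_apply (F x) (blinfun_apply (R x) v) = v"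
    by metis
  have "(R \<longlongrightarrow> R a) (at a within S)" if a: "a \<in> S" for a
  proof -
    define c where "c = norm (R a)"
    have F: "((\<lambda>x. norm (F x - F a)) \<longlongrightarrow> 0) (at a within S)"
      using cont a by (simp add: continuous_on_def tendsto_norm_zero LIM_zero)
    have "\<forall>\<^sub>F x in at a within S. norm (F x - F a) < 1 / (2 * (c + 1))"
      by (rule order_tendstoD(2)[OF F]) (simp add: c_def add_nonneg_pos)
    then have "\<forall>\<^sub>F x in at a within S. norm (R x - R a) \<le> 2 * c * c * norm (F x - F a)"
      unfolding eventually_at_filter
    proof eventually_elim
      case (elim x)
      show ?case
      proof (intro impI)
        assume "x \<noteq> a" and x: "x \<in> S"
        with elim have small: "norm (F x - F a) < 1 / (2 * (c + 1))" by blast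
        have c0: "0 \<le> c" by (simp add: c_def)
        have "c * norm (F x - F a) \<le> c * (1 / (2 * (c + 1)))"
          using small c0 by (intro mult_left_mono) auto
        also have "\<dots> \<le> 1 / 2" using c0 by (simp add: divide_simps)
        finally have half: "c * norm (F x - F a) \<le> 1 / 2" .
        have low: "norm v \<le> 2 * c * norm (blinfun_apply (F x) v)" for v
        proof -
          have "norm v = norm (blinfun_apply (R a) (blinfun_apply (F a) v))" by (simp add: R a)
          also have "\<dots> \<le> c * norm (blinfun_apply (F a) v)" unfolding c_def by (rule norm_blinfun)
          also have "blinfun_apply (F a) v = blinfun_apply (F x) v - blinfun_apply (F x - F a) v"
            by (simp add: blinfun.diff_left)
          also have "c * norm \<dots> \<le> c * (norm (blinfun_apply (F x) v) + norm (blinfun_apply (F x - F a) v))"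
            using c0 by (intro mult_left_mono norm_triangle_ineq4)
          also have "\<dots> \<le> c * (norm (blinfun_apply (F x) v) + norm (F x - F a) * norm v)"
            using c0 by (intro mult_left_mono add_left_mono norm_blinfun)
          also have "\<dots> = c * norm (blinfun_apply (F x) v) + (c * norm (F x - F a)) * norm v"
            by (simp add: algebra_simps)
          also have "\<dots> \<le> c * norm (blinfun_apply (F x) v) + 1 / 2 * norm v"
            using half by (intro add_left_mono mult_right_mono) auto
          finally show ?thesis by simp
        qed
        have "norm (blinfun_apply (R x - R a) v) \<le> 2 * c * c * norm (F x - F a) * norm v" for v
        proof -
          define w where "w = blinfun_apply (R a) v"
          have "blinfun_apply (F x) (blinfun_apply (R x - R a) v) = - blinfun_apply (F x - F a) w"
            by (simp add: blinfun.diff_left blinfun.diff_right R x a w_def)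
          then have "norm (blinfun_apply (R x - R a) v) \<le> 2 * c * norm (blinfun_apply (F x - F a) w)"
            using low[of "blinfun_apply (R x - R a) v"] by simp
          also have "\<dots> \<le> 2 * c * (norm (F x - F a) * (c * norm v))"
          proof (rule mult_left_mono)
            have "norm (blinfun_apply (F x - F a) w) \<le> norm (F x - F a) * norm w" by (rule norm_blinfun)
            also have "\<dots> \<le> norm (F x - F a) * (c * norm v)"
              unfolding w_def c_def by (intro mult_left_mono norm_blinfun) simp
            finally show "norm (blinfun_apply (F x - F a) w) \<le> norm (F x - F a) * (c * norm v)" .
          qed (use c0 in simp)
          finally show ?thesis by (simp add: mult_ac)
        qed
        then show "norm (R x - R a) \<le> 2 * c * c * norm (F x - F a)"
          using c0 by (intro norm_blinfun_bound) auto
      qed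
    qed
    moreover have "((\<lambda>x. 2 * c * c * norm (F x - F a)) \<longlongrightarrow> 0) (at a within S)"
      using tendsto_mult_right_zero[OF F] by simp
    ultimately have "((\<lambda>x. R x - R a) \<longlongrightarrow> 0) (at a within S)"
      by (rule Lim_null_comparison)
    then show ?thesis by (simp add: LIM_zero_iff)
  qed
  then have "continuous_on S R" by (simp add: continuous_on_def)
  then show ?thesis using that R by blast
qed

text \<open>The factorization form of differentiability (Caratheodory): the error at \<open>y\<close> is
  \<open>(D y - D x) (y - x)\<close>.\<close>

lemma has_derivative_of_difference_factorization:
  fixes f :: "'a::real_normed_vector \<Rightarrow> 'b::real_normed_vector" and D :: "'a \<Rightarrow> 'a \<Rightarrow>\<^sub>L 'b"
  assumes "open U" "x \<in> U" "continuous_on U D"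
    and eq: "\<And>y. y \<in> U \<Longrightarrow> f y - f x = blinfun_apply (D y) (y - x)"
  shows "(f has_derivative blinfun_apply (D x)) (at x)"
  unfolding has_derivative_at_alt
proof (intro conjI allI impI)
  show "bounded_linear (blinfun_apply (D x))" by (rule blinfun.bounded_linear_right)
  fix e :: real assume e: "0 < e"
  obtain d1 where d1: "d1 > 0" "\<And>y. y \<in> U \<Longrightarrow> dist y x < d1 \<Longrightarrow> dist (D y) (D x) < e"
    using assms(2,3) e unfolding continuous_on_iff by metis
  obtain d2 where d2: "d2 > 0" "ball x d2 \<subseteq> U"
    using assms(1,2) open_contains_ball by blast
  show "\<exists>d>0. \<forall>y. norm (y - x) < d \<longrightarrow> norm (f y - f x - blinfun_apply (D x) (y - x)) \<le> e * norm (y - x)"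
  proof (intro exI[of _ "min d1 d2"] conjI allI impI)
    fix y assume y: "norm (y - x) < min d1 d2"
    then have yU: "y \<in> U" using d2(2) by (auto simp: dist_norm norm_minus_commute)
    have "f y - f x - blinfun_apply (D x) (y - x) = blinfun_apply (D y - D x) (y - x)"
      by (simp add: eq[OF yU] blinfun.diff_left)
    then have "norm (f y - f x - blinfun_apply (D x) (y - x)) \<le> norm (D y - D x) * norm (y - x)"
      by (simp only: norm_blinfun)
    also have "\<dots> \<le> e * norm (y - x)"
      using d1(2)[OF yU] y by (intro mult_right_mono) (auto simp: dist_norm)
    finally show "norm (f y - f x - blinfun_apply (D x) (y - x)) \<le> e * norm (y - x)" .
  qed (use d1 d2 in simp)
qed

context stable_system
begin

lemma bounded_linear_secant_op:
  assumes "\<Lambda> \<in> L_plus A B" "M \<in> L_plus A B"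
  shows "bounded_linear (secant_op \<psi> \<Lambda> M)"
proof -
  have c: "continuous_on UNIV (\<lambda>z. apply_bcontfun \<psi> z *\<^sub>R (moment_kernel M z ** X ** moment_kernel \<Lambda> z))" for X
    by (intro continuous_on_scaleR continuous_on_apply_bcontfun continuous_intros continuous_moment_kernel assms)
  have "linear (secant_op \<psi> \<Lambda> M)"
  proof (rule linearI)
    show "secant_op \<psi> \<Lambda> M (X + Y) = secant_op \<psi> \<Lambda> M X + secant_op \<psi> \<Lambda> M Y" for X Y
      unfolding secant_op_def circle_integral_add[OF c c, symmetric]
      by (simp add: matrix_mult_simps scaleR_add_right)
    show "secant_op \<psi> \<Lambda> M (r *\<^sub>R X) = r *\<^sub>R secant_op \<psi> \<Lambda> M X" for r X
      unfolding secant_op_def circle_integral_linear[OF c bounded_linear_scaleR_right, symmetric]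
      by (simp add: matrix_mult_simps mult.commute)
  qed
  then show ?thesis by (simp add: linear_conv_bounded_linear)
qed

text \<open>The integrand is bilinear in the continuous functions \<open>\<psi> K\<^sub>M\<close> and \<open>K\<^sub>\<Lambda>\<close>.\<close>

lemma continuous_secant_op:
  "continuous_on (UNIV \<times> L_plus A B \<times> L_plus A B) (\<lambda>p. secant_op (fst p) (fst (snd p)) (snd (snd p)) X)"
proof -
  let ?S = "UNIV \<times> L_plus A B \<times> L_plus A B"
  let ?b = "\<lambda>\<psi> k. Bcontfun (\<lambda>z. apply_bcontfun \<psi> z *\<^sub>R apply_bcontfun k z)"
  have "bounded_bilinear (\<lambda>a b :: complex^'n^'n. a ** X ** b)"
    using bounded_bilinear.comp1[OF bounded_bilinear_matrix_mult
        bounded_bilinear.bounded_linear_left[OF bounded_bilinear_matrix_mult]] .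
  note bb = bounded_bilinear_circle_integral[OF this]
  have k1: "continuous_on ?S (\<lambda>p. moment_kernel_fun (fst (snd p)))" and k2: "continuous_on ?S (\<lambda>p. moment_kernel_fun (snd (snd p)))"
    by (rule continuous_on_compose2[OF continuous_moment_kernel_fun]; (intro continuous_intros)?; force)+
  have "continuous_on ?S (\<lambda>p. circle_integral (\<lambda>z. apply_bcontfun (?b (fst p) (moment_kernel_fun (snd (snd p)))) z ** X
      ** apply_bcontfun (moment_kernel_fun (fst (snd p))) z))"
    by (intro bounded_bilinear.continuous_on[OF bb] k1
        bounded_bilinear.continuous_on[OF bounded_bilinear_bcontfun[OF bounded_bilinear_scaleR]] k2
        continuous_on_fst continuous_on_id)
  then show ?thesis
    by (rule continuous_on_eq)
       (auto simp: secant_op_def apply_moment_kernel_fun apply_bcontfun_circle continuous_scaled_moment_kernel matrix_mult_simps)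
qed

text \<open>A sequence of solutions that stayed away from the expected limit would, by properness, have a
  subsequence that converges to a second solution.\<close>

lemma moment_solution_continuous:
  assumes S: "S \<in> Range_Gamma_plus A B"
    and s: "\<And>\<psi>. \<psi> \<in> C_plus \<Longrightarrow> s \<psi> \<in> L_plus_Gamma A B"
      "\<And>\<psi>. \<psi> \<in> C_plus \<Longrightarrow> moment_map A B \<psi> (s \<psi>) = S"
  shows "continuous_on C_plus s"
proof (rule continuous_on_sequentiallyI)
  fix u \<psi> assume u: "\<forall>n. u n \<in> C_plus" and \<psi>: "\<psi> \<in> C_plus" and lim: "u \<longlonglongrightarrow> \<psi>"
  show "(\<lambda>n. s (u n)) \<longlonglongrightarrow> s \<psi>"
  proof (rule tendstoI, rule ccontr)
    fix e :: real assume e: "0 < e" and "\<not> (\<forall>\<^sub>F n in sequentially. dist (s (u n)) (s \<psi>) < e)"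
    then obtain r :: "nat \<Rightarrow> nat" where r: "strict_mono r" "\<And>n. \<not> dist (s (u (r n))) (s \<psi>) < e"
      using not_eventually_sequentiallyD by blast
    have lim': "(\<lambda>n. u (r n)) \<longlonglongrightarrow> \<psi>"
      using LIMSEQ_subseq_LIMSEQ[OF lim r(1)] by (simp add: o_def)
    have limS: "(\<lambda>n. moment_map A B (u (r n)) (s (u (r n)))) \<longlonglongrightarrow> S"
      using u s(2) by simp
    obtain r' \<Lambda> where r': "strict_mono (r' :: nat \<Rightarrow> nat)" "((\<lambda>n. s (u (r n))) \<circ> r') \<longlonglongrightarrow> \<Lambda>"
        "\<Lambda> \<in> L_plus_Gamma A B" "moment_map A B \<psi> \<Lambda> = S"
      by (rule moment_map_proper[OF _ lim' \<psi> _ limS S]) (use u s(1) in auto)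
    have "\<Lambda> = s \<psi>"
      using moment_map_inj[OF \<psi> r'(3) s(1)[OF \<psi>]] r'(4) s(2)[OF \<psi>] by simp
    then have "\<forall>\<^sub>F n in sequentially. dist (((\<lambda>n. s (u (r n))) \<circ> r') n) (s \<psi>) < e"
      using tendstoD[OF r'(2) e] by simp
    then show False using r(2) by (auto simp: eventually_sequentially)
  qed
qed

text \<open>For \<open>M \<noteq> \<Lambda>\<close> the secant operator does not preserve the range of \<open>\<Gamma>\<close>, because \<open>K\<^sub>M X K\<^sub>\<Lambda>\<close> is in general
  not Hermitian.  Hence it is compressed by the orthogonal projection \<open>P\<close> and extended by the identity
  on the orthogonal complement; the resulting endomorphism is injective by \<open>secant_op_pos\<close>, and its
  inverse still maps the difference of the weights to the difference of the solutions, since both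
  \<open>s \<phi> - s \<psi>\<close> and the moment of \<open>\<phi> - \<psi>\<close> lie in the range.\<close>

theorem moment_solution_C1:
  assumes S: "S \<in> Range_Gamma_plus A B"
    and s: "\<And>\<psi>. \<psi> \<in> C_plus \<Longrightarrow> s \<psi> \<in> L_plus_Gamma A B"
      "\<And>\<psi>. \<psi> \<in> C_plus \<Longrightarrow> moment_map A B \<psi> (s \<psi>) = S"
  shows "C1_map C_plus (Range_Gamma A B) (L_plus_Gamma A B) s"
proof -
  let ?V = "Range_Gamma A B" and ?L = "L_plus_Gamma A B"
  note V = subspace_Range_Gamma
  have LL: "\<Lambda> \<in> L_plus A B" and LV: "\<Lambda> \<in> ?V" if "\<Lambda> \<in> ?L" for \<Lambda>
    using that by (auto simp: L_plus_Gamma_def)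
  have cs: "continuous_on C_plus s" by (rule moment_solution_continuous[OF S s])
  obtain P where P: "bounded_linear P" "\<And>X. P X \<in> ?V" "\<And>X. X \<in> ?V \<Longrightarrow> P X = X"
      "\<And>X Y. Y \<in> ?V \<Longrightarrow> (X - P X) \<bullet> Y = 0"
    using subspace_orthogonal_projection[OF V] by blast
  define Dom where "Dom = C_plus \<times> ?L \<times> ?L"
  define E where "E p = (\<lambda>X. P (secant_op (fst p) (fst (snd p)) (snd (snd p)) (P X)) + (X - P X))" for p
  define F where "F p = Blinfun (E p)" for p
  have F: "blinfun_apply (F p) = E p" if "p \<in> Dom" for p
  proof -
    have "bounded_linear (secant_op (fst p) (fst (snd p)) (snd (snd p)))"
      using that by (intro bounded_linear_secant_op) (auto simp: Dom_def LL)
    then have "bounded_linear (E p)"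
      unfolding E_def
      by (intro bounded_linear_add bounded_linear_sub bounded_linear_ident P(1)
          bounded_linear_compose[OF P(1)] bounded_linear_compose[OF _ P(1)])
    then show ?thesis by (simp add: F_def bounded_linear_Blinfun_apply)
  qed
  have "continuous_on Dom F"
  proof (rule continuous_on_blinfun_componentwise)
    fix i :: "complex^'n^'n"
    have "continuous_on Dom (\<lambda>p. secant_op (fst p) (fst (snd p)) (snd (snd p)) (P i))"
      by (rule continuous_on_subset[OF continuous_secant_op]) (auto simp: Dom_def LL)
    then have "continuous_on Dom (\<lambda>p. E p i)"
      unfolding E_def
      by (intro continuous_on_add continuous_on_const bounded_linear.continuous_on[OF P(1)])
    then show "continuous_on Dom (\<lambda>p. blinfun_apply (F p) i)"
      by (rule continuous_on_eq) (simp add: F)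
  qed
  moreover have "X = 0" if p: "p \<in> Dom" and 0: "blinfun_apply (F p) X = 0" for p X
  proof -
    obtain \<psi> \<Lambda> M where p_eq: "p = (\<psi>, \<Lambda>, M)" by (metis prod_cases3)
    have mem: "\<psi> \<in> C_plus" "\<Lambda> \<in> L_plus A B" "M \<in> L_plus A B"
      using p by (auto simp: p_eq Dom_def LL)
    have eq: "P (secant_op \<psi> \<Lambda> M (P X)) + (X - P X) = 0" using 0 F[OF p] by (simp add: E_def p_eq)
    have "(X - P X) \<bullet> (X - P X) = (X - P X) \<bullet> (P (secant_op \<psi> \<Lambda> M (P X)) + (X - P X))"
      using P(4)[OF P(2)] by (simp add: inner_add_right)
    then have "X = P X" by (simp add: eq)
    then have X: "X \<in> ?V" and "P (secant_op \<psi> \<Lambda> M X) = 0" using P(2)[of X] eq by auto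
    then have "X \<bullet> secant_op \<psi> \<Lambda> M X = 0"
      using P(4)[OF X, of "secant_op \<psi> \<Lambda> M X"] by (simp add: inner_commute)
    then show "X = 0" using secant_op_pos[OF mem X] by force
  qed
  ultimately obtain R where R: "continuous_on Dom R"
    "\<And>p X. p \<in> Dom \<Longrightarrow> blinfun_apply (R p) (blinfun_apply (F p) X) = X"
    "\<And>p X. p \<in> Dom \<Longrightarrow> blinfun_apply (F p) (blinfun_apply (R p) X) = X"
    using continuous_on_blinfun_inverse[of Dom F] by blast
  have RV: "blinfun_apply (R p) Y \<in> ?V" if p: "p \<in> Dom" and Y: "Y \<in> ?V" for p Y
  proof -
    let ?X = "blinfun_apply (R p) Y"
    have eq: "P (secant_op (fst p) (fst (snd p)) (snd (snd p)) (P ?X)) + (?X - P ?X) = Y"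
      using R(3)[OF p, of Y] unfolding F[OF p] E_def .
    then have "?X - P ?X = Y - P (secant_op (fst p) (fst (snd p)) (snd (snd p)) (P ?X))"
      by (simp add: algebra_simps)
    then have "?X - P ?X \<in> ?V" using subspace_diff[OF V Y P(2)] by metis
    then have "(?X - P ?X) \<bullet> (?X - P ?X) = 0" by (rule P(4))
    then have "?X = P ?X" by simp
    then show ?thesis using P(2) by metis
  qed
  interpret N: bounded_bilinear "\<lambda>(\<psi> :: circle \<Rightarrow>\<^sub>C real) (k :: circle \<Rightarrow>\<^sub>C (complex^'n^'n)).
      circle_integral (\<lambda>z. apply_bcontfun \<psi> z *\<^sub>R apply_bcontfun k z)"
    by (rule bounded_bilinear_circle_integral[OF bounded_bilinear_scaleR])
  \<comment> \<open>the inner operator sends a variation of the weight to its moment with the kernel of the new solution\<close>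
  define D where "D \<psi> \<phi> = R (\<psi>, s \<psi>, s \<phi>) o\<^sub>L N.prod_left (moment_kernel_fun (s \<phi>))" for \<psi> \<phi>
  have D: "blinfun_apply (D \<psi> \<phi>) h = blinfun_apply (R (\<psi>, s \<psi>, s \<phi>)) (moment_map A B h (s \<phi>))"
    if "\<phi> \<in> C_plus" for \<psi> \<phi> h
    using that s(1) LL by (simp add: D_def moment_map_eq apply_moment_kernel_fun)
  have dom: "(\<psi>, s \<psi>, s \<phi>) \<in> Dom" if "\<psi> \<in> C_plus" "\<phi> \<in> C_plus" for \<psi> \<phi>
    using that s(1) by (simp add: Dom_def)
  have diff: "s \<phi> - s \<psi> = blinfun_apply (D \<psi> \<phi>) (\<phi> - \<psi>)" if "\<psi> \<in> C_plus" "\<phi> \<in> C_plus" for \<psi> \<phi>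
  proof -
    let ?Y = "s \<phi> - s \<psi>"
    have L: "s \<psi> \<in> L_plus A B" "s \<phi> \<in> L_plus A B" using that s(1) LL by auto
    have Y: "?Y \<in> ?V" using that s(1) LV by (intro subspace_diff V) auto
    have "secant_op \<psi> (s \<psi>) (s \<phi>) ?Y = moment_map A B (\<phi> - \<psi>) (s \<phi>)"
      using moment_map_difference[OF L, of \<phi> \<psi>] s(2) that by simp
    then have "blinfun_apply (F (\<psi>, s \<psi>, s \<phi>)) ?Y = moment_map A B (\<phi> - \<psi>) (s \<phi>)"
      using P(3) Y moment_map_range[OF L(2)] unfolding F[OF dom[OF that]] E_def by simp
    then show ?thesis
      using R(2)[OF dom[OF that], of ?Y] by (simp add: D that)
  qed
  have cD: "continuous_on U (\<lambda>x. D (f x) (g x))"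
    if "continuous_on U f" "continuous_on U g" "f ` U \<subseteq> C_plus" "g ` U \<subseteq> C_plus"
    for U :: "(circle \<Rightarrow>\<^sub>C real) set" and f g
  proof -
    have sf: "continuous_on U (\<lambda>x. s (f x))" and sg: "continuous_on U (\<lambda>x. s (g x))"
      using that by (auto intro: continuous_on_compose2[OF cs])
    have "continuous_on U (\<lambda>x. R (f x, s (f x), s (g x)))"
      using that dom by (intro continuous_on_compose2[OF R(1)] continuous_on_Pair sf sg) auto
    moreover have "continuous_on U (\<lambda>x. moment_kernel_fun (s (g x)))"
      using that s(1) LL by (intro continuous_on_compose2[OF continuous_moment_kernel_fun] sg) auto
    ultimately show ?thesis
      unfolding D_def
      by (intro bounded_bilinear.continuous_on[OF bounded_bilinear_blinfun_compose]
          bounded_linear.continuous_on[OF N.bounded_linear_prod_left])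
  qed
  show ?thesis
    unfolding C1_map_def
  proof (intro conjI exI[of _ "\<lambda>\<psi>. D \<psi> \<psi>"] ballI)
    show "open C_plus" by (rule open_C_plus)
    show "subspace ?V" by (rule V)
    then show "closed ?V" by (rule closed_subspace)
    show "openin (top_of_set ?V) ?L" by (rule openin_L_plus_Gamma)
    show "s ` C_plus \<subseteq> ?L" using s(1) by blast
    show "continuous_on C_plus (\<lambda>\<psi>. D \<psi> \<psi>)"
      by (intro cD continuous_on_id) auto
    fix \<psi> :: "circle \<Rightarrow>\<^sub>C real" assume \<psi>: "\<psi> \<in> C_plus"
    show "(s has_derivative blinfun_apply (D \<psi> \<psi>)) (at \<psi>)"
    proof (rule has_derivative_of_difference_factorization[where D = "D \<psi>", OF open_C_plus \<psi>])
      show "continuous_on C_plus (D \<psi>)"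
        using cD[of C_plus "\<lambda>_. \<psi>" "\<lambda>\<phi>. \<phi>"] \<psi> by (auto intro: continuous_intros)
      show "s \<phi> - s \<psi> = blinfun_apply (D \<psi> \<phi>) (\<phi> - \<psi>)" if "\<phi> \<in> C_plus" for \<phi>
        by (rule diff[OF \<psi> that])
    qed
    show "range (blinfun_apply (D \<psi> \<psi>)) \<subseteq> ?V"
      using RV[OF dom[OF \<psi> \<psi>]] moment_map_range LL s(1) \<psi> by (auto simp: D)
  qed
qed

end

lemma full_column_rank_inj:
  fixes B :: "complex^'m^'n"
  assumes "rank B = CARD('m)" "B *v x = 0"
  shows "x = 0"
proof -
  have "vec.span (rows B) = UNIV"
    using assms(1) unfolding row_rank_def_gen
    by (simp add: vec.dim_eq_full[symmetric] card_cart_basis vec.dimension_def)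
  then have "\<exists>C :: complex^'n^'m. C ** B = mat 1"
    by (simp add: matrix_left_invertible_span_rows_gen)
  then show ?thesis using assms(2) matrix_left_invertible_ker by blast
qed

theorem theorem1:
  fixes A :: "complex^'n^'n" and B :: "complex^'m^'n" and \<Sigma> :: "complex^'n^'n"
  assumes "CARD('m) \<le> CARD('n)"
    and "\<And>\<mu>. eigenvalue A \<mu> \<Longrightarrow> norm \<mu> < 1"
    and "rank B = CARD('m)"
    and "reachable A B"
    and "\<Sigma> \<in> Range_Gamma_plus A B"
  shows "(\<forall>\<psi>\<in>C_plus. \<exists>!\<Lambda>. \<Lambda> \<in> L_plus_Gamma A B \<and> moment_map A B \<psi> \<Lambda> = \<Sigma>) \<and>
    C1_map C_plus (Range_Gamma A B) (L_plus_Gamma A B) (\<lambda>\<psi>. s_map A B \<psi> \<Sigma>)"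
proof -
  interpret stable_system A B
    using assms(2) full_column_rank_inj[OF assms(3)] by unfold_locales (auto simp: stable_def)
  have ex1: "\<exists>!\<Lambda>. \<Lambda> \<in> L_plus_Gamma A B \<and> moment_map A B \<psi> \<Lambda> = \<Sigma>" if "\<psi> \<in> C_plus" for \<psi>
    by (rule moment_map_ex1[OF assms(5) that])
  have "s_map A B \<psi> \<Sigma> \<in> L_plus_Gamma A B \<and> moment_map A B \<psi> (s_map A B \<psi> \<Sigma>) = \<Sigma>" if "\<psi> \<in> C_plus" for \<psi>
    unfolding s_map_def by (rule theI'[OF ex1[OF that]])
  then have "C1_map C_plus (Range_Gamma A B) (L_plus_Gamma A B) (\<lambda>\<psi>. s_map A B \<psi> \<Sigma>)"
    by (intro moment_solution_C1[OF assms(5)]) auto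
  then show ?thesis using ex1 by blast
qed

end
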